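(* There exists an absolute constant $C>0$ such that for any two trees $T_1$ and $T_2$, $$\operatorname{gm}(T_1\mathbin{\Box} T_2)\le \operatorname{gm}(T_1\boxtimes T_2)\le \operatorname{tw}(T_1\boxtimes T_2)\le C\cdot \operatorname{gm}(T_1\mathbin{\Box} T_2)^2,$$ i.e. $\operatorname{tw}(T_1\boxtimes T_2)\in O(\operatorname{gm}(T_1\mathbin{\Box} T_2)^2)$.
   Context: All graphs are finite, simple and undirected; $\operatorname{tw}$ denotes treewidth. For a positive integer $k$, the $k\times k$ grid $\boxplus_k$ is the graph with vertex set $\{1,\dots,k\}^2$ in which $(x,y)$ and $(x',y')$ are adjacent iff $|x-x'|+|y-y'|=1$. $\operatorname{gm}(G)$ is the maximum $k$ such that $\boxplus_k$ is a minor of $G$. Both products below have vertex set $V(G_1)\times V(G_2)$. In the Cartesian product $G_1\mathbin{\Box} G_2$, distinct $(u_1,u_2),(v_1,v_2)$ are adjacent iff ($u_1=v_1$ and $u_2v_2\in E(G_2)$) or ($u_2=v_2$ and $u_1v_1\in E(G_1)$). In the strong product $G_1\boxtimes G_2$ they are adjacent iff ($u_1=v_1$ and $u_2v_2\in E(G_2)$) or ($u_2=v_2$ and $u_1v_1\in E(G_1)$) or ($u_1v_1\in E(G_1)$ and $u_2v_2\in E(G_2)$).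
   Formalization: The inequality gm(T1⊠T2) ≤ tw(T1⊠T2) is claimed only when T1 and T2 are not both single vertices (there gm = 1 but tw = 0); the trees are taken, up to isomorphism, with natural numbers as vertices. *)

theory Defs
  imports "Graph_Theory.Graph_Theory"
begin

text \<open>
  A finite simple undirected graph is a \<^locale>\<open>pair_graph\<close>: a finite vertex set with a symmetric
  irreflexive set of arcs, each edge being represented by its two opposite arcs.
\<close>

text \<open>
  The library predicates \<^const>\<open>forest\<close> and \<^const>\<open>tree\<close> are meant for directed graphs: they count
  \<open>[(u,v),(v,u)]\<close> as a cycle, which every edge of a symmetric digraph would give. The cycles of a
  simple undirected graph are exactly the closed walks of this kind of length at least 3.
  Note that \<^const>\<open>connected\<close> implies that there is at least one vertex.
\<close>

definition undirected_tree :: "'a pair_pre_digraph \<Rightarrow> bool" where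
  "undirected_tree T \<longleftrightarrow>
     pair_graph T \<and> connected (with_proj T) \<and>
     (\<nexists>p. pre_digraph.cycle (with_proj T) p \<and> 3 \<le> length p)"

definition cartesian_product ::
    "'a pair_pre_digraph \<Rightarrow> 'b pair_pre_digraph \<Rightarrow> ('a \<times> 'b) pair_pre_digraph" where
  "cartesian_product G1 G2 =
     \<lparr> pverts = pverts G1 \<times> pverts G2,
       parcs = {((u1, u2), (v1, v2)) | u1 u2 v1 v2.
         (u1, u2) \<in> pverts G1 \<times> pverts G2 \<and> (v1, v2) \<in> pverts G1 \<times> pverts G2 \<and>
         (u1 = v1 \<and> (u2, v2) \<in> parcs G2 \<or>
          u2 = v2 \<and> (u1, v1) \<in> parcs G1)} \<rparr>"

definition strong_product ::
    "'a pair_pre_digraph \<Rightarrow> 'b pair_pre_digraph \<Rightarrow> ('a \<times> 'b) pair_pre_digraph" where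
  "strong_product G1 G2 =
     \<lparr> pverts = pverts G1 \<times> pverts G2,
       parcs = {((u1, u2), (v1, v2)) | u1 u2 v1 v2.
         (u1, u2) \<in> pverts G1 \<times> pverts G2 \<and> (v1, v2) \<in> pverts G1 \<times> pverts G2 \<and>
         (u1 = v1 \<and> (u2, v2) \<in> parcs G2 \<or>
          u2 = v2 \<and> (u1, v1) \<in> parcs G1 \<or>
          (u1, v1) \<in> parcs G1 \<and> (u2, v2) \<in> parcs G2)} \<rparr>"

definition grid :: "nat \<Rightarrow> (nat \<times> nat) pair_pre_digraph" where
  "grid k =
     \<lparr> pverts = {1..k} \<times> {1..k},
       parcs = {((x, y), (x', y')) | x y x' y'.
         (x, y) \<in> {1..k} \<times> {1..k} \<and> (x', y') \<in> {1..k} \<times> {1..k} \<and>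
         \<bar>int x - int x'\<bar> + \<bar>int y - int y'\<bar> = 1} \<rparr>"

text \<open>
  A minor is given by its branch sets: pairwise disjoint, connected (hence nonempty) vertex sets
  of the host graph, with an edge between the branch sets of adjacent vertices.
\<close>

definition is_minor :: "'b pair_pre_digraph \<Rightarrow> 'a pair_pre_digraph \<Rightarrow> bool" where
  "is_minor H G \<longleftrightarrow>
     (\<exists>B :: 'b \<Rightarrow> 'a set.
        (\<forall>v \<in> pverts H. B v \<subseteq> pverts G \<and> connected (with_proj G \<restriction> B v)) \<and>
        (\<forall>u \<in> pverts H. \<forall>v \<in> pverts H. u \<noteq> v \<longrightarrow> B u \<inter> B v = {}) \<and>
        (\<forall>(u, v) \<in> parcs H. \<exists>x \<in> B u. \<exists>y \<in> B v. (x, y) \<in> parcs G))"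

text \<open>For a finite graph with at least one vertex, the set below is finite and contains 1.\<close>

definition gm :: "'a pair_pre_digraph \<Rightarrow> nat" where
  "gm G = Max {k. 1 \<le> k \<and> is_minor (grid k) G}"

definition tree_decomposition ::
    "'a pair_pre_digraph \<Rightarrow> 't pair_pre_digraph \<Rightarrow> ('t \<Rightarrow> 'a set) \<Rightarrow> bool" where
  "tree_decomposition G T bag \<longleftrightarrow>
     undirected_tree T \<and>
     (\<Union>t \<in> pverts T. bag t) = pverts G \<and>
     (\<forall>(u, v) \<in> parcs G. \<exists>t \<in> pverts T. u \<in> bag t \<and> v \<in> bag t) \<and>
     (\<forall>v \<in> pverts G. connected (with_proj T \<restriction> {t \<in> pverts T. v \<in> bag t}))"

definition decomposition_width :: "'t pair_pre_digraph \<Rightarrow> ('t \<Rightarrow> 'a set) \<Rightarrow> nat" where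
  "decomposition_width T bag = Max ((\<lambda>t. card (bag t)) ` pverts T) - 1"

text \<open>
  Natural numbers suffice as nodes of the decomposition trees, since these trees are finite.
  The subtraction in the width truncates only for the graph without vertices.
\<close>

definition treewidth :: "'a pair_pre_digraph \<Rightarrow> nat" where
  "treewidth G =
     (LEAST w. \<exists>(T :: nat pair_pre_digraph) bag.
        tree_decomposition G T bag \<and> decomposition_width T bag = w)"

end

theory Submission
  imports Defs Complex_Main
begin

text \<open>
  Since \<open>T\<^sub>1\<close> decomposes the strong product into bags \<open>{t, parent t} \<times> V(T\<^sub>2)\<close>, its treewidth is at most
  \<open>2 n\<close> with \<open>n = min (|T\<^sub>1|, |T\<^sub>2|)\<close>, so that one needs a grid of order \<open>\<Omega>(\<surd>n)\<close> in the Cartesian product.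

  Let \<open>h\<^sub>i\<close> be the number of vertices of height \<open>i\<close> in a rooted tree. As the \<open>h\<^sub>i\<close> add up to the number of
  vertices while \<open>\<Sum> 1/i\<^sup>2\<close> converges, there is a scale \<open>L\<close> with \<open>h\<^bsub>L-1\<^esub> = \<Omega>(n / L\<^sup>2)\<close>. Take the least such
  scales of both trees, the smaller one, \<open>L\<close>, being that of \<open>T\<^sub>1\<close>. Then \<open>T\<^sub>1\<close> contracts to a spider with
  \<open>\<Omega>(n / L\<^sup>2)\<close> legs of length \<open>L\<close>. At least half of the vertices of \<open>T\<^sub>2\<close> have height at least \<open>L - 1\<close>, so that
  \<open>T\<^sub>2\<close> contains \<open>\<Omega>(n / L)\<close> disjoint paths with \<open>L\<close> vertices. A leg times a path contains a grid of order
  \<open>\<Omega>(L)\<close> whose four sides lead to the centre of the spider. Hence \<open>\<Omega>(n / L\<^sup>2)\<close> such blocks can be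
  linked through the copies of the centre and further legs, to form a grid of order \<open>\<Omega>(\<surd>n)\<close>.
\<close>

subsection \<open>Connected sets and minors\<close>

text \<open>The orders balance because about n / L^2 blocks, arranged as a k x k array, have order
  about L each: k L is about the square root of n, whatever L is. Least scales are taken for the
  sake of the tree with the larger one: all its levels below L - 1 are then sparse, and discarding
  them costs at most half of its vertices. Links may cross freely, since every pair of neighbouring
  blocks has legs of its own and all legs hang on the same copies of the centre. The obstacle is
  order: a link carries n strands at once and must deliver the i-th row or column of a block to the
  i-th one of the next. Within one leg, nested strands join two intervals of positions only in the
  order dictated by the sides from which these are approached; a second leg repairs it. Two cases
  fall outside the construction: a tree too low for a spider has at most one vertex at its scale,
  hence few vertices at all, and for bounded L single vertices replace the blocks. The middle
  inequality is a separate matter, the bramble bound for grids, transferred to bags by the Helly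
  property of subtrees.\<close>

definition conn :: "('a \<times> 'a) set \<Rightarrow> 'a set \<Rightarrow> bool" where
  "conn E S \<longleftrightarrow> S \<noteq> {} \<and> (\<forall>x\<in>S. \<forall>y\<in>S. (x, y) \<in> (E \<inter> S \<times> S)\<^sup>*)"

lemma connD: "conn E S \<Longrightarrow> x \<in> S \<Longrightarrow> y \<in> S \<Longrightarrow> (x, y) \<in> (E \<inter> S \<times> S)\<^sup>*"
  by (auto simp: conn_def)

lemma conn_nonempty: "conn E S \<Longrightarrow> S \<noteq> {}"
  by (auto simp: conn_def)

lemma rtrancl_on_Restr: "(x, y) \<in> rtrancl_on V R \<longleftrightarrow> x \<in> V \<and> (x, y) \<in> (R \<inter> V \<times> V)\<^sup>*"
proof
  assume "(x, y) \<in> rtrancl_on V R"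
  then show "x \<in> V \<and> (x, y) \<in> (R \<inter> V \<times> V)\<^sup>*"
  proof (induction rule: rtrancl_on.induct)
    case (rtrancl_on_into_rtrancl_on a b c)
    then have "b \<in> V"
      by (auto elim: rtrancl.cases)
    with rtrancl_on_into_rtrancl_on show ?case
      by (auto intro: rtrancl_into_rtrancl)
  qed auto
next
  assume "x \<in> V \<and> (x, y) \<in> (R \<inter> V \<times> V)\<^sup>*"
  then have "(x, y) \<in> (R \<inter> V \<times> V)\<^sup>*" "x \<in> V" by auto
  then show "(x, y) \<in> rtrancl_on V R"
    by (induction rule: rtrancl_induct) (auto intro: rtrancl_on_into_rtrancl_on)
qed

lemma connected_iff_conn:
  assumes "sym (parcs G)" "S \<subseteq> pverts G"
  shows "connected (with_proj G \<restriction> S) \<longleftrightarrow> conn (parcs G) S"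
proof -
  have "parcs (mk_symmetric (with_proj G \<restriction> S)) = parcs G \<inter> S \<times> S"
    using assms by (auto simp: mk_symmetric_def induce_subgraph_def dest: symD)
  then show ?thesis
    by (auto simp: connected_def strongly_connected_def reachable_def rtrancl_on_Restr conn_def
        induce_subgraph_def Int_absorb1)
qed

lemma connected_whole_iff_conn:
  assumes "sym (parcs G)"
  shows "connected (with_proj G) \<longleftrightarrow> conn (parcs G) (pverts G)"
proof -
  have "parcs (mk_symmetric (with_proj G)) = parcs G"
    using assms by (auto simp: mk_symmetric_def dest: symD)
  then show ?thesis
    by (auto simp: connected_def strongly_connected_def reachable_def rtrancl_on_Restr conn_def)
qed

lemma conn_singleton [simp]: "conn E {x}"
  by (auto simp: conn_def)

text \<open>A walk among the indices lifts to a walk through the sets; most connectedness claims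
  below are instances. The index relation \<open>F\<close> is arbitrary, for example
  \<open>UNIV\<close> if the sets meet pairwise, which is why \<open>conn\<close> speaks of a bare
  relation instead of a graph.\<close>

lemma conn_UN:
  assumes I: "conn F I" and A: "\<And>i. i \<in> I \<Longrightarrow> conn E (A i)"
    and adj: "\<And>i j. (i, j) \<in> F \<Longrightarrow> i \<in> I \<Longrightarrow> j \<in> I \<Longrightarrow>
      A i \<inter> A j \<noteq> {} \<or> (\<exists>x\<in>A i. \<exists>y\<in>A j. (x, y) \<in> E)"
  shows "conn E (\<Union>i\<in>I. A i)"
proof -
  let ?U = "\<Union>i\<in>I. A i" and ?R = "E \<inter> (\<Union>i\<in>I. A i) \<times> (\<Union>i\<in>I. A i)"
  have inner: "(x, y) \<in> ?R\<^sup>*" if "i \<in> I" "x \<in> A i" "y \<in> A i" for i x y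
  proof -
    have "(x, y) \<in> (E \<inter> A i \<times> A i)\<^sup>*"
      using A that by (simp add: connD)
    moreover have "E \<inter> A i \<times> A i \<subseteq> ?R" using that by auto
    ultimately show ?thesis using rtrancl_mono by blast
  qed
  have step: "(x, y) \<in> ?R\<^sup>*" if "(i, j) \<in> (F \<inter> I \<times> I)\<^sup>*" "i \<in> I" "x \<in> A i" "y \<in> A j" for i j x y
    using that(1,4)
  proof (induction arbitrary: y rule: rtrancl_induct)
    case base
    then show ?case using inner that by blast
  next
    case (step j k)
    then have jk: "j \<in> I" "k \<in> I" "(j, k) \<in> F" by auto
    then consider z where "z \<in> A j" "z \<in> A k" | u v where "u \<in> A j" "v \<in> A k" "(u, v) \<in> E"
      using adj by blast
    then show ?case
    proof cases
      case 1
      then show ?thesis using step.IH[of z] inner[of k z y] jk step.prems by auto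
    next
      case 2
      then have "(u, v) \<in> ?R" using jk by auto
      then show ?thesis
        using step.IH[OF 2(1)] inner[OF jk(2) 2(2) step.prems]
        by (meson rtrancl_into_rtrancl rtrancl_trans)
    qed
  qed
  have "(x, y) \<in> ?R\<^sup>*" if "x \<in> ?U" "y \<in> ?U" for x y
    using that step connD[OF I] by blast
  moreover have "?U \<noteq> {}"
    using conn_nonempty[OF I] conn_nonempty[OF A] by auto
  ultimately show ?thesis unfolding conn_def by auto
qed

lemma conn_Un:
  assumes "sym E" "conn E S" "conn E T" "S \<inter> T \<noteq> {} \<or> (\<exists>x\<in>S. \<exists>y\<in>T. (x, y) \<in> E)"
  shows "conn E (S \<union> T)"
proof -
  have "conn E (\<Union>b\<in>(UNIV :: bool set). if b then S else T)"
  proof (rule conn_UN[where F = UNIV])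
    show "conn UNIV (UNIV :: bool set)" by (auto simp: conn_def)
  qed (use assms in \<open>auto split: if_splits dest: symD conn_nonempty\<close>)
  then show ?thesis by (simp add: UNIV_bool Un_commute)
qed

lemma conn_insert:
  assumes "sym E" "conn E S" "x \<in> S" "(x, y) \<in> E"
  shows "conn E (insert y S)"
  using conn_Un[OF assms(1,2) conn_singleton[of E y]] assms by auto

lemma conn_image:
  assumes "conn E S" "\<And>x y. (x, y) \<in> E \<Longrightarrow> x \<in> S \<Longrightarrow> y \<in> S \<Longrightarrow> f x = f y \<or> (f x, f y) \<in> F"
  shows "conn F (f ` S)"
proof -
  have "conn F (\<Union>x\<in>S. {f x})"
    by (rule conn_UN[OF assms(1)]) (use assms(2) in fastforce)+
  then show ?thesis by (simp add: UNION_singleton_eq_range)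
qed

lemma conn_path:
  assumes "sym E" "a \<le> b" "\<And>n. a \<le> n \<Longrightarrow> n < b \<Longrightarrow> (p n, p (Suc n)) \<in> E"
  shows "conn E (p ` {a..b})"
  using assms(2,3)
proof (induction b rule: dec_induct)
  case (step n)
  then have "conn E (insert (p (Suc n)) (p ` {a..n}))"
    by (intro conn_insert[OF assms(1), of _ "p n"]) auto
  moreover have "insert (p (Suc n)) (p ` {a..n}) = p ` {a..Suc n}"
    using step by (simp add: atLeastAtMostSuc_conv)
  ultimately show ?case by simp
qed simp

lemma conn_crossing_edge:
  assumes "conn E S" "x \<in> S" "x \<in> A" "z \<in> S" "z \<notin> A"
  obtains u v where "u \<in> S" "v \<in> S" "u \<in> A" "v \<notin> A" "(u, v) \<in> E"
proof -
  have "(x, z) \<in> (E \<inter> S \<times> S)\<^sup>*" using assms by (simp add: connD)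
  then have "z \<in> A \<or> (\<exists>u v. u \<in> S \<and> v \<in> S \<and> u \<in> A \<and> v \<notin> A \<and> (u, v) \<in> E)"
    by (induction rule: rtrancl_induct) (use assms in auto)
  then show thesis using assms that by blast
qed

text \<open>The part of a walk from \<open>A\<close> to \<open>B\<close> between the last visit of \<open>A\<close> and the next visit of \<open>B\<close>.\<close>

lemma conn_touching_once:
  assumes E: "sym E" "conn E S" and A: "A \<subseteq> S" "A \<noteq> {}" and B: "B \<subseteq> S" "B \<noteq> {}"
    and AB: "A \<inter> B = {}"
  obtains C a b where "C \<subseteq> S" "conn E C" "C \<inter> A = {a}" "C \<inter> B = {b}"
proof -
  obtain x y where xy: "x \<in> A" "y \<in> B" using A B by auto
  let ?good = "\<exists>C a b. C \<subseteq> S \<and> conn E C \<and> C \<inter> A = {a} \<and> C \<inter> B = {b}"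
  have "(x, y) \<in> (E \<inter> S \<times> S)\<^sup>*"
    using xy A B E by (auto intro: connD)
  then have "?good \<or> (\<exists>C a. C \<subseteq> S \<and> conn E C \<and> y \<in> C \<and> C \<inter> A = {a} \<and> C \<inter> B = {})"
  proof (induction rule: rtrancl_induct)
    case base
    have "{x} \<subseteq> S \<and> conn E {x} \<and> x \<in> {x} \<and> {x} \<inter> A = {x} \<and> {x} \<inter> B = {}"
      using xy A AB by auto
    then show ?case by (intro disjI2 exI)
  next
    case (step y z)
    then have z: "z \<in> S" "(y, z) \<in> E" by auto
    show ?case
    proof (cases ?good)
      case True
      then show ?thesis by (rule disjI1)
    next
      case False
      then obtain C a where C: "C \<subseteq> S" "conn E C" "y \<in> C" "C \<inter> A = {a}" "C \<inter> B = {}"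
        using step.IH by (elim disjE) (blast, elim exE conjE, rule that)
      have conn: "conn E (insert z C)"
        using conn_insert[OF E(1) C(2,3) z(2)] by simp
      consider "z \<in> A" | "z \<in> B" | "z \<notin> A" "z \<notin> B" by blast
      then show ?thesis
      proof cases
        case 1
        \<comment> \<open>On a new visit of \<open>A\<close>, the part of the walk collected so far
          is discarded.\<close>
        then have "{z} \<subseteq> S \<and> conn E {z} \<and> z \<in> {z} \<and> {z} \<inter> A = {z} \<and> {z} \<inter> B = {}"
          using AB z by auto
        then show ?thesis by (intro disjI2 exI)
      next
        case 2
        then have "insert z C \<subseteq> S \<and> conn E (insert z C) \<and> insert z C \<inter> A = {a} \<and>
            insert z C \<inter> B = {z}"
          using AB z conn C by auto
        then show ?thesis by (intro disjI1 exI)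
      next
        case 3
        then have "insert z C \<subseteq> S \<and> conn E (insert z C) \<and> z \<in> insert z C \<and>
            insert z C \<inter> A = {a} \<and> insert z C \<inter> B = {}"
          using AB z conn C by auto
        then show ?thesis by (intro disjI2 exI)
      qed
    qed
  qed
  then show thesis
  proof
    assume ?good
    then show thesis by (elim exE conjE) (rule that)
  qed (use xy in blast)
qed

section \<open>Minor models and how minors combine with products\<close>

definition wf_sym :: "'a pair_pre_digraph \<Rightarrow> bool" where
  "wf_sym G \<longleftrightarrow> sym (parcs G) \<and> parcs G \<subseteq> pverts G \<times> pverts G"

definition minor_model :: "('b \<Rightarrow> 'a set) \<Rightarrow> 'b pair_pre_digraph \<Rightarrow> 'a pair_pre_digraph \<Rightarrow> bool" where
  "minor_model B H G \<longleftrightarrow>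
     (\<forall>v \<in> pverts H. B v \<subseteq> pverts G \<and> conn (parcs G) (B v)) \<and>
     (\<forall>u \<in> pverts H. \<forall>v \<in> pverts H. u \<noteq> v \<longrightarrow> B u \<inter> B v = {}) \<and>
     (\<forall>(u, v) \<in> parcs H. \<exists>x \<in> B u. \<exists>y \<in> B v. (x, y) \<in> parcs G)"

lemma is_minor_iff:
  assumes "wf_sym G"
  shows "is_minor H G \<longleftrightarrow> (\<exists>B. minor_model B H G)"
  using assms connected_iff_conn[of G] unfolding is_minor_def minor_model_def wf_sym_def
  by (intro ex_cong1 conj_cong refl) auto

lemma minor_model_trans:
  assumes A: "minor_model A H G" and B: "minor_model B K H" and K: "wf_sym K"
  shows "minor_model (\<lambda>k. \<Union>h\<in>B k. A h) K G"
  unfolding minor_model_def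
proof (intro conjI ballI impI)
  fix k assume k: "k \<in> pverts K"
  then have Bk: "B k \<subseteq> pverts H" "conn (parcs H) (B k)"
    using B by (auto simp: minor_model_def)
  then show "(\<Union>h\<in>B k. A h) \<subseteq> pverts G"
    using A by (auto simp: minor_model_def)
  show "conn (parcs G) (\<Union>h\<in>B k. A h)"
  proof (rule conn_UN[OF Bk(2)])
    fix i assume "i \<in> B k"
    then show "conn (parcs G) (A i)" using A Bk by (auto simp: minor_model_def)
  next
    fix i j assume "(i, j) \<in> parcs H"
    then show "A i \<inter> A j \<noteq> {} \<or> (\<exists>x\<in>A i. \<exists>y\<in>A j. (x, y) \<in> parcs G)"
      using A unfolding minor_model_def by blast
  qed
next
  fix k l assume kl: "k \<in> pverts K" "l \<in> pverts K" "k \<noteq> l"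
  then have "B k \<subseteq> pverts H" "B l \<subseteq> pverts H" "B k \<inter> B l = {}"
    using B by (auto simp: minor_model_def)
  then have "A h \<inter> A h' = {}" if "h \<in> B k" "h' \<in> B l" for h h'
    using A that unfolding minor_model_def by (metis disjoint_iff subsetD)
  then show "(\<Union>h\<in>B k. A h) \<inter> (\<Union>h\<in>B l. A h) = {}" by auto
next
  fix e assume e: "e \<in> parcs K"
  obtain k l where kl: "e = (k, l)" by (cases e)
  have "\<exists>x\<in>B k. \<exists>y\<in>B l. (x, y) \<in> parcs H"
    using B e kl by (auto simp: minor_model_def)
  then show "case e of (k, l) \<Rightarrow> \<exists>x\<in>(\<Union>h\<in>B k. A h). \<exists>y\<in>(\<Union>h\<in>B l. A h). (x, y) \<in> parcs G"
    using A kl by (fastforce simp: minor_model_def)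
qed

lemma is_minor_trans:
  assumes "is_minor K H" "is_minor H G" "wf_sym K" "wf_sym H" "wf_sym G"
  shows "is_minor K G"
  using assms minor_model_trans by (metis is_minor_iff)

lemma is_minor_hom:
  assumes "wf_sym G" "inj_on f (pverts H)" "f ` pverts H \<subseteq> pverts G"
    "\<And>u v. (u, v) \<in> parcs H \<Longrightarrow> (f u, f v) \<in> parcs G"
  shows "is_minor H G"
proof -
  have "minor_model (\<lambda>v. {f v}) H G"
    using assms by (auto simp: minor_model_def inj_on_def)
  then show ?thesis using assms(1) is_minor_iff by blast
qed

lemma wf_sym_cartesian:
  assumes "wf_sym G" "wf_sym H"
  shows "wf_sym (cartesian_product G H)"
  using assms by (auto simp: wf_sym_def cartesian_product_def intro!: symI dest: symD)

lemma wf_sym_strong: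
  assumes "wf_sym G" "wf_sym H"
  shows "wf_sym (strong_product G H)"
  using assms by (auto simp: wf_sym_def strong_product_def intro!: symI dest: symD)

lemma wf_sym_grid: "wf_sym (grid k)"
  by (auto simp: wf_sym_def grid_def intro!: symI)

lemma cartesian_minor_strong:
  assumes "wf_sym G" "wf_sym H"
  shows "is_minor (cartesian_product G H) (strong_product G H)"
  by (rule is_minor_hom[where f = id, OF wf_sym_strong[OF assms]])
    (auto simp: cartesian_product_def strong_product_def)

lemma cartesian_swap_minor:
  assumes "wf_sym G" "wf_sym H"
  shows "is_minor (cartesian_product H G) (cartesian_product G H)"
  by (rule is_minor_hom[where f = prod.swap, OF wf_sym_cartesian[OF assms]])
    (auto simp: cartesian_product_def)

lemma conn_Times:
  assumes E: "conn (parcs G) S" "S \<subseteq> pverts G" and F: "conn (parcs H) T" "T \<subseteq> pverts H"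
  shows "conn (parcs (cartesian_product G H)) (S \<times> T)"
proof -
  have T: "conn (parcs (cartesian_product G H)) ({x} \<times> T)" if "x \<in> S" for x
  proof -
    have "conn (parcs (cartesian_product G H)) (Pair x ` T)"
      by (rule conn_image[OF F(1)]) (use that E F in \<open>auto simp: cartesian_product_def\<close>)
    moreover have "Pair x ` T = {x} \<times> T" by auto
    ultimately show ?thesis by simp
  qed
  obtain t where t: "t \<in> T" using conn_nonempty[OF F(1)] by auto
  have "conn (parcs (cartesian_product G H)) (\<Union>x\<in>S. {x} \<times> T)"
  proof (rule conn_UN[OF E(1) T])
    fix i j assume "(i, j) \<in> parcs G" "i \<in> S" "j \<in> S"
    then have "((i, t), (j, t)) \<in> parcs (cartesian_product G H)"
      using t E F by (auto simp: cartesian_product_def)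
    then show "{i} \<times> T \<inter> {j} \<times> T \<noteq> {} \<or>
        (\<exists>x\<in>{i} \<times> T. \<exists>y\<in>{j} \<times> T. (x, y) \<in> parcs (cartesian_product G H))"
      using t by auto
  qed auto
  moreover have "(\<Union>x\<in>S. {x} \<times> T) = S \<times> T" by auto
  ultimately show ?thesis by simp
qed

text \<open>Each copy of \<open>G'\<close> is contracted from its own copy of \<open>G\<close>, so
  that the branch sets stay within single layers of the product. This allows a tree to be replaced
  by a spider before any grid is built.\<close>

lemma cartesian_minor_mono:
  assumes "is_minor G' G" "wf_sym G'" "wf_sym G" "wf_sym H"
  shows "is_minor (cartesian_product G' H) (cartesian_product G H)"
proof -
  obtain B where B: "minor_model B G' G"
    using assms is_minor_iff by blast
  have "minor_model (\<lambda>(u, y). B u \<times> {y}) (cartesian_product G' H) (cartesian_product G H)"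
    unfolding minor_model_def
  proof (intro conjI ballI impI)
    fix v assume "v \<in> pverts (cartesian_product G' H)"
    then obtain u y where v: "v = (u, y)" "u \<in> pverts G'" "y \<in> pverts H"
      by (auto simp: cartesian_product_def)
    show "(case v of (u, y) \<Rightarrow> B u \<times> {y}) \<subseteq> pverts (cartesian_product G H)"
      using v B by (auto simp: cartesian_product_def minor_model_def)
    show "conn (parcs (cartesian_product G H)) (case v of (u, y) \<Rightarrow> B u \<times> {y})"
      using v B conn_Times[of G "B u" H "{y}"] by (auto simp: minor_model_def)
  next
    fix v w assume "v \<in> pverts (cartesian_product G' H)" "w \<in> pverts (cartesian_product G' H)"
      "v \<noteq> w"
    moreover have "B u \<inter> B u' = {}" if "u \<in> pverts G'" "u' \<in> pverts G'" "u \<noteq> u'" for u u'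
      using B that by (auto simp: minor_model_def)
    ultimately show "(case v of (u, y) \<Rightarrow> B u \<times> {y}) \<inter> (case w of (u, y) \<Rightarrow> B u \<times> {y}) = {}"
      by (fastforce simp: cartesian_product_def)
  next
    fix e assume e: "e \<in> parcs (cartesian_product G' H)"
    obtain u y u' y' where uy: "e = ((u, y), (u', y'))" by (metis surj_pair)
    have V: "u \<in> pverts G'" "u' \<in> pverts G'" "y \<in> pverts H" "y' \<in> pverts H"
      using e uy by (auto simp: cartesian_product_def)
    then have BV: "B u \<subseteq> pverts G" "B u' \<subseteq> pverts G" "B u \<noteq> {}"
      using B by (auto simp: minor_model_def conn_def)
    consider "u = u'" "(y, y') \<in> parcs H" | "y = y'" "(u, u') \<in> parcs G'"
      using e uy by (auto simp: cartesian_product_def)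
    then have "\<exists>a\<in>B u. \<exists>b\<in>B u'. ((a, y), (b, y')) \<in> parcs (cartesian_product G H)"
    proof cases
      case 1
      then show ?thesis using V BV by (fastforce simp: cartesian_product_def)
    next
      case 2
      then obtain a b where "a \<in> B u" "b \<in> B u'" "(a, b) \<in> parcs G"
        using B by (fastforce simp: minor_model_def)
      then show ?thesis using V BV 2 by (fastforce simp: cartesian_product_def)
    qed
    then show "case e of (v, w) \<Rightarrow> \<exists>x\<in>(case v of (u, y) \<Rightarrow> B u \<times> {y}).
        \<exists>y\<in>(case w of (u, y) \<Rightarrow> B u \<times> {y}). (x, y) \<in> parcs (cartesian_product G H)"
      using uy by auto
  qed
  then show ?thesis using assms is_minor_iff wf_sym_cartesian by blast
qed

text \<open>Coordinates are shifted to start at 0, so that grid points can later be split by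
  \<open>div\<close> and \<open>mod\<close>. Adjacency is demanded in two directions only; the
  opposite ones follow by symmetry of the arcs.\<close>

lemma grid_minorI:
  assumes G: "wf_sym G"
    and sub: "\<And>x y. x < k \<Longrightarrow> y < k \<Longrightarrow> B x y \<subseteq> pverts G"
    and conn: "\<And>x y. x < k \<Longrightarrow> y < k \<Longrightarrow> conn (parcs G) (B x y)"
    and disj: "\<And>x y x' y'. x < k \<Longrightarrow> y < k \<Longrightarrow> x' < k \<Longrightarrow> y' < k \<Longrightarrow> (x, y) \<noteq> (x', y') \<Longrightarrow>
      B x y \<inter> B x' y' = {}"
    and right: "\<And>x y. x < k \<Longrightarrow> Suc y < k \<Longrightarrow> \<exists>a\<in>B x y. \<exists>b\<in>B x (Suc y). (a, b) \<in> parcs G"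
    and down: "\<And>x y. Suc x < k \<Longrightarrow> y < k \<Longrightarrow> \<exists>a\<in>B x y. \<exists>b\<in>B (Suc x) y. (a, b) \<in> parcs G"
  shows "is_minor (grid k) G"
proof -
  have sym: "(b, a) \<in> parcs G" if "(a, b) \<in> parcs G" for a b
    using G that by (auto simp: wf_sym_def dest: symD)
  have "minor_model (\<lambda>(x, y). B (x - 1) (y - 1)) (grid k) G"
    unfolding minor_model_def
  proof (intro conjI ballI impI)
    fix v assume "v \<in> pverts (grid k)"
    then obtain x y where "v = (x, y)" "x - 1 < k" "y - 1 < k"
      by (auto simp: grid_def)
    then show "(case v of (x, y) \<Rightarrow> B (x - 1) (y - 1)) \<subseteq> pverts G"
      "conn (parcs G) (case v of (x, y) \<Rightarrow> B (x - 1) (y - 1))"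
      using sub conn by simp_all
  next
    fix v w assume vw: "v \<in> pverts (grid k)" "w \<in> pverts (grid k)" "v \<noteq> w"
    obtain x y x' y' where "v = (x, y)" "w = (x', y')" by (metis surj_pair)
    moreover from this have "x - 1 < k" "y - 1 < k" "x' - 1 < k" "y' - 1 < k"
      "(x - 1, y - 1) \<noteq> (x' - 1, y' - 1)"
      using vw by (auto simp: grid_def)
    ultimately show "(case v of (x, y) \<Rightarrow> B (x - 1) (y - 1)) \<inter>
        (case w of (x, y) \<Rightarrow> B (x - 1) (y - 1)) = {}"
      using disj by simp
  next
    fix e assume e: "e \<in> parcs (grid k)"
    obtain x y x' y' where xy: "e = ((Suc x, Suc y), (Suc x', Suc y'))"
      "x < k" "y < k" "x' < k" "y' < k" "\<bar>int x - int x'\<bar> + \<bar>int y - int y'\<bar> = 1"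
    proof -
      obtain a b a' b' where ab: "e = ((a, b), (a', b'))" by (metis surj_pair)
      show thesis
        by (rule that[of "a - 1" "b - 1" "a' - 1" "b' - 1"])
          (use ab e in \<open>auto simp: grid_def of_nat_diff\<close>)
    qed
    then consider "x' = x" "y' = Suc y" | "x' = x" "y = Suc y'" | "x' = Suc x" "y' = y"
      | "x = Suc x'" "y' = y" by linarith
    then have "\<exists>a\<in>B x y. \<exists>b\<in>B x' y'. (a, b) \<in> parcs G"
      using xy right[of x y] right[of x y'] down[of x y] down[of x' y] sym
      by cases blast+
    then show "case e of (v, w) \<Rightarrow> \<exists>a\<in>(case v of (x, y) \<Rightarrow> B (x - 1) (y - 1)).
        \<exists>b\<in>(case w of (x, y) \<Rightarrow> B (x - 1) (y - 1)). (a, b) \<in> parcs G"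
      using xy by simp
  qed
  then show ?thesis using G is_minor_iff by blast
qed

text \<open>Choosing a vertex from each branch set embeds the points of the grid into
  \<open>G\<close>. The bound makes the set in \<open>gm\<close> finite, without which
  \<open>Max\<close> would say nothing about it.\<close>

lemma grid_minor_card:
  assumes "is_minor (grid k) G" "wf_sym G" "finite (pverts G)"
  shows "k\<^sup>2 \<le> card (pverts G)"
proof -
  obtain B where B: "minor_model B (grid k) G"
    using assms is_minor_iff by blast
  define f where "f v = (SOME x. x \<in> B v)" for v
  have f: "f v \<in> B v" if "v \<in> pverts (grid k)" for v
    using B that some_in_eq[of "B v"] unfolding f_def minor_model_def conn_def by auto
  have "inj_on f (pverts (grid k))"
    using B f unfolding minor_model_def inj_on_def by (metis disjoint_iff)
  moreover have "f ` pverts (grid k) \<subseteq> pverts G"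
    using B f unfolding minor_model_def by blast
  ultimately have "card (pverts (grid k)) \<le> card (pverts G)"
    using card_inj_on_le assms(3) by blast
  then show ?thesis by (simp add: grid_def power2_eq_square)
qed

lemma grid_minor_finite:
  assumes "wf_sym G" "finite (pverts G)"
  shows "finite {k. 1 \<le> k \<and> is_minor (grid k) G}"
proof (rule finite_subset)
  show "{k. 1 \<le> k \<and> is_minor (grid k) G} \<subseteq> {..card (pverts G)}"
  proof safe
    fix k assume "is_minor (grid k) G"
    then have "k\<^sup>2 \<le> card (pverts G)" using grid_minor_card assms by blast
    moreover have "k \<le> k\<^sup>2" by (simp add: power2_nat_le_imp_le)
    ultimately show "k \<le> card (pverts G)" by linarith
  qed
qed simp

lemma grid_1_minor:
  assumes "wf_sym G" "pverts G \<noteq> {}"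
  shows "is_minor (grid 1) G"
proof -
  obtain v where "v \<in> pverts G" using assms by auto
  then show ?thesis by (intro grid_minorI[where B = "\<lambda>_ _. {v}"]) (use assms in auto)
qed

lemma gm_ge:
  assumes "wf_sym G" "finite (pverts G)" "1 \<le> k" "is_minor (grid k) G"
  shows "k \<le> gm G"
  unfolding gm_def by (rule Max_ge) (use assms grid_minor_finite in auto)

lemma gm_minor:
  assumes "wf_sym G" "finite (pverts G)" "pverts G \<noteq> {}"
  shows "1 \<le> gm G" "is_minor (grid (gm G)) G"
proof -
  have "gm G \<in> {k. 1 \<le> k \<and> is_minor (grid k) G}"
    unfolding gm_def by (rule Max_in) (use assms grid_minor_finite grid_1_minor in auto)
  then show "1 \<le> gm G" "is_minor (grid (gm G)) G" by auto
qed

lemma gm_mono: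
  assumes "is_minor H G" "wf_sym G" "wf_sym H" "finite (pverts G)" "finite (pverts H)" "pverts H \<noteq> {}"
  shows "gm H \<le> gm G"
proof -
  have "is_minor (grid (gm H)) G"
    using is_minor_trans[OF gm_minor(2)[of H] assms(1)] assms wf_sym_grid by blast
  then show ?thesis
    using gm_ge gm_minor(1)[of H] assms by blast
qed

subsection \<open>Rooted trees\<close>

lemma undirected_treeD:
  assumes "undirected_tree T"
  shows "wf_sym T" "finite (pverts T)" "conn (parcs T) (pverts T)" "pverts T \<noteq> {}"
proof -
  interpret pair_graph T using assms by (simp add: undirected_tree_def)
  show wf: "wf_sym T"
    using pair_sym_arcs by (auto simp: wf_sym_def symmetric_def wellformed')
  show "finite (pverts T)" by (rule pair_finite_verts)
  show "conn (parcs T) (pverts T)"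
    using assms connected_whole_iff_conn[of T] wf by (simp add: undirected_tree_def wf_sym_def)
  then show "pverts T \<noteq> {}" by (rule conn_nonempty)
qed

text \<open>A walk avoiding the edge in both directions contains a simple path, which the arc from
  \<open>v\<close> back to \<open>u\<close> closes to a cycle. That path has at least two arcs, so
  the cycle is of the forbidden kind and not merely an edge followed by its reverse.\<close>

lemma undirected_tree_bridge:
  assumes T: "undirected_tree T" and uv: "(u, v) \<in> parcs T"
  shows "(u, v) \<notin> (parcs T - {(u, v), (v, u)})\<^sup>*"
proof
  assume reach: "(u, v) \<in> (parcs T - {(u, v), (v, u)})\<^sup>*"
  interpret T: pair_graph T using T by (simp add: undirected_tree_def)
  define H where "H = \<lparr>pverts = pverts T, parcs = parcs T - {(u, v), (v, u)}\<rparr>"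
  interpret H: pair_wf_digraph H
    by unfold_locales (auto simp: H_def T.wellformed')
  have "u \<noteq> v" "u \<in> pverts T" "v \<in> pverts T"
    using uv T.no_loops' T.wellformed' by blast+
  then have "Digraph.reachable (with_proj H) u v"
    using reach H.reachable_conv[of u v] by (simp add: H_def)
  then obtain q where q: "H.apath u q v"
    using H.reachable_apath by blast
  then have Hq: "H.awalk u q v" "distinct (pawalk_verts u q)"
    by (auto simp: H.apath_def)
  then have Hq': "set q \<subseteq> parcs H" "pcas u q v"
    by (simp_all add: H.awalk_def)
  then have set: "set q \<subseteq> parcs T - {(u, v), (v, u)}"
    by (simp add: H_def)
  have Tq: "T.awalk u q v"
    using Hq'(2) set \<open>u \<in> pverts T\<close> by (auto simp: T.awalk_def)
  have "T.awalk u (q @ [(v, u)]) u"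
    using Tq uv T.arcs_symmetric by (auto simp: T.awalk_simps T.wellformed')
  moreover have "distinct (tl (pawalk_verts u (q @ [(v, u)])))"
  proof -
    have "pawalk_verts u (q @ [(v, u)]) = pawalk_verts u q @ [u]"
      using T.awalk_verts_append[of u q "[(v, u)]" u] calculation Tq by auto
    moreover have "pawalk_verts u q = u # tl (pawalk_verts u q)"
      using Tq by (cases q) (auto simp: T.awalk_simps)
    ultimately show ?thesis
      using Hq(2) by (metis (no_types, lifting) append_Cons distinct.simps(2) distinct1_rotate
          list.sel(3) rotate1.simps(2))
  qed
  ultimately have "T.cycle (q @ [(v, u)])"
    by (auto simp: T.cycle_def)
  moreover have "3 \<le> length (q @ [(v, u)])"
  proof (cases q)
    case Nil
    then show ?thesis using Tq \<open>u \<noteq> v\<close> by (simp add: T.awalk_simps)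
  next
    case (Cons e es)
    then show ?thesis using Tq set by (cases es; cases e) (auto simp: T.awalk_simps)
  qed
  ultimately show False using T by (auto simp: undirected_tree_def)
qed

lemma rtrancl_via:
  assumes "sym R" "(x, r) \<in> R\<^sup>*" "(y, r) \<in> R\<^sup>*"
  shows "(x, y) \<in> R\<^sup>*"
proof -
  have "(r, y) \<in> R\<^sup>*" using sym_rtrancl[OF assms(1)] assms(3) by (rule symD)
  with assms(2) show ?thesis by (rule rtrancl_trans)
qed

text \<open>All later arguments run along parents, so the tree is kept as a parent and a depth
  function. The value \<open>par r\<close> is left unspecified; this is the source of the side
  conditions \<open>n \<le> dep x\<close> wherever \<open>par\<close> is iterated.\<close>

locale rooted_tree =
  fixes V :: "'a set" and E :: "('a \<times> 'a) set" and r :: 'a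
    and par :: "'a \<Rightarrow> 'a" and dep :: "'a \<Rightarrow> nat"
  assumes finite_V: "finite V" and r_in: "r \<in> V" and dep_r: "dep r = 0"
    and par_in: "\<And>x. x \<in> V \<Longrightarrow> x \<noteq> r \<Longrightarrow> par x \<in> V"
    and dep_par: "\<And>x. x \<in> V \<Longrightarrow> x \<noteq> r \<Longrightarrow> dep x = Suc (dep (par x))"
    and E_iff: "\<And>u v. (u, v) \<in> E \<longleftrightarrow>
      u \<in> V \<and> v \<in> V \<and> (u \<noteq> r \<and> v = par u \<or> v \<noteq> r \<and> u = par v)"

text \<open>Depth is the distance from an arbitrary root. The arcs \<open>F\<close> between vertices
  and their parents already connect the tree, so \<open>F\<close> would bypass any edge outside of
  it, although every edge is a bridge.\<close>

lemma undirected_tree_rooted: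
  assumes "undirected_tree T"
  obtains r par dep where "rooted_tree (pverts T) (parcs T) r par dep"
proof -
  let ?E = "parcs T"
  note T = undirected_treeD[OF assms]
  have sym: "sym ?E" and EV: "?E \<subseteq> pverts T \<times> pverts T" using T(1) by (auto simp: wf_sym_def)
  obtain r where r: "r \<in> pverts T" using T(4) by auto
  have reach: "\<exists>n. (r, x) \<in> ?E ^^ n" if "x \<in> pverts T" for x
  proof -
    have "(r, x) \<in> (?E \<inter> pverts T \<times> pverts T)\<^sup>*" using T(3) r that by (simp add: connD)
    then show ?thesis using EV by (simp add: Int_absorb2 rtrancl_is_UN_relpow)
  qed
  define dep where "dep x = (LEAST n. (r, x) \<in> ?E ^^ n)" for x
  have dep: "(r, x) \<in> ?E ^^ dep x" if "x \<in> pverts T" for x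
    unfolding dep_def using reach[OF that] by (rule LeastI_ex)
  have dep_le: "dep x \<le> n" if "(r, x) \<in> ?E ^^ n" for x n
    unfolding dep_def using that by (rule Least_le)
  have dep_r: "dep r = 0" using dep_le[of r 0] by simp
  have ex: "\<exists>y. (y, x) \<in> ?E \<and> dep x = Suc (dep y)" if x: "x \<in> pverts T" "x \<noteq> r" for x
  proof -
    have "dep x \<noteq> 0" using dep[OF x(1)] x(2) by (cases "dep x") auto
    then obtain m where m: "dep x = Suc m" by (cases "dep x") auto
    then obtain y where y: "(r, y) \<in> ?E ^^ m" "(y, x) \<in> ?E" using dep[OF x(1)] by auto
    then have "y \<in> pverts T" using EV by auto
    then have "(r, x) \<in> ?E ^^ Suc (dep y)" using dep y(2) by auto
    then have "dep x \<le> Suc (dep y)" by (rule dep_le)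
    then show ?thesis using y m dep_le[OF y(1)] by auto
  qed
  define par where "par x = (SOME y. (y, x) \<in> ?E \<and> dep x = Suc (dep y))" for x
  have par: "(par x, x) \<in> ?E" "dep x = Suc (dep (par x))" if "x \<in> pverts T" "x \<noteq> r" for x
    using someI_ex[OF ex[OF that]] unfolding par_def by auto
  define F where "F = {(x, par x) |x. x \<in> pverts T \<and> x \<noteq> r} \<union> {(par x, x) |x. x \<in> pverts T \<and> x \<noteq> r}"
  have F: "F \<subseteq> ?E" using par(1) sym unfolding F_def by (auto dest: symD)
  have symF: "sym F" unfolding F_def by (auto intro!: symI)
  have to_r: "(x, r) \<in> F\<^sup>*" if "x \<in> pverts T" for x
    using that
  proof (induction "dep x" arbitrary: x rule: less_induct)
    case less
    show ?case
    proof (cases "x = r")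
      case False
      have "(x, par x) \<in> F" unfolding F_def using less False by auto
      moreover have "(par x, r) \<in> F\<^sup>*"
        using less par[of x] False EV by auto
      ultimately show ?thesis by (rule converse_rtrancl_into_rtrancl)
    qed simp
  qed
  have conF: "(x, y) \<in> F\<^sup>*" if "x \<in> pverts T" "y \<in> pverts T" for x y
    using symF to_r[OF that(1)] to_r[OF that(2)] by (rule rtrancl_via)
  have "(u, v) \<in> F" if uv: "(u, v) \<in> ?E" for u v
  proof (rule ccontr)
    assume "(u, v) \<notin> F"
    then have "F \<subseteq> ?E - {(u, v), (v, u)}" using F symF by (auto dest: symD)
    moreover have "(u, v) \<in> F\<^sup>*" using conF uv EV by auto
    ultimately have "(u, v) \<in> (?E - {(u, v), (v, u)})\<^sup>*" using rtrancl_mono by blast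
    then show False using undirected_tree_bridge[OF assms uv] by simp
  qed
  then have FE: "?E = F" using F by auto
  have "rooted_tree (pverts T) ?E r par dep"
  proof
    fix u v
    show "(u, v) \<in> ?E \<longleftrightarrow> u \<in> pverts T \<and> v \<in> pverts T \<and> (u \<noteq> r \<and> v = par u \<or> v \<noteq> r \<and> u = par v)"
    proof
      assume uv: "(u, v) \<in> ?E"
      then have "(u, v) \<in> F" using FE by simp
      then have "u \<noteq> r \<and> v = par u \<or> v \<noteq> r \<and> u = par v" unfolding F_def by auto
      then show "u \<in> pverts T \<and> v \<in> pverts T \<and> (u \<noteq> r \<and> v = par u \<or> v \<noteq> r \<and> u = par v)"
        using EV uv by auto
    next
      assume "u \<in> pverts T \<and> v \<in> pverts T \<and> (u \<noteq> r \<and> v = par u \<or> v \<noteq> r \<and> u = par v)"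
      then have "(u, v) \<in> F" unfolding F_def by auto
      then show "(u, v) \<in> ?E" using FE by simp
    qed
  qed (use T r dep_r par EV in auto)
  then show thesis by (rule that)
qed

context rooted_tree
begin

lemma sym_E: "sym E"
  by (auto simp: E_iff intro!: symI)

lemma funpow_par:
  assumes "x \<in> V" "n \<le> dep x"
  shows "(par ^^ n) x \<in> V \<and> dep ((par ^^ n) x) = dep x - n"
  using assms(2)
proof (induction n)
  case (Suc n)
  then have IH: "(par ^^ n) x \<in> V" "dep ((par ^^ n) x) = dep x - n" by auto
  then have "(par ^^ n) x \<noteq> r" using Suc.prems dep_r by auto
  then show ?case using IH par_in dep_par[of "(par ^^ n) x"] by simp
qed (use assms in simp)

definition below :: "'a \<Rightarrow> 'a set" where
  "below a = {x \<in> V. \<exists>n \<le> dep x. (par ^^ n) x = a}"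

lemma below_dep:
  assumes "x \<in> below a"
  shows "dep a \<le> dep x" "dep a = dep x \<Longrightarrow> x = a"
proof -
  obtain n where n: "x \<in> V" "n \<le> dep x" "(par ^^ n) x = a" using assms by (auto simp: below_def)
  then have "dep a = dep x - n" using funpow_par by blast
  then show "dep a \<le> dep x" by simp
  assume "dep a = dep x"
  then have "n = 0" using n \<open>dep a = dep x - n\<close> by linarith
  then show "x = a" using n by simp
qed

lemma leaving_below:
  assumes "(x, y) \<in> E" "x \<in> below a" "y \<notin> below a"
  shows "x = a \<and> a \<noteq> r \<and> y = par a"
proof -
  obtain n where n: "x \<in> V" "n \<le> dep x" "(par ^^ n) x = a" using assms by (auto simp: below_def)
  consider "x \<noteq> r" "y = par x" | "y \<noteq> r" "x = par y" using assms(1) E_iff by auto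
  then show ?thesis
  proof cases
    case 1
    show ?thesis
    proof (cases n)
      case (Suc m)
      then have "(par ^^ m) y = a" "m \<le> dep y"
        using n 1 dep_par[of x] by (auto simp: funpow_swap1)
      then have "y \<in> below a" using assms(1) E_iff by (auto simp: below_def)
      then show ?thesis using assms(3) by simp
    qed (use n 1 in auto)
  next
    case 2
    have "y \<in> V" using assms(1) E_iff by auto
    then have "(par ^^ Suc n) y = a" "Suc n \<le> dep y"
      using n 2 dep_par[of y] by (auto simp: funpow_swap1)
    then have "y \<in> below a" using \<open>y \<in> V\<close> unfolding below_def by blast
    then show ?thesis using assms(3) by simp
  qed
qed

lemma conn_leaving_below:
  assumes "conn E S" "x \<in> S" "x \<in> below a" "z \<in> S" "z \<notin> below a"
  shows "a \<in> S" "par a \<in> S" "a \<noteq> r"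
proof -
  obtain u v where "u \<in> S" "v \<in> S" "u \<in> below a" "v \<notin> below a" "(u, v) \<in> E"
    using conn_crossing_edge[OF assms] by blast
  then show "a \<in> S" "par a \<in> S" "a \<noteq> r" using leaving_below by auto
qed

text \<open>Call a vertex of least depth in a subtree its top; the deepest of these tops is common
  to all members. A member whose own top is not below that vertex must leave the part below it,
  hence contains it; one whose top is below it cannot have a deeper top, hence has the same
  one.\<close>

lemma helly:
  assumes F: "F \<noteq> {}" "\<And>S. S \<in> F \<Longrightarrow> S \<subseteq> V \<and> conn E S"
    and meet: "\<And>S S'. S \<in> F \<Longrightarrow> S' \<in> F \<Longrightarrow> S \<inter> S' \<noteq> {}"
  obtains a where "a \<in> V" "\<And>S. S \<in> F \<Longrightarrow> a \<in> S"
proof -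
  define top where "top S = (ARG_MIN dep x. x \<in> S)" for S
  have top: "top S \<in> S" "\<And>x. x \<in> S \<Longrightarrow> dep (top S) \<le> dep x" if S: "S \<in> F" for S
  proof -
    obtain x where "x \<in> S" using F(2)[OF S] conn_nonempty by blast
    then show "top S \<in> S" unfolding top_def by (rule arg_min_natI)
    show "dep (top S) \<le> dep x" if "x \<in> S" for x
      unfolding top_def using that by (rule arg_min_nat_le)
  qed
  have "finite F"
    by (rule finite_subset[of _ "Pow V"]) (use F finite_V in auto)
  then obtain S where S: "S \<in> F" "\<And>S'. S' \<in> F \<Longrightarrow> dep (top S') \<le> dep (top S)"
    using obtains_MAX[of F "\<lambda>S. dep (top S)"] F(1) by (metis (no_types, lifting) Max_ge finite_imageI imageI)
  let ?a = "top S"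
  have aV: "?a \<in> V" using top(1)[OF S(1)] F(2)[OF S(1)] by auto
  have below: "S \<subseteq> below ?a"
  proof
    fix z assume z: "z \<in> S"
    show "z \<in> below ?a"
    proof (rule ccontr)
      assume "z \<notin> below ?a"
      moreover have "?a \<in> below ?a" using aV by (auto simp: below_def intro: exI[of _ 0])
      ultimately have "par ?a \<in> S" "?a \<noteq> r"
        using conn_leaving_below z F(2)[OF S(1)] top(1)[OF S(1)] by blast+
      then show False using top(2)[OF S(1), of "par ?a"] dep_par[OF aV] by simp
    qed
  qed
  have "?a \<in> S'" if S': "S' \<in> F" for S'
  proof -
    obtain x where x: "x \<in> S" "x \<in> S'" using meet S(1) S' by blast
    show ?thesis
    proof (cases "top S' \<in> below ?a")
      case True
      have "top S' = ?a"
        using below_dep(1)[OF True] S(2)[OF S'] by (intro below_dep(2)[OF True]) (rule le_antisym)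
      then show ?thesis using top(1)[OF S'] by simp
    next
      case False
      then show ?thesis
        using conn_leaving_below(1)[of S' x ?a "top S'"] F(2)[OF S'] x below top(1)[OF S'] by auto
    qed
  qed
  then show thesis using that aV by blast
qed

section \<open>Heights and descending chains\<close>

definition ht :: "'a \<Rightarrow> nat" where
  "ht x = Max {n. \<exists>y\<in>V. n \<le> dep y \<and> (par ^^ n) y = x}"

lemma finite_hts: "finite {n. \<exists>y\<in>V. n \<le> dep y \<and> (par ^^ n) y = x}"
  by (rule finite_subset[of _ "\<Union>y\<in>V. {..dep y}"]) (use finite_V in auto)

lemma ht_ge: "y \<in> V \<Longrightarrow> n \<le> dep y \<Longrightarrow> (par ^^ n) y = x \<Longrightarrow> n \<le> ht x"
  unfolding ht_def using finite_hts by (intro Max_ge) auto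

lemma ht_witness:
  assumes "x \<in> V"
  obtains y where "y \<in> V" "ht x \<le> dep y" "(par ^^ ht x) y = x"
proof -
  have "ht x \<in> {n. \<exists>y\<in>V. n \<le> dep y \<and> (par ^^ n) y = x}"
    unfolding ht_def
    by (rule Max_in[OF finite_hts]) (use assms in \<open>auto intro: exI[of _ 0]\<close>)
  then show thesis using that by auto
qed

lemma ht_par:
  assumes "x \<in> V" "x \<noteq> r"
  shows "ht x < ht (par x)"
proof -
  obtain y where y: "y \<in> V" "ht x \<le> dep y" "(par ^^ ht x) y = x" using ht_witness assms by blast
  have "dep x = dep y - ht x" using funpow_par[OF y(1,2)] y(3) by simp
  then have "Suc (ht x) \<le> dep y" using dep_par[OF assms] by simp
  then show ?thesis using ht_ge[OF y(1), of "Suc (ht x)"] y(3) by simp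
qed

lemma ht_le_root: "x \<in> V \<Longrightarrow> ht x \<le> ht r"
proof (induction "dep x" arbitrary: x rule: less_induct)
  case less
  show ?case
  proof (cases "x = r")
    case False
    then have "ht (par x) \<le> ht r" using less dep_par par_in by simp
    then show ?thesis using ht_par[OF less.prems False] by simp
  qed simp
qed

lemma ht_root_eq: "x \<in> V \<Longrightarrow> ht x = ht r \<Longrightarrow> x = r"
  using ht_par[of x] ht_le_root par_in[of x] by fastforce

lemma ex_high_child:
  assumes "x \<in> V" "0 < ht x"
  shows "\<exists>c. c \<in> V \<and> c \<noteq> r \<and> par c = x \<and> Suc (ht c) = ht x"
proof -
  obtain y where y: "y \<in> V" "ht x \<le> dep y" "(par ^^ ht x) y = x" using ht_witness assms by blast
  define t where "t = ht x - 1"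
  then have t: "ht x = Suc t" using assms by simp
  define c where "c = (par ^^ t) y"
  have c: "c \<in> V" "dep c = dep y - t" "par c = x"
    using funpow_par[OF y(1), of t] y t by (auto simp: c_def)
  then have "c \<noteq> r" using y t dep_r by auto
  moreover have "t \<le> ht c" using y t by (intro ht_ge[of y]) (auto simp: c_def)
  ultimately show ?thesis using ht_par[of c] c t by (intro exI[of _ c]) auto
qed

text \<open>A fixed highest child: iterating \<open>child\<close> traces a longest descending path,
  along which the height falls by exactly one per step.\<close>

definition child :: "'a \<Rightarrow> 'a" where
  "child x = (SOME c. c \<in> V \<and> c \<noteq> r \<and> par c = x \<and> Suc (ht c) = ht x)"

lemma child:
  assumes "x \<in> V" "0 < ht x"
  shows "child x \<in> V" "child x \<noteq> r" "par (child x) = x" "Suc (ht (child x)) = ht x"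
  using someI_ex[OF ex_high_child[OF assms]] unfolding child_def by auto

lemma funpow_child:
  assumes "x \<in> V" "i \<le> ht x"
  shows "(child ^^ i) x \<in> V \<and> ht ((child ^^ i) x) = ht x - i \<and> (par ^^ i) ((child ^^ i) x) = x"
  using assms(2)
proof (induction i)
  case (Suc i)
  let ?y = "(child ^^ i) x"
  have y: "?y \<in> V" "ht ?y = ht x - i" "(par ^^ i) ?y = x" using Suc by auto
  then have "0 < ht ?y" using Suc.prems by simp
  then show ?case using child[OF y(1)] y by (auto simp: funpow_swap1)
qed (use assms in simp)

lemma child_adjacent:
  assumes "x \<in> V" "Suc i \<le> ht x"
  shows "((child ^^ i) x, (child ^^ Suc i) x) \<in> E"
proof -
  let ?y = "(child ^^ i) x"
  have y: "?y \<in> V" "ht ?y = ht x - i" using funpow_child assms by auto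
  then have "0 < ht ?y" using assms by simp
  then show ?thesis using child[OF y(1)] y by (auto simp: E_iff)
qed

text \<open>Heights count the steps taken: chains from equal heights can only meet after equally
  many steps, and climbing back that many steps recovers the start.\<close>

lemma child_chains_disjoint:
  assumes "x \<in> V" "y \<in> V" "i \<le> ht x" "j \<le> ht y" "(child ^^ i) x = (child ^^ j) y"
    and "i = j \<or> ht x = ht y"
  shows "x = y" "i = j"
proof -
  note x = funpow_child[OF assms(1,3)] and y = funpow_child[OF assms(2,4)]
  have "ht x - i = ht y - j" using x y assms(5) by simp
  then show "i = j" using assms by linarith
  then show "x = y" using x y assms(5) by metis
qed

lemma conn_high:
  assumes "L \<le> ht r"
  shows "conn E {x \<in> V. L \<le> ht x}"
proof -
  let ?S = "{x \<in> V. L \<le> ht x}"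
  have to_r: "(x, r) \<in> (E \<inter> ?S \<times> ?S)\<^sup>*" if "x \<in> ?S" for x
    using that
  proof (induction "dep x" arbitrary: x rule: less_induct)
    case less
    show ?case
    proof (cases "x = r")
      case False
      then have "par x \<in> ?S" "(x, par x) \<in> E" "dep (par x) < dep x"
        using less.prems par_in ht_par[of x] dep_par[of x] by (auto simp: E_iff)
      then show ?thesis using less by (intro converse_rtrancl_into_rtrancl[of x "par x"]) auto
    qed simp
  qed
  have "sym (E \<inter> ?S \<times> ?S)" using sym_E by (auto simp: sym_def)
  then have "(x, y) \<in> (E \<inter> ?S \<times> ?S)\<^sup>*" if "x \<in> ?S" "y \<in> ?S" for x y
    using rtrancl_via[OF _ to_r[OF that(1)] to_r[OF that(2)]] by blast
  then show ?thesis using r_in assms unfolding conn_def by blast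
qed

definition level :: "nat \<Rightarrow> 'a set" where
  "level t = {x \<in> V. ht x = t}"

lemma card_level_root: "ht r \<le> t \<Longrightarrow> card (level t) \<le> 1"
proof -
  assume "ht r \<le> t"
  then have "level t \<subseteq> {r}"
    using ht_le_root ht_root_eq unfolding level_def by fastforce
  then show ?thesis by (metis card.empty card_mono finite.emptyI finite.insertI is_singletonI is_singleton_altdef)
qed

text \<open>The vertices of height divisible by \<open>L\<close> (shifted by one) are the tops of disjoint descending
  paths with \<open>L\<close> vertices; descending from an arbitrary vertex of height at least \<open>L - 1\<close>, one meets
  such a top after fewer than \<open>L\<close> steps.\<close>

definition path_tops :: "nat \<Rightarrow> 'a set" where
  "path_tops L = {x \<in> V. L dvd Suc (ht x)}"

lemma path_tops_ht: "x \<in> path_tops L \<Longrightarrow> i < L \<Longrightarrow> i \<le> ht x"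
  unfolding path_tops_def by (auto dest: dvd_imp_le)

text \<open>The height of a common vertex would be congruent to both \<open>-1 - i\<close> and
  \<open>-1 - j\<close> modulo \<open>L\<close>, which forces \<open>i = j\<close>.\<close>

lemma path_tops_disjoint:
  assumes "x \<in> path_tops L" "y \<in> path_tops L" "i < L" "j < L" "(child ^^ i) x = (child ^^ j) y"
  shows "x = y \<and> i = j"
proof -
  have V: "x \<in> V" "y \<in> V" and d: "L dvd Suc (ht x)" "L dvd Suc (ht y)"
    using assms by (auto simp: path_tops_def)
  have le: "i \<le> ht x" "j \<le> ht y" using assms path_tops_ht by auto
  have eq: "ht x - i = ht y - j"
    using funpow_child[OF V(1) le(1)] funpow_child[OF V(2) le(2)] assms(5) by simp
  have "int L dvd int (Suc (ht x)) - int (Suc (ht y))" using d by (metis dvd_diff int_dvd_int_iff)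
  moreover have "int (Suc (ht x)) - int (Suc (ht y)) = int i - int j" using eq le by linarith
  ultimately have "int L dvd int i - int j" by simp
  then have "i = j" using assms(3,4) by (metis mod_eq_dvd_iff of_nat_mod mod_less of_nat_eq_iff)
  then show ?thesis using child_chains_disjoint[OF V le assms(5)] by simp
qed

lemma card_high_le:
  assumes "0 < L"
  shows "card {x \<in> V. L \<le> Suc (ht x)} \<le> card (path_tops L) * L"
proof -
  \<comment> \<open>The number of steps is recorded along with the vertex reached, because climbing
    back that many steps recovers \<open>x\<close>; this gives injectivity.\<close>
  define f where "f x = ((child ^^ (Suc (ht x) mod L)) x, Suc (ht x) mod L)" for x
  let ?S = "{x \<in> V. L \<le> Suc (ht x)}"
  have le: "Suc (ht x) mod L \<le> ht x" if "x \<in> ?S" for x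
    using that mod_less_divisor[OF assms, of "Suc (ht x)"] by simp
  have "inj_on f ?S"
  proof (rule inj_onI)
    fix x y assume xy: "x \<in> ?S" "y \<in> ?S" "f x = f y"
    let ?i = "Suc (ht x) mod L"
    have i: "?i = Suc (ht y) mod L" "(child ^^ ?i) x = (child ^^ (Suc (ht y) mod L)) y"
      using xy(3) unfolding f_def by - (erule Pair_inject, assumption)+
    have "(child ^^ ?i) x = (child ^^ ?i) y" using i(2) unfolding i(1) .
    then show "x = y"
      using child_chains_disjoint(1)[of x y ?i ?i] le[OF xy(1)] le[OF xy(2)] xy(1,2) i(1) by simp
  qed
  moreover have "f ` ?S \<subseteq> path_tops L \<times> {..<L}"
  proof
    fix p assume "p \<in> f ` ?S"
    then obtain x where x: "x \<in> ?S" "p = f x" by auto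
    let ?i = "Suc (ht x) mod L"
    have c: "(child ^^ ?i) x \<in> V" "ht ((child ^^ ?i) x) = ht x - ?i"
      using funpow_child[of x ?i] le[OF x(1)] x(1) by auto
    then have "Suc (ht ((child ^^ ?i) x)) = Suc (ht x) - ?i" using le[OF x(1)] by simp
    then have "L dvd Suc (ht ((child ^^ ?i) x))" by (metis dvd_minus_mod)
    then show "p \<in> path_tops L \<times> {..<L}"
      using x c assms by (simp add: f_def path_tops_def)
  qed
  moreover have "finite (path_tops L \<times> {..<L})" using finite_V by (simp add: path_tops_def)
  ultimately have "card ?S \<le> card (path_tops L \<times> {..<L})" by (rule card_inj_on_le)
  then show ?thesis by (simp add: card_cartesian_product)
qed

section \<open>Sparse levels and the choice of a scale\<close>

lemma sum_inverse_squares_le: "(\<Sum>i<m. 1 / (real (Suc i))\<^sup>2) \<le> 2"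
proof -
  \<comment> \<open>The subtracted term makes the claim inductive: the inverse square of m + 1 is at
    most 1 / m - 1 / (m + 1), and the sum telescopes.\<close>
  have "(\<Sum>i<Suc m. 1 / (real (Suc i))\<^sup>2) \<le> 2 - 1 / real (Suc m)" for m
  proof (induction m)
    case (Suc m)
    have "1 / (real (Suc (Suc m)))\<^sup>2 \<le> 1 / (real (Suc m) * real (Suc (Suc m)))"
      unfolding power2_eq_square by (intro divide_left_mono mult_right_mono) auto
    also have "\<dots> = 1 / real (Suc m) - 1 / real (Suc (Suc m))"
      by (simp add: field_simps)
    finally show ?case using Suc by (subst sum.lessThan_Suc) linarith
  qed simp
  then have "(\<Sum>i<Suc m. 1 / (real (Suc i))\<^sup>2) \<le> 2" for m
    by (rule order.trans) simp
  then show ?thesis by (cases m) auto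
qed

lemma card_low_le:
  assumes "\<And>i. i < m \<Longrightarrow> 4 * (Suc i)\<^sup>2 * card (level i) < card V"
  shows "2 * card {x \<in> V. ht x < m} \<le> card V"
proof -
  have "{x \<in> V. ht x < m} = (\<Union>i<m. level i)" by (auto simp: level_def)
  moreover have "card (\<Union>i<m. level i) = (\<Sum>i<m. card (level i))"
    by (rule card_UN_disjoint) (use finite_V in \<open>auto simp: level_def\<close>)
  ultimately have "real (card {x \<in> V. ht x < m}) = (\<Sum>i<m. real (card (level i)))" by simp
  also have "\<dots> \<le> (\<Sum>i<m. real (card V) / 4 * (1 / (real (Suc i))\<^sup>2))"
  proof (rule sum_mono)
    fix i assume "i \<in> {..<m}"
    then have "real (4 * (Suc i)\<^sup>2 * card (level i)) \<le> real (card V)"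
      using assms[of i] by (simp only: of_nat_le_iff lessThan_iff less_imp_le)
    then show "real (card (level i)) \<le> real (card V) / 4 * (1 / (real (Suc i))\<^sup>2)"
      by (simp add: field_simps del: of_nat_Suc)
  qed
  also have "\<dots> = real (card V) / 4 * (\<Sum>i<m. 1 / (real (Suc i))\<^sup>2)"
    by (simp add: sum_distrib_left)
  also have "\<dots> \<le> real (card V) / 4 * 2"
    by (intro mult_left_mono sum_inverse_squares_le) simp
  finally show ?thesis by linarith
qed

text \<open>If every level were sparse, all of \<open>V\<close> would lie in sparse levels, which
  hold at most half of it. The factor 4 combines this half with the bound 2 on the sum of the
  inverse squares. Minimality is kept as a conclusion because it is what makes the other tree rich
  in paths.\<close>

lemma ex_scale:
  obtains L where "0 < L" "card V \<le> 4 * L\<^sup>2 * card (level (L - 1))"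
    "\<And>i. i < L - 1 \<Longrightarrow> 4 * (Suc i)\<^sup>2 * card (level i) < card V"
proof -
  let ?P = "\<lambda>i. card V \<le> 4 * (Suc i)\<^sup>2 * card (level i)"
  have "\<exists>i. ?P i"
  proof (rule ccontr)
    assume "\<not> ?thesis"
    then have "2 * card {x \<in> V. ht x < Suc (ht r)} \<le> card V"
      by (intro card_low_le) (simp add: not_le)
    moreover have "{x \<in> V. ht x < Suc (ht r)} = V" using ht_le_root by (auto simp: less_Suc_eq_le)
    ultimately show False using r_in finite_V by (auto simp: card_eq_0_iff)
  qed
  then have "?P (Least ?P)" by (rule LeastI_ex)
  moreover have "\<not> ?P i" if "i < Least ?P" for i using that by (rule not_less_Least)
  ultimately show thesis by (intro that[of "Suc (Least ?P)"]) (simp_all add: not_le)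
qed

lemma card_path_tops_ge:
  assumes "0 < L" "\<And>i. i < L - 1 \<Longrightarrow> 4 * (Suc i)\<^sup>2 * card (level i) < card V"
  shows "card V \<le> 2 * L * card (path_tops L)"
proof -
  have "2 * card {x \<in> V. ht x < L - 1} \<le> card V" using assms(2) by (rule card_low_le)
  moreover have "card V = card {x \<in> V. ht x < L - 1} + card {x \<in> V. L \<le> Suc (ht x)}"
    by (subst card_Un_disjoint[symmetric]) (use finite_V in \<open>auto intro: arg_cong[where f = card]\<close>)
  ultimately show ?thesis using card_high_le[OF assms(1)] by (simp add: mult.commute)
qed

end

section \<open>Spiders as minors of trees\<close>

definition spider :: "'i set \<Rightarrow> nat \<Rightarrow> ('i \<times> nat) option pair_pre_digraph" where
  "spider I L = \<lparr>pverts = insert None (Some ` (I \<times> {..<L})),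
     parcs = {(u, v). \<exists>a\<in>I. \<exists>l<L.
       (u, v) \<in> {(None, Some (a, 0)), (Some (a, 0), None)} \<or>
       Suc l < L \<and> (u, v) \<in> {(Some (a, l), Some (a, Suc l)), (Some (a, Suc l), Some (a, l))}}\<rparr>"

lemma wf_sym_spider: "wf_sym (spider I L)"
  by (auto simp: wf_sym_def spider_def intro!: symI)

lemma spider_minor_mono:
  assumes "inj_on f I" "f ` I \<subseteq> J"
  shows "is_minor (spider I L) (spider J L)"
proof (rule is_minor_hom[where f = "map_option (map_prod f id)", OF wf_sym_spider])
  show "inj_on (map_option (map_prod f id)) (pverts (spider I L))"
    using assms(1) by (auto simp: inj_on_def spider_def)
  show "map_option (map_prod f id) ` pverts (spider I L) \<subseteq> pverts (spider J L)"
    using assms(2) by (auto simp: spider_def)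
next
  fix u v assume "(u, v) \<in> parcs (spider I L)"
  then obtain a l where al: "a \<in> I" "l < L"
    "(u, v) \<in> {(None, Some (a, 0)), (Some (a, 0), None)} \<or>
     Suc l < L \<and> (u, v) \<in> {(Some (a, l), Some (a, Suc l)), (Some (a, Suc l), Some (a, l))}"
    unfolding spider_def by auto
  then have "f a \<in> J" using assms(2) by auto
  with al show "(map_option (map_prod f id) u, map_option (map_prod f id) v) \<in> parcs (spider J L)"
    unfolding spider_def by auto
qed

text \<open>The vertices of height at least \<open>L\<close> form a connected set, contracted to the
  centre; the chains descending from height \<open>L - 1\<close> are the legs. By
  \<open>L \<le> ht r\<close> the root belongs to that set, so that the top of each leg has a
  parent, which lies in it too.\<close>

lemma (in rooted_tree) spider_minor:
  assumes T: "wf_sym T" "pverts T = V" "parcs T = E" and L: "0 < L" "L \<le> ht r"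
  shows "is_minor (spider (level (L - 1)) L) T"
proof -
  define B where "B u = (case u of None \<Rightarrow> {x \<in> V. L \<le> ht x} | Some (x, l) \<Rightarrow> {(child ^^ l) x})" for u
  have leg: "(child ^^ l) x \<in> V" "ht ((child ^^ l) x) < L" if "x \<in> level (L - 1)" "l < L" for x l
  proof -
    have "x \<in> V" "l \<le> ht x" "ht x < L" using that L by (auto simp: level_def)
    then show "(child ^^ l) x \<in> V" "ht ((child ^^ l) x) < L" using funpow_child[of x l] by auto
  qed
  have "minor_model B (spider (level (L - 1)) L) T"
    unfolding minor_model_def
  proof (intro conjI ballI impI)
    fix u assume "u \<in> pverts (spider (level (L - 1)) L)"
    then show "B u \<subseteq> pverts T" "conn (parcs T) (B u)"
      using leg conn_high[OF L(2)] T by (auto simp: spider_def B_def)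
  next
    fix u v assume uv: "u \<in> pverts (spider (level (L - 1)) L)" "v \<in> pverts (spider (level (L - 1)) L)"
      "u \<noteq> v"
    have "x = y \<and> l = m"
      if "x \<in> level (L - 1)" "y \<in> level (L - 1)" "l < L" "m < L" "(child ^^ l) x = (child ^^ m) y"
      for x y l m
    proof -
      have "l \<le> ht x" "m \<le> ht y" using that by (auto simp: level_def)
      then show ?thesis
        using that child_chains_disjoint[of x y l m] by (auto simp: level_def)
    qed
    moreover have "(child ^^ l) x \<notin> {x \<in> V. L \<le> ht x}" if "x \<in> level (L - 1)" "l < L" for x l
      using leg(2)[OF that] by simp
    ultimately show "B u \<inter> B v = {}"
      using uv unfolding spider_def B_def by (cases u; cases v) auto
  next
    fix e assume e: "e \<in> parcs (spider (level (L - 1)) L)"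
    have top: "\<exists>x\<in>{x \<in> V. L \<le> ht x}. (x, a) \<in> E \<and> (a, x) \<in> E" if "a \<in> level (L - 1)" for a
    proof -
      have a: "a \<in> V" "ht a = L - 1" using that by (auto simp: level_def)
      then have "a \<noteq> r" using L by auto
      then show ?thesis using a par_in[of a] ht_par[of a] L
        by (intro bexI[of _ "par a"]) (auto simp: E_iff)
    qed
    have step: "((child ^^ l) a, (child ^^ Suc l) a) \<in> E \<and> ((child ^^ Suc l) a, (child ^^ l) a) \<in> E"
      if "a \<in> level (L - 1)" "Suc l < L" for a l
    proof -
      have "((child ^^ l) a, (child ^^ Suc l) a) \<in> E"
        by (rule child_adjacent) (use that in \<open>auto simp: level_def\<close>)
      then show ?thesis using symD[OF sym_E] by blast
    qed
    obtain u v where uv: "e = (u, v)" by (cases e)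
    obtain a l where al: "a \<in> level (L - 1)" "l < L"
      "(u, v) \<in> {(None, Some (a, 0)), (Some (a, 0), None)} \<or>
       Suc l < L \<and> (u, v) \<in> {(Some (a, l), Some (a, Suc l)), (Some (a, Suc l), Some (a, l))}"
      using e uv unfolding spider_def by auto
    then have "\<exists>x\<in>B u. \<exists>y\<in>B v. (x, y) \<in> E"
      using top[OF al(1)] step[OF al(1), of l] unfolding B_def by auto
    then show "case e of (u, v) \<Rightarrow> \<exists>x\<in>B u. \<exists>y\<in>B v. (x, y) \<in> parcs T"
      using uv T by simp
  qed
  then show ?thesis using T is_minor_iff by blast
qed

subsection \<open>Treewidth\<close>

text \<open>A \<open>LEAST\<close> is attained only if there is some decomposition at all; the
  assumption supplies one.\<close>

lemma treewidth_attained: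
  fixes T :: "nat pair_pre_digraph"
  assumes "tree_decomposition G T bag"
  obtains T' :: "nat pair_pre_digraph" and bag' where "tree_decomposition G T' bag'"
    "decomposition_width T' bag' = treewidth G"
proof -
  have "\<exists>w. \<exists>(T :: nat pair_pre_digraph) bag.
      tree_decomposition G T bag \<and> decomposition_width T bag = w"
    using assms by blast
  from LeastI_ex[OF this] show thesis
    unfolding treewidth_def[symmetric] using that by blast
qed

lemma treewidth_le:
  fixes T :: "nat pair_pre_digraph"
  assumes "tree_decomposition G T bag"
  shows "treewidth G \<le> decomposition_width T bag"
  unfolding treewidth_def using assms by (intro Least_le) blast

text \<open>A bag collects the fibres over a node and its parent, so that the fibres over both ends
  of any tree edge share a bag. A vertex \<open>v\<close> then lies in the bags of
  \<open>f v\<close> and of the children of \<open>f v\<close>, which induce a star.\<close>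

lemma decomposition_over_tree:
  fixes T :: "nat pair_pre_digraph" and f :: "'a \<Rightarrow> nat"
  assumes T: "undirected_tree T" and G: "finite (pverts G)" "wf_sym G"
    and f: "\<And>v. v \<in> pverts G \<Longrightarrow> f v \<in> pverts T"
      "\<And>u v. (u, v) \<in> parcs G \<Longrightarrow> f u = f v \<or> (f u, f v) \<in> parcs T"
    and fibre: "\<And>t. t \<in> pverts T \<Longrightarrow> card {v \<in> pverts G. f v = t} \<le> M"
  obtains bag where "tree_decomposition G T bag" "decomposition_width T bag \<le> 2 * M"
proof -
  obtain r par dep where "rooted_tree (pverts T) (parcs T) r par dep"
    using undirected_tree_rooted[OF T] .
  then interpret rooted_tree "pverts T" "parcs T" r par dep .
  define bag where "bag t = {v \<in> pverts G. f v = t \<or> t \<noteq> r \<and> f v = par t}" for t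
  have "tree_decomposition G T bag"
    unfolding tree_decomposition_def
  proof (intro conjI ballI T)
    show "(\<Union>t\<in>pverts T. bag t) = pverts G" using f(1) by (auto simp: bag_def)
  next
    fix e assume e: "e \<in> parcs G"
    obtain u v where uv: "e = (u, v)" by (cases e)
    have V: "u \<in> pverts G" "v \<in> pverts G" using e uv G(2) by (auto simp: wf_sym_def)
    consider "f u = f v" | "f u \<noteq> r" "f v = par (f u)" | "f v \<noteq> r" "f u = par (f v)"
      using f(2) e uv E_iff by blast
    then have "\<exists>t\<in>pverts T. u \<in> bag t \<and> v \<in> bag t"
    proof cases
      case 1
      then show ?thesis using f(1) V by (auto simp: bag_def)
    next
      case 2
      then show ?thesis using f(1) V by (intro bexI[of _ "f u"]) (auto simp: bag_def)
    next
      case 3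
      then show ?thesis using f(1) V by (intro bexI[of _ "f v"]) (auto simp: bag_def)
    qed
    then show "case e of (u, v) \<Rightarrow> \<exists>t\<in>pverts T. u \<in> bag t \<and> v \<in> bag t" using uv by simp
  next
    fix v assume v: "v \<in> pverts G"
    let ?A = "{t \<in> pverts T. v \<in> bag t}"
    have A: "?A = (\<Union>t\<in>?A. {f v, t})"
      using f(1)[OF v] v by (auto simp: bag_def)
    have "conn (parcs T) (\<Union>t\<in>?A. {f v, t})"
    proof (rule conn_UN[where F = UNIV])
      show "conn UNIV ?A"
        using f(1)[OF v] v by (auto simp: conn_def bag_def)
    next
      fix t assume "t \<in> ?A"
      then consider "t = f v" | "t \<in> pverts T" "t \<noteq> r" "f v = par t" by (auto simp: bag_def)
      then show "conn (parcs T) {f v, t}"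
      proof cases
        case 2
        then have "(t, f v) \<in> parcs T" using f(1)[OF v] by (auto simp: E_iff)
        then show ?thesis using conn_insert[OF sym_E conn_singleton, of t t "f v"] by simp
      qed simp
    qed auto
    then show "connected (with_proj T \<restriction> ?A)"
      using A connected_iff_conn[OF sym_E, of ?A] by auto
  qed
  moreover have "decomposition_width T bag \<le> 2 * M"
  proof -
    have "card (bag t) \<le> 2 * M" if t: "t \<in> pverts T" for t
    proof -
      have "bag t \<subseteq> {v \<in> pverts G. f v = t} \<union> {v \<in> pverts G. t \<noteq> r \<and> f v = par t}"
        by (auto simp: bag_def)
      then have "card (bag t) \<le> card ({v \<in> pverts G. f v = t} \<union> {v \<in> pverts G. t \<noteq> r \<and> f v = par t})"
        using G(1) by (intro card_mono) auto
      also have "\<dots> \<le> card {v \<in> pverts G. f v = t} + card {v \<in> pverts G. t \<noteq> r \<and> f v = par t}"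
        by (rule card_Un_le)
      also have "\<dots> \<le> M + M"
        using fibre[OF t] fibre[OF par_in[OF t]] by (cases "t = r") auto
      finally show ?thesis by simp
    qed
    then have "Max ((\<lambda>t. card (bag t)) ` pverts T) \<le> 2 * M"
      using finite_V r_in by (subst Max_le_iff) auto
    then show ?thesis by (simp add: decomposition_width_def)
  qed
  ultimately show thesis by (rule that)
qed

text \<open>Both projections map an edge of the strong product to an edge or to a single vertex. The
  factors themselves are the decomposition trees; as their vertices are natural numbers, these
  decompositions compete in \<open>treewidth\<close>.\<close>

lemma strong_product_decompositions:
  fixes T1 T2 :: "nat pair_pre_digraph"
  assumes T: "undirected_tree T1" "undirected_tree T2"
  defines "G \<equiv> strong_product T1 T2"
  obtains bag1 bag2 where
    "tree_decomposition G T1 bag1" "decomposition_width T1 bag1 \<le> 2 * card (pverts T2)"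
    "tree_decomposition G T2 bag2" "decomposition_width T2 bag2 \<le> 2 * card (pverts T1)"
proof -
  note T1 = undirected_treeD[OF T(1)] and T2 = undirected_treeD[OF T(2)]
  have wf: "wf_sym G" using T1 T2 by (simp add: G_def wf_sym_strong)
  have fin: "finite (pverts G)" using T1 T2 by (simp add: G_def strong_product_def)
  have "{v \<in> pverts G. fst v = t} \<subseteq> Pair t ` pverts T2" for t
    by (auto simp: G_def strong_product_def)
  then have "card {v \<in> pverts G. fst v = t} \<le> card (pverts T2)" for t
    using T2(2) by (meson card_image_le card_mono finite_imageI order.trans)
  then obtain bag1 where 1: "tree_decomposition G T1 bag1"
    "decomposition_width T1 bag1 \<le> 2 * card (pverts T2)"
    by (rule decomposition_over_tree[OF T(1) fin wf, of fst, rotated 2])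
      (auto simp: G_def strong_product_def)
  have "{v \<in> pverts G. snd v = t} \<subseteq> (\<lambda>x. (x, t)) ` pverts T1" for t
    by (auto simp: G_def strong_product_def)
  then have "card {v \<in> pverts G. snd v = t} \<le> card (pverts T1)" for t
    using T1(2) by (meson card_image_le card_mono finite_imageI order.trans)
  then obtain bag2 where 2: "tree_decomposition G T2 bag2"
    "decomposition_width T2 bag2 \<le> 2 * card (pverts T1)"
    by (rule decomposition_over_tree[OF T(2) fin wf, of snd, rotated 2])
      (auto simp: G_def strong_product_def)
  show thesis using that 1 2 by blast
qed

text \<open>The nodes whose bags meet a given member form a subtree. Subtrees of touching members
  intersect, since a shared vertex or a joining edge lies in some bag, and the Helly property gives
  a node common to all of them.\<close>

lemma bag_meets_bramble:
  assumes D: "tree_decomposition G T bag" and G: "wf_sym G"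
    and F: "F \<noteq> {}" "\<And>X. X \<in> F \<Longrightarrow> X \<subseteq> pverts G \<and> conn (parcs G) X"
    and touch: "\<And>X Y. X \<in> F \<Longrightarrow> Y \<in> F \<Longrightarrow> X \<inter> Y \<noteq> {} \<or> (\<exists>x\<in>X. \<exists>y\<in>Y. (x, y) \<in> parcs G)"
  obtains t where "t \<in> pverts T" "\<And>X. X \<in> F \<Longrightarrow> X \<inter> bag t \<noteq> {}"
proof -
  have T: "undirected_tree T"
    and cover: "(\<Union>t\<in>pverts T. bag t) = pverts G"
    and arcs: "\<And>u v. (u, v) \<in> parcs G \<Longrightarrow> \<exists>t\<in>pverts T. u \<in> bag t \<and> v \<in> bag t"
    and con: "\<And>v. v \<in> pverts G \<Longrightarrow> connected (with_proj T \<restriction> {t \<in> pverts T. v \<in> bag t})"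
    using D by (auto simp: tree_decomposition_def)
  obtain r par dep where "rooted_tree (pverts T) (parcs T) r par dep"
    using undirected_tree_rooted[OF T] .
  then interpret rooted_tree "pverts T" "parcs T" r par dep .
  define N where "N X = (\<Union>v\<in>X. {t \<in> pverts T. v \<in> bag t})" for X
  have N: "N X \<subseteq> pverts T \<and> conn (parcs T) (N X)" if X: "X \<in> F" for X
  proof
    show "N X \<subseteq> pverts T" by (auto simp: N_def)
    have XG: "X \<subseteq> pverts G" "conn (parcs G) X" using F(2)[OF X] by auto
    show "conn (parcs T) (N X)"
      unfolding N_def
    proof (rule conn_UN[OF XG(2)])
      fix v assume "v \<in> X"
      then show "conn (parcs T) {t \<in> pverts T. v \<in> bag t}"
        using con[of v] connected_iff_conn[OF sym_E, of "{t \<in> pverts T. v \<in> bag t}"] XG(1) by auto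
    next
      fix u v assume "(u, v) \<in> parcs G"
      then show "{t \<in> pverts T. u \<in> bag t} \<inter> {t \<in> pverts T. v \<in> bag t} \<noteq> {} \<or>
        (\<exists>x\<in>{t \<in> pverts T. u \<in> bag t}. \<exists>y\<in>{t \<in> pverts T. v \<in> bag t}. (x, y) \<in> parcs T)"
        using arcs by blast
    qed
  qed
  have meet: "N X \<inter> N Y \<noteq> {}" if XY: "X \<in> F" "Y \<in> F" for X Y
    using touch[OF XY]
  proof (elim disjE)
    assume "X \<inter> Y \<noteq> {}"
    then obtain v where "v \<in> X" "v \<in> Y" by auto
    moreover have "\<exists>t\<in>pverts T. v \<in> bag t" using cover F(2)[OF XY(1)] \<open>v \<in> X\<close> by blast
    ultimately show ?thesis by (auto simp: N_def)
  next
    assume "\<exists>x\<in>X. \<exists>y\<in>Y. (x, y) \<in> parcs G"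
    then obtain x y where "x \<in> X" "y \<in> Y" "(x, y) \<in> parcs G" by blast
    moreover from this obtain t where "t \<in> pverts T" "x \<in> bag t" "y \<in> bag t" using arcs by blast
    ultimately show ?thesis by (auto simp: N_def)
  qed
  obtain t where t: "t \<in> pverts T" "\<And>S. S \<in> N ` F \<Longrightarrow> t \<in> S"
    by (rule helly[of "N ` F"]) (use F(1) N meet in auto)
  show thesis
  proof (rule that[OF t(1)])
    fix X assume "X \<in> F"
    then have "t \<in> N X" using t(2) by auto
    then show "X \<inter> bag t \<noteq> {}" by (auto simp: N_def)
  qed
qed

text \<open>The crosses of the whole grid form a bramble of order \<open>k\<close> only. Restricting them to a subgrid
  lowers the order by one, but leaves room for two further sets.\<close>

definition grid_bramble :: "nat \<Rightarrow> (nat \<times> nat) set set" where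
  "grid_bramble k =
     {(\<lambda>y. (i, y)) ` {1..k-1} \<union> (\<lambda>x. (x, j)) ` {1..k-1} |i j. i \<in> {1..k-1} \<and> j \<in> {1..k-1}} \<union>
     {(\<lambda>x. (x, k)) ` {1..k}, (\<lambda>y. (k, y)) ` {1..k-1}}"

lemma grid_bramble_conn:
  assumes k: "2 \<le> k" and X: "X \<in> grid_bramble k"
  shows "X \<subseteq> pverts (grid k) \<and> conn (parcs (grid k)) X"
proof -
  have sym: "sym (parcs (grid k))" using wf_sym_grid by (simp add: wf_sym_def)
  have h: "conn (parcs (grid k)) ((\<lambda>x. (x, j)) ` {1..m})" if "1 \<le> m" "m \<le> k" "j \<in> {1..k}" for j m
    by (rule conn_path[OF sym]) (use that in \<open>auto simp: grid_def\<close>)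
  have v: "conn (parcs (grid k)) ((\<lambda>y. (i, y)) ` {1..m})" if "1 \<le> m" "m \<le> k" "i \<in> {1..k}" for i m
    by (rule conn_path[OF sym]) (use that in \<open>auto simp: grid_def\<close>)
  consider i j where "i \<in> {1..k-1}" "j \<in> {1..k-1}"
      "X = (\<lambda>y. (i, y)) ` {1..k-1} \<union> (\<lambda>x. (x, j)) ` {1..k-1}"
    | "X = (\<lambda>x. (x, k)) ` {1..k}" | "X = (\<lambda>y. (k, y)) ` {1..k-1}"
    using X unfolding grid_bramble_def by blast
  then show ?thesis
  proof cases
    case 1
    have "conn (parcs (grid k)) ((\<lambda>y. (i, y)) ` {1..k-1} \<union> (\<lambda>x. (x, j)) ` {1..k-1})"
    proof (rule conn_Un[OF sym v h])
      have "(i, j) \<in> (\<lambda>y. (i, y)) ` {1..k-1} \<inter> (\<lambda>x. (x, j)) ` {1..k-1}" using 1 by auto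
      then show "(\<lambda>y. (i, y)) ` {1..k-1} \<inter> (\<lambda>x. (x, j)) ` {1..k-1} \<noteq> {} \<or>
          (\<exists>x\<in>(\<lambda>y. (i, y)) ` {1..k-1}. \<exists>y\<in>(\<lambda>x. (x, j)) ` {1..k-1}. (x, y) \<in> parcs (grid k))"
        by blast
    qed (use 1 k in auto)
    then show ?thesis using 1 by (auto simp: grid_def)
  next
    case 2
    then show ?thesis using h[of k k] k by (auto simp: grid_def)
  next
    case 3
    then show ?thesis using v[of "k - 1" k] k by (auto simp: grid_def)
  qed
qed

lemma grid_bramble_touch:
  assumes k: "2 \<le> k" and XY: "X \<in> grid_bramble k" "Y \<in> grid_bramble k"
  shows "X \<inter> Y \<noteq> {} \<or> (\<exists>x\<in>X. \<exists>y\<in>Y. (x, y) \<in> parcs (grid k))"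
proof -
  let ?cross = "\<lambda>i j. (\<lambda>y. (i, y)) ` {1..k-1} \<union> (\<lambda>x. (x, j)) ` {1..k-1}"
  let ?row = "(\<lambda>x. (x, k)) ` {1..k}" and ?col = "(\<lambda>y. (k, y)) ` {1..k-1}"
  let ?R = "parcs (grid k)"
  have cc: "(i, j') \<in> ?cross i j \<inter> ?cross i' j'" if "i \<in> {1..k-1}" "j' \<in> {1..k-1}" for i j i' j'
    using that by auto
  have cr: "(i, k - 1) \<in> ?cross i j" "(i, k) \<in> ?row" "((i, k - 1), (i, k)) \<in> ?R" "((i, k), (i, k - 1)) \<in> ?R"
    if "i \<in> {1..k-1}" for i j
    using that k by (auto simp: grid_def)
  have cl: "(k - 1, j) \<in> ?cross i j" "(k, j) \<in> ?col" "((k - 1, j), (k, j)) \<in> ?R" "((k, j), (k - 1, j)) \<in> ?R"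
    if "j \<in> {1..k-1}" for i j
    using that k by (auto simp: grid_def)
  have rc: "(k, k) \<in> ?row" "(k, k - 1) \<in> ?col" "((k, k), (k, k - 1)) \<in> ?R" "((k, k - 1), (k, k)) \<in> ?R"
    using k by (auto simp: grid_def)
  have edgeI: ?thesis if "x \<in> X" "y \<in> Y" "(x, y) \<in> ?R" for x y
    using that by blast
  have ne: "?row \<noteq> {}" "?col \<noteq> {}" using k by auto
  have shapes: "(\<exists>i\<in>{1..k-1}. \<exists>j\<in>{1..k-1}. X = ?cross i j) \<or> X = ?row \<or> X = ?col"
    if "X \<in> grid_bramble k" for X
    using that unfolding grid_bramble_def by (elim UnE CollectE exE conjE insertE emptyE) blast+
  show ?thesis
    using shapes[OF XY(1)] shapes[OF XY(2)]
  proof (elim disjE bexE)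
    fix i j i' j' assume "i \<in> {1..k-1}" "j' \<in> {1..k-1}" "X = ?cross i j" "Y = ?cross i' j'"
    then have "(i, j') \<in> X \<inter> Y" using cc by blast
    then show ?thesis by blast
  next
    fix i j assume *: "i \<in> {1..k-1}" "X = ?cross i j" "Y = ?row"
    show ?thesis by (rule edgeI[of "(i, k - 1)" "(i, k)"]) (unfold *(2,3), (rule cr[OF *(1)])+)
  next
    fix i j assume *: "j \<in> {1..k-1}" "X = ?cross i j" "Y = ?col"
    show ?thesis by (rule edgeI[of "(k - 1, j)" "(k, j)"]) (unfold *(2,3), (rule cl[OF *(1)])+)
  next
    fix i j assume *: "i \<in> {1..k-1}" "X = ?row" "Y = ?cross i j"
    show ?thesis by (rule edgeI[of "(i, k)" "(i, k - 1)"]) (unfold *(2,3), (rule cr[OF *(1)])+)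
  next
    fix i j assume *: "j \<in> {1..k-1}" "X = ?col" "Y = ?cross i j"
    show ?thesis by (rule edgeI[of "(k, j)" "(k - 1, j)"]) (unfold *(2,3), (rule cl[OF *(1)])+)
  next
    assume *: "X = ?row" "Y = ?col"
    show ?thesis by (rule edgeI[of "(k, k)" "(k, k - 1)"]) (unfold *, (rule rc)+)
  next
    assume *: "X = ?col" "Y = ?row"
    show ?thesis by (rule edgeI[of "(k, k - 1)" "(k, k)"]) (unfold *, (rule rc)+)
  next
    assume "X = ?row" "Y = ?row"
    then show ?thesis using ne(1) by (intro disjI1) simp
  next
    assume "X = ?col" "Y = ?col"
    then show ?thesis using ne(2) by (intro disjI1) simp
  qed
qed

text \<open>A set that misses a line of the subgrid in either direction misses the cross of the two
  lines; hence \<open>k - 1\<close> vertices are needed inside the subgrid. The outer row and the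
  outer column are disjoint from it and from each other, and cost one more vertex each.\<close>

lemma grid_bramble_order:
  assumes k: "2 \<le> k" and W: "finite W" "\<And>X. X \<in> grid_bramble k \<Longrightarrow> X \<inter> W \<noteq> {}"
  shows "k + 1 \<le> card W"
proof -
  let ?cross = "\<lambda>i j. (\<lambda>y. (i, y)) ` {1..k-1} \<union> (\<lambda>x. (x, j)) ` {1..k-1}"
  define U where "U = W \<inter> {1..k-1} \<times> {1..k-1}"
  have fin: "finite U" using W(1) by (simp add: U_def)
  have "(\<lambda>x. (x, k)) ` {1..k} \<in> grid_bramble k" "(\<lambda>y. (k, y)) ` {1..k-1} \<in> grid_bramble k"
    by (simp_all add: grid_bramble_def)
  from W(2)[OF this(1)] W(2)[OF this(2)] obtain p q
    where p: "p \<in> W" "snd p = k" and q: "q \<in> W" "fst q = k" "snd q \<le> k - 1"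
    by fastforce
  have "{1..k-1} \<subseteq> fst ` U \<or> {1..k-1} \<subseteq> snd ` U"
  proof (rule ccontr)
    assume "\<not> ?thesis"
    then obtain i j where ij: "i \<in> {1..k-1}" "i \<notin> fst ` U" "j \<in> {1..k-1}" "j \<notin> snd ` U" by blast
    then have "?cross i j \<in> grid_bramble k" unfolding grid_bramble_def by blast
    then obtain w where "w \<in> ?cross i j" "w \<in> W" using W(2) by blast
    moreover from this have "w \<in> U" using ij unfolding U_def by auto
    ultimately show False using ij by force
  qed
  then have "k - 1 \<le> card U"
  proof
    assume "{1..k-1} \<subseteq> fst ` U"
    then have "card {1..k-1} \<le> card (fst ` U)" using fin by (intro card_mono) auto
    also have "\<dots> \<le> card U" using fin by (rule card_image_le)
    finally show ?thesis by simp
  next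
    assume "{1..k-1} \<subseteq> snd ` U"
    then have "card {1..k-1} \<le> card (snd ` U)" using fin by (intro card_mono) auto
    also have "\<dots> \<le> card U" using fin by (rule card_image_le)
    finally show ?thesis by simp
  qed
  moreover have "p \<notin> U" "q \<notin> U" "p \<noteq> q" using p q k by (auto simp: U_def)
  then have "card (insert p (insert q U)) = card U + 2" using fin by simp
  moreover have "card (insert p (insert q U)) \<le> card W"
    by (rule card_mono) (use W p q in \<open>auto simp: U_def\<close>)
  ultimately show ?thesis using k by linarith
qed

lemma decomposition_width_ge:
  assumes D: "tree_decomposition G T bag" and t: "t \<in> pverts T" "k + 1 \<le> card (bag t)"
  shows "k \<le> decomposition_width T bag"
proof -
  have "finite (pverts T)"
    using D undirected_treeD by (auto simp: tree_decomposition_def)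
  then have "card (bag t) \<le> Max ((\<lambda>t. card (bag t)) ` pverts T)"
    using t by (intro Max_ge) auto
  then show ?thesis using t by (simp add: decomposition_width_def)
qed

text \<open>The bramble is lifted to \<open>G\<close> by replacing grid points with their branch
  sets. The grid points whose branch sets meet the common bag hit the bramble of the grid, and the
  branch sets being disjoint, the bag has at least as many vertices.\<close>

lemma grid_minor_width:
  assumes k: "2 \<le> k" and minor: "is_minor (grid k) G" and G: "wf_sym G" "finite (pverts G)"
    and D: "tree_decomposition G T bag"
  shows "k \<le> decomposition_width T bag"
proof -
  obtain B where B: "minor_model B (grid k) G" using minor is_minor_iff[OF G(1)] by blast
  define lift where "lift X = (\<Union>v\<in>X. B v)" for X
  have lift: "lift X \<subseteq> pverts G \<and> conn (parcs G) (lift X)" if X: "X \<in> grid_bramble k" for X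
  proof
    have X: "X \<subseteq> pverts (grid k)" "conn (parcs (grid k)) X" using grid_bramble_conn[OF k X] by auto
    show "lift X \<subseteq> pverts G" using B X unfolding lift_def minor_model_def by blast
    show "conn (parcs G) (lift X)"
      unfolding lift_def
    proof (rule conn_UN[OF X(2)])
      fix v assume "v \<in> X"
      then show "conn (parcs G) (B v)" using X B by (auto simp: minor_model_def)
    next
      fix u v assume "(u, v) \<in> parcs (grid k)"
      then show "B u \<inter> B v \<noteq> {} \<or> (\<exists>x\<in>B u. \<exists>y\<in>B v. (x, y) \<in> parcs G)"
        using B by (auto simp: minor_model_def)
    qed
  qed
  have touch: "lift X \<inter> lift Y \<noteq> {} \<or> (\<exists>x\<in>lift X. \<exists>y\<in>lift Y. (x, y) \<in> parcs G)"
    if XY: "X \<in> grid_bramble k" "Y \<in> grid_bramble k" for X Y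
    using grid_bramble_touch[OF k XY]
  proof
    assume "X \<inter> Y \<noteq> {}"
    then obtain v where v: "v \<in> X" "v \<in> Y" by auto
    then have "v \<in> pverts (grid k)" using grid_bramble_conn[OF k XY(1)] by auto
    then have "B v \<noteq> {}" using B conn_nonempty by (auto simp: minor_model_def)
    then show ?thesis using v by (auto simp: lift_def)
  next
    assume "\<exists>x\<in>X. \<exists>y\<in>Y. (x, y) \<in> parcs (grid k)"
    then obtain x y where xy: "x \<in> X" "y \<in> Y" "(x, y) \<in> parcs (grid k)" by blast
    then have "\<exists>a\<in>B x. \<exists>b\<in>B y. (a, b) \<in> parcs G" using B by (auto simp: minor_model_def)
    then show ?thesis using xy unfolding lift_def by blast
  qed
  obtain t where t: "t \<in> pverts T" "\<And>X. X \<in> lift ` grid_bramble k \<Longrightarrow> X \<inter> bag t \<noteq> {}"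
  proof (rule bag_meets_bramble[OF D G(1), of "lift ` grid_bramble k"])
    show "lift ` grid_bramble k \<noteq> {}" by (auto simp: grid_bramble_def)
  qed (use lift touch in auto)
  define W where "W = {v \<in> pverts (grid k). B v \<inter> bag t \<noteq> {}}"
  have "finite W" by (simp add: W_def grid_def)
  have "k + 1 \<le> card W"
  proof (rule grid_bramble_order[OF k \<open>finite W\<close>])
    fix X assume X: "X \<in> grid_bramble k"
    then have "lift X \<inter> bag t \<noteq> {}" using t(2) by blast
    then obtain v where "v \<in> X" "B v \<inter> bag t \<noteq> {}" by (auto simp: lift_def)
    moreover from this have "v \<in> pverts (grid k)" using grid_bramble_conn[OF k X] by auto
    ultimately show "X \<inter> W \<noteq> {}" by (auto simp: W_def)
  qed
  also have "card W \<le> card (bag t)"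
  proof (rule card_inj_on_le)
    define f where "f v = (SOME x. x \<in> B v \<inter> bag t)" for v
    have f: "f v \<in> B v \<inter> bag t" if "v \<in> W" for v
      using that some_in_eq[of "B v \<inter> bag t"] unfolding f_def W_def by blast
    show "inj_on f W"
    proof (rule inj_onI)
      fix u v assume uv: "u \<in> W" "v \<in> W" "f u = f v"
      then have "f u \<in> B u \<inter> B v" using f[OF uv(1)] f[OF uv(2)] by auto
      moreover have "B u \<inter> B v = {}" if "u \<noteq> v"
        using B uv(1,2) that by (auto simp: minor_model_def W_def)
      ultimately show "u = v" by auto
    qed
    show "f ` W \<subseteq> bag t" using f by auto
    have "bag t \<subseteq> pverts G" using D t(1) by (auto simp: tree_decomposition_def)
    then show "finite (bag t)" using G(2) finite_subset by blast
  qed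
  finally show ?thesis using decomposition_width_ge[OF D t(1)] by simp
qed

text \<open>The bramble argument starts at order 2. For order 1 the edge steps in: it forces a bag
  with two vertices.\<close>

lemma gm_le_width:
  assumes G: "wf_sym G" "finite (pverts G)" and edge: "(u, v) \<in> parcs G" "u \<noteq> v"
    and D: "tree_decomposition G T bag"
  shows "gm G \<le> decomposition_width T bag"
proof -
  have "pverts G \<noteq> {}" using G(1) edge by (auto simp: wf_sym_def)
  note gm = gm_minor[OF G this]
  show ?thesis
  proof (cases "gm G = 1")
    case True
    obtain t where t: "t \<in> pverts T" "u \<in> bag t" "v \<in> bag t"
      using D edge by (auto simp: tree_decomposition_def)
    have "bag t \<subseteq> pverts G" using D t(1) by (auto simp: tree_decomposition_def)
    then have "finite (bag t)" using G(2) finite_subset by blast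
    then have "card {u, v} \<le> card (bag t)" using t by (intro card_mono) auto
    then show ?thesis using decomposition_width_ge[OF D t(1), of 1] edge(2) True by simp
  next
    case False
    then show ?thesis using grid_minor_width[OF _ gm(2) G D] gm(1) by simp
  qed
qed

subsection \<open>Linking in the product with a spider\<close>

text \<open>A linkage of \<open>n\<close> pairs, by connected sets instead of paths because branch
  sets will absorb them. Carrying the region \<open>U\<close> along makes concatenated linkages
  disjoint as soon as their regions are, without comparing single strands.\<close>

definition strands ::
    "('a \<times> 'a) set \<Rightarrow> nat \<Rightarrow> (nat \<Rightarrow> 'a set) \<Rightarrow> 'a set \<Rightarrow> (nat \<Rightarrow> 'a) \<Rightarrow> (nat \<Rightarrow> 'a) \<Rightarrow> bool" where
  "strands E n R U y z \<longleftrightarrow>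
     (\<forall>i<n. conn E (R i) \<and> R i \<subseteq> U \<and> y i \<in> R i \<and> z i \<in> R i) \<and>
     (\<forall>i<n. \<forall>j<n. i \<noteq> j \<longrightarrow> R i \<inter> R j = {})"

lemma strands_concat:
  assumes "sym E" "strands E n R U y z" "strands E n R' U' y' z'" "U \<inter> U' = {}"
    "\<And>i. i < n \<Longrightarrow> (z i, y' i) \<in> E"
  shows "strands E n (\<lambda>i. R i \<union> R' i) (U \<union> U') y z'"
  unfolding strands_def
proof (intro conjI allI impI)
  fix i assume i: "i < n"
  show "conn E (R i \<union> R' i)"
  proof (rule conn_Un[OF assms(1)])
    have "z i \<in> R i" "y' i \<in> R' i" using assms i by (auto simp: strands_def)
    then show "R i \<inter> R' i \<noteq> {} \<or> (\<exists>x\<in>R i. \<exists>y\<in>R' i. (x, y) \<in> E)" using assms(5)[OF i] by blast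
  qed (use assms i in \<open>auto simp: strands_def\<close>)
  show "R i \<union> R' i \<subseteq> U \<union> U'" "y i \<in> R i \<union> R' i" "z' i \<in> R i \<union> R' i"
    using assms i by (auto simp: strands_def)
next
  fix i j assume "i < n" "j < n" "i \<noteq> j"
  then have "R i \<inter> R j = {}" "R' i \<inter> R' j = {}" "R i \<subseteq> U" "R j \<subseteq> U" "R' i \<subseteq> U'" "R' j \<subseteq> U'"
    using assms by (auto simp: strands_def)
  then show "(R i \<union> R' i) \<inter> (R j \<union> R' j) = {}" using assms(4) by blast
qed

lemma strands_reindex:
  assumes "strands E n R U y z" "\<And>i. i < n \<Longrightarrow> f i < n" "inj_on f {..<n}"
  shows "strands E n (\<lambda>i. R (f i)) U (\<lambda>i. y (f i)) (\<lambda>i. z (f i))"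
  using assms unfolding strands_def inj_on_def by (metis lessThan_iff)

lemma strands_reverse:
  assumes "strands E n R U y z"
  shows "strands E n (\<lambda>i. R (n - 1 - i)) U (\<lambda>i. y (n - 1 - i)) (\<lambda>i. z (n - 1 - i))"
  by (rule strands_reindex[OF assms, of "\<lambda>i. n - 1 - i"]) (auto simp: inj_on_def)

lemma strands_points: "inj_on p {..<n} \<Longrightarrow> strands E n (\<lambda>i. {p i}) (p ` {..<n}) p p"
  by (auto simp: strands_def inj_on_def)

lemma strands_cong:
  assumes "strands E n R U y z" "\<And>i. i < n \<Longrightarrow> y i = y' i" "\<And>i. i < n \<Longrightarrow> z i = z' i"
  shows "strands E n R U y' z'"
  using assms by (auto simp: strands_def)

lemma strands_mono: "strands E n R U y z \<Longrightarrow> U \<subseteq> U' \<Longrightarrow> strands E n R U' y z"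
  by (fastforce simp: strands_def)

definition path_in :: "'b pair_pre_digraph \<Rightarrow> (nat \<Rightarrow> 'b) \<Rightarrow> nat \<Rightarrow> bool" where
  "path_in H q M \<longleftrightarrow> inj_on q {..<M} \<and> q ` {..<M} \<subseteq> pverts H \<and>
     (\<forall>p. Suc p < M \<longrightarrow> (q p, q (Suc p)) \<in> parcs H)"

lemma path_inD:
  assumes "path_in H q M"
  shows "i < M \<Longrightarrow> j < M \<Longrightarrow> q i = q j \<longleftrightarrow> i = j" "i < M \<Longrightarrow> q i \<in> pverts H"
    "q ` {..<M} \<subseteq> pverts H" "Suc i < M \<Longrightarrow> (q i, q (Suc i)) \<in> parcs H"
  using assms by (auto simp: path_in_def inj_on_def)

lemma path_in_shift: "path_in H q M \<Longrightarrow> s + M' \<le> M \<Longrightarrow> path_in H (\<lambda>p. q (s + p)) M'"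
proof -
  assume q: "path_in H q M" and s: "s + M' \<le> M"
  have "q (s + i) = q (s + j) \<longleftrightarrow> i = j" if "i < M'" "j < M'" for i j
    using path_inD(1)[OF q, of "s + i" "s + j"] that s by simp
  then show ?thesis
    using path_inD(2,4)[OF q] s unfolding path_in_def inj_on_def by auto
qed

locale spider_host =
  fixes I :: "'i set" and L :: nat and H :: "'b pair_pre_digraph"
  assumes wf_H: "wf_sym H"
begin

abbreviation G :: "(('i \<times> nat) option \<times> 'b) pair_pre_digraph" where
  "G \<equiv> cartesian_product (spider I L) H"

definition legs :: "'i \<Rightarrow> (('i \<times> nat) option \<times> 'b) set" where
  "legs a = {(Some (a, l), y) |l y. l < L \<and> y \<in> pverts H}"

lemma wf_G: "wf_sym G"
  by (rule wf_sym_cartesian[OF wf_sym_spider wf_H])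

lemma sym_G: "sym (parcs G)"
  using wf_G by (simp add: wf_sym_def)

lemma sym_H: "sym (parcs H)"
  using wf_H by (simp add: wf_sym_def)

lemma hub_arc:
  assumes "a \<in> I" "0 < L" "y \<in> pverts H"
  shows "((None, y), (Some (a, 0), y)) \<in> parcs G" "((Some (a, 0), y), (None, y)) \<in> parcs G"
  using assms by (auto simp: cartesian_product_def spider_def)

lemma leg_arc:
  assumes "a \<in> I" "Suc l < L" "y \<in> pverts H"
  shows "((Some (a, l), y), (Some (a, Suc l), y)) \<in> parcs G"
proof -
  have "(Some (a, l), Some (a, Suc l)) \<in> parcs (spider I L)"
    using assms(1,2) unfolding spider_def pair_pre_digraph.simps mem_Collect_eq prod.case
    by (intro bexI[of _ a] exI[of _ l] conjI disjI2) auto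
  then show ?thesis
    using assms by (auto simp: cartesian_product_def spider_def)
qed

lemma level_arc:
  assumes "a \<in> I" "l < L" "(y, y') \<in> parcs H"
  shows "((Some (a, l), y), (Some (a, l), y')) \<in> parcs G"
  using assms wf_H by (auto simp: cartesian_product_def spider_def wf_sym_def)

lemma conn_leg:
  assumes "a \<in> I" "j < L" "y \<in> pverts H"
  shows "conn (parcs G) ((\<lambda>l. (Some (a, l), y)) ` {..j})"
  using conn_path[OF sym_G, of 0 j "\<lambda>l. (Some (a, l), y)"] leg_arc assms
  by (auto simp: atMost_atLeast0)

lemma conn_level:
  assumes "a \<in> I" "l < L" "conn (parcs H) C"
  shows "conn (parcs G) (Pair (Some (a, l)) ` C)"
  by (rule conn_image[OF assms(3)]) (use level_arc assms in auto)

lemma conn_subpath: "path_in H q M \<Longrightarrow> i \<le> j \<Longrightarrow> j < M \<Longrightarrow> conn (parcs H) (q ` {i..j})"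
  by (rule conn_path[OF sym_H]) (auto intro: path_inD)

text \<open>The strand \<open>t\<close> descends from both ends to level \<open>t\<close>, and so passes below those ending closer to \<open>C\<close>.\<close>

lemma link:
  assumes a: "a \<in> I" and n: "0 < n" "n \<le> L"
    and y: "path_in H y n" and z: "path_in H z n"
    and yz: "y ` {..<n} \<inter> z ` {..<n} = {}"
    and C: "conn (parcs H) C" "C \<subseteq> pverts H" "C \<inter> y ` {..<n} = {y 0}" "C \<inter> z ` {..<n} = {z 0}"
  obtains R where "strands (parcs G) n R (legs a) (\<lambda>t. (Some (a, 0), y t)) (\<lambda>t. (Some (a, 0), z t))"
proof -
  define R where "R t = (\<lambda>l. (Some (a, l), y t)) ` {..t} \<union>
      Pair (Some (a, t)) ` (y ` {..t} \<union> C \<union> z ` {..t}) \<union> (\<lambda>l. (Some (a, l), z t)) ` {..t}" for t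
  \<comment> \<open>The later strand \<open>t'\<close> visits level \<open>t\<close> only over
    \<open>y t'\<close> and \<open>z t'\<close>; neither belongs to \<open>C\<close> or to the
    positions that strand \<open>t\<close> uses there.\<close>
  have disj: "R t \<inter> R t' = {}" if t: "t < t'" "t' < n" for t t'
  proof -
    have n1: "y t' \<notin> C" "z t' \<notin> C"
      using C(3,4) t path_inD(1)[OF y, of t' 0] path_inD(1)[OF z, of t' 0] by auto
    have "y t' \<noteq> y u" "z t' \<noteq> z u" if "u \<le> t" for u
      using that t path_inD(1)[OF y, of t' u] path_inD(1)[OF z, of t' u] by auto
    then have n2: "y t' \<notin> y ` {..t}" "z t' \<notin> z ` {..t}" by auto
    have n3: "y t' \<notin> z ` {..t}" "z t' \<notin> y ` {..t}"
      using t yz by fastforce+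
    have n4: "y t \<noteq> y t'" "z t \<noteq> z t'" "z t \<noteq> y t'" "y t \<noteq> z t'"
      using n2 n3 by (metis atMost_iff imageI order_refl)+
    show ?thesis
      using n1 n2 n3 n4 t unfolding R_def by auto
  qed
  have R: "conn (parcs G) (R t)" "R t \<subseteq> legs a" if t: "t < n" for t
  proof -
    have yt: "y t \<in> pverts H" "z t \<in> pverts H" using path_inD(2) y z t by auto
    have cy: "conn (parcs H) (y ` {..t})" "conn (parcs H) (z ` {..t})"
      using conn_subpath[OF y, of 0 t] conn_subpath[OF z, of 0 t] t
      by (auto simp: atMost_atLeast0)
    have "y 0 \<in> C" "z 0 \<in> C" using C(3,4) by auto
    moreover have "y 0 \<in> y ` {..t}" "z 0 \<in> z ` {..t}" by auto
    ultimately have "conn (parcs H) (y ` {..t} \<union> C \<union> z ` {..t})"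
      by (intro conn_Un[OF sym_H] cy C(1)) blast+
    then have c: "conn (parcs G) (Pair (Some (a, t)) ` (y ` {..t} \<union> C \<union> z ` {..t}))"
      using a t n by (intro conn_level) auto
    have tL: "t < L" using t n by simp
    have mem: "(Some (a, t), y t) \<in> Pair (Some (a, t)) ` (y ` {..t} \<union> C \<union> z ` {..t})"
      "(Some (a, t), z t) \<in> Pair (Some (a, t)) ` (y ` {..t} \<union> C \<union> z ` {..t})"
      "(Some (a, t), y t) \<in> (\<lambda>l. (Some (a, l), y t)) ` {..t}"
      "(Some (a, t), z t) \<in> (\<lambda>l. (Some (a, l), z t)) ` {..t}"
      by auto
    show "conn (parcs G) (R t)"
      unfolding R_def
    proof (intro conn_Un[OF sym_G] conn_leg[OF a tL] c yt disjI1)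
      show "(\<lambda>l. (Some (a, l), y t)) ` {..t} \<inter> Pair (Some (a, t)) ` (y ` {..t} \<union> C \<union> z ` {..t}) \<noteq> {}"
        using mem(1,3) by (metis IntI equals0D)
      show "((\<lambda>l. (Some (a, l), y t)) ` {..t} \<union> Pair (Some (a, t)) ` (y ` {..t} \<union> C \<union> z ` {..t})) \<inter>
          (\<lambda>l. (Some (a, l), z t)) ` {..t} \<noteq> {}"
        using mem(2,4) by (metis IntI UnI2 equals0D)
    qed
    show "R t \<subseteq> legs a"
      using t n yt path_inD(2)[OF y] path_inD(2)[OF z] C(2) unfolding R_def legs_def by auto
  qed
  have "strands (parcs G) n R (legs a) (\<lambda>t. (Some (a, 0), y t)) (\<lambda>t. (Some (a, 0), z t))"
    unfolding strands_def
  proof (intro conjI allI impI)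
    fix i j assume "i < n" "j < n" "i \<noteq> j"
    then show "R i \<inter> R j = {}" using disj[of i j] disj[of j i] by (cases i j rule: linorder_cases) auto
  next
    fix i assume "i < n"
    then show "conn (parcs G) (R i)" "R i \<subseteq> legs a" by (rule R)+
    show "(Some (a, 0), y i) \<in> R i" "(Some (a, 0), z i) \<in> R i" by (auto simp: R_def)
  qed
  then show thesis by (rule that)
qed

text \<open>A port is an interval of \<open>n\<close> positions on a path, starting at
  \<open>s\<close>. Here its positions are counted from the end facing the outside position
  \<open>m\<close>: the order in which nested strands coming from \<open>m\<close> can use
  them.\<close>

definition near :: "nat \<Rightarrow> nat \<Rightarrow> nat \<Rightarrow> nat \<Rightarrow> nat" where
  "near n m s t = (if m < s then s + t else s + n - 1 - t)"

text \<open>The connecting set is prolonged along the path, from its contact \<open>m\<close> to the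
  facing end of the port. As it touched the path nowhere else, it now meets the port exactly in that
  end, as \<open>link\<close> demands.\<close>

lemma approach_port:
  assumes q: "path_in H q M"
    and C: "conn (parcs H) C" "C \<inter> q ` {..<M} = {q m}" "m < M"
    and n: "0 < n" "s + n \<le> M" "m < s \<or> s + n \<le> m"
  obtains C' where "conn (parcs H) C'" "C \<subseteq> C'" "C' \<subseteq> C \<union> q ` {..<M}"
    "C' \<inter> (\<lambda>t. q (near n m s t)) ` {..<n} = {q (near n m s 0)}"
proof -
  define lo where "lo = (if m < s then m else s + n - 1)"
  define hi where "hi = (if m < s then s else m)"
  have lh: "lo \<le> hi" "hi < M" "m \<in> {lo..hi}" "near n m s 0 \<in> {lo..hi}"
    using C(3) n by (auto simp: lo_def hi_def near_def)
  have near: "near n m s t \<in> {lo..hi} \<Longrightarrow> t = 0" "near n m s t < M" "near n m s t \<noteq> m" if "t < n" for t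
    using that n by (auto simp: lo_def hi_def near_def split: if_splits)
  have seg: "conn (parcs H) (q ` {lo..hi})"
    by (rule conn_subpath[OF q]) (use lh in auto)
  have "conn (parcs H) (C \<union> q ` {lo..hi})"
    by (rule conn_Un[OF sym_H C(1) seg]) (use C(2) lh(3) in blast)
  moreover have "q ` {lo..hi} \<subseteq> q ` {..<M}" using lh(2) by auto
  moreover have "(C \<union> q ` {lo..hi}) \<inter> (\<lambda>t. q (near n m s t)) ` {..<n} = {q (near n m s 0)}"
  proof (intro equalityI subsetI)
    fix x assume x: "x \<in> (C \<union> q ` {lo..hi}) \<inter> (\<lambda>t. q (near n m s t)) ` {..<n}"
    then obtain t where t: "t < n" "x = q (near n m s t)" by auto
    have "x \<notin> C"
    proof
      assume "x \<in> C"
      then have "q (near n m s t) = q m" using C(2) t near(2)[OF t(1)] by auto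
      then show False using path_inD(1)[OF q] near(2,3)[OF t(1)] C(3) by auto
    qed
    then obtain p where p: "p \<in> {lo..hi}" "x = q p" using x by auto
    have "q p = q (near n m s t)" using p(2) t(2) by simp
    moreover have "p < M" using p(1) lh(2) by simp
    ultimately have "p = near n m s t"
      using path_inD(1)[OF q _ near(2)[OF t(1)]] by blast
    then have "t = 0" using near(1)[OF t(1)] p(1) by blast
    then show "x \<in> {q (near n m s 0)}" using t(2) by simp
  qed (use n lh in auto)
  ultimately show thesis by (intro that[of "C \<union> q ` {lo..hi}"]) auto
qed

lemma path_near:
  assumes q: "path_in H q M" and n: "0 < n" "s + n \<le> M"
  shows "path_in H (\<lambda>t. q (near n m s t)) n" "(\<lambda>t. q (near n m s t)) ` {..<n} \<subseteq> q ` {..<M}"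
proof -
  have lt: "near n m s t < M" if "t < n" for t using that n by (auto simp: near_def)
  show "(\<lambda>t. q (near n m s t)) ` {..<n} \<subseteq> q ` {..<M}" using lt by auto
  have "t = t'" if "t < n" "t' < n" "q (near n m s t) = q (near n m s t')" for t t'
    using that path_inD(1)[OF q lt lt] by (auto simp: near_def split: if_splits)
  moreover have "(q (near n m s t), q (near n m s (Suc t))) \<in> parcs H" if t: "Suc t < n" for t
  proof (cases "m < s")
    case True
    then show ?thesis using path_inD(4)[OF q, of "s + t"] t n by (auto simp: near_def)
  next
    case False
    have "Suc (s + n - 1 - Suc t) = s + n - 1 - t" using t by simp
    then have "(q (s + n - 1 - Suc t), q (s + n - 1 - t)) \<in> parcs H"
      using path_inD(4)[OF q, of "s + n - 1 - Suc t"] t n by simp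
    then show ?thesis using False symD[OF sym_H] by (simp add: near_def)
  qed
  ultimately show "path_in H (\<lambda>t. q (near n m s t)) n"
    using lt path_inD(2)[OF q] unfolding path_in_def inj_on_def by auto
qed

text \<open>Whether the link preserves or reverses the positions within the ports depends on the sides from
  which the connecting set \<open>C\<close> approaches them.\<close>

lemma port_link:
  assumes a: "a \<in> I" and n: "0 < n" "n \<le> L"
    and q: "path_in H q M" and q': "path_in H q' M"
    and qq': "q ` {..<M} \<inter> q' ` {..<M} = {}"
    and C: "conn (parcs H) C" "C \<subseteq> pverts H" "C \<inter> q ` {..<M} = {q m}" "C \<inter> q' ` {..<M} = {q' m'}"
    and m: "m < M" "m' < M"
    and s: "s + n \<le> M" "m < s \<or> s + n \<le> m" "s' + n \<le> M" "m' < s' \<or> s' + n \<le> m'"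
  obtains R where "strands (parcs G) n R (legs a) (\<lambda>i. (Some (a, 0), q (s + i)))
    (\<lambda>i. (Some (a, 0), q' (s' + (if (m < s) = (m' < s') then i else n - 1 - i))))"
proof -
  let ?y = "\<lambda>t. q (near n m s t)" and ?z = "\<lambda>t. q' (near n m' s' t)"
  note y = path_near[OF q n(1) s(1), of m] and z = path_near[OF q' n(1) s(3), of m']
  obtain C1 where C1: "conn (parcs H) C1" "C \<subseteq> C1" "C1 \<subseteq> C \<union> q ` {..<M}"
    "C1 \<inter> ?y ` {..<n} = {?y 0}"
    using approach_port[OF q C(1,3) m(1) n(1) s(1,2)] .
  have C1q': "C1 \<inter> q' ` {..<M} = {q' m'}" using C1(2,3) C(4) qq' by blast
  obtain C2 where C2: "conn (parcs H) C2" "C1 \<subseteq> C2" "C2 \<subseteq> C1 \<union> q' ` {..<M}"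
    "C2 \<inter> ?z ` {..<n} = {?z 0}"
    using approach_port[OF q' C1(1) C1q' m(2) n(1) s(3,4)] .
  have C2y: "C2 \<inter> ?y ` {..<n} = {?y 0}" using C2(2,3) C1(4) y(2) qq' by blast
  have C2H: "C2 \<subseteq> pverts H" using C2(3) C1(3) C(2) path_inD(3)[OF q] path_inD(3)[OF q'] by blast
  have yz: "?y ` {..<n} \<inter> ?z ` {..<n} = {}" using y(2) z(2) qq' by blast
  obtain R where R: "strands (parcs G) n R (legs a) (\<lambda>t. (Some (a, 0), ?y t)) (\<lambda>t. (Some (a, 0), ?z t))"
    using link[OF a n y(1) z(1) yz C2(1) C2H C2y C2(4)] .
  show thesis
  proof (cases "m < s")
    case True
    show thesis by (rule that[OF strands_cong[OF R]]) (use True in \<open>auto simp: near_def\<close>)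
  next
    case False
    \<comment> \<open>Here \<open>near\<close> runs through the first port backwards, so the strands
      are renumbered to start in increasing order.\<close>
    show thesis
      by (rule that[OF strands_cong[OF strands_reverse[OF R]]]) (use False in \<open>auto simp: near_def\<close>)
  qed
qed

text \<open>Two ports of one path are joined through the stretch between their facing ends. Nesting
  pairs positions by their distance from this stretch, so the order is always reversed.\<close>

lemma twist:
  assumes a: "a \<in> I" and n: "0 < n" "n \<le> L"
    and q: "path_in H q M"
    and s: "s + n \<le> s'" "s' + n \<le> M"
  obtains R where "strands (parcs G) n R (legs a) (\<lambda>i. (Some (a, 0), q (s + i)))
    (\<lambda>i. (Some (a, 0), q (s' + (n - 1 - i))))"
proof -
  let ?y = "\<lambda>t. q (near n s' s t)" and ?z = "\<lambda>t. q (near n s s' t)"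
  have sM: "s + n \<le> M" using s by simp
  note y = path_near[OF q n(1) sM, of s'] and z = path_near[OF q n(1) s(2), of s]
  have ns: "near n s' s t = s + n - 1 - t" "near n s s' t = s' + t" for t
    using s n by (auto simp: near_def)
  let ?C = "q ` {s + n - 1..s'}"
  have C: "conn (parcs H) ?C"
    by (rule conn_subpath[OF q]) (use s n in auto)
  have CH: "?C \<subseteq> pverts H"
    using path_inD(2)[OF q] s n by auto
  note inj = path_inD(1)[OF q]
  have Cy: "?C \<inter> ?y ` {..<n} = {?y 0}"
  proof (intro equalityI subsetI)
    fix x assume "x \<in> ?C \<inter> ?y ` {..<n}"
    then obtain p t where "p \<in> {s + n - 1..s'}" "t < n" "x = q p" "x = q (s + n - 1 - t)" by (auto simp: ns)
    then have "p = s + n - 1 - t" using inj[of p "s + n - 1 - t"] s n by auto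
    then have "t = 0" using \<open>p \<in> {s + n - 1..s'}\<close> \<open>t < n\<close> by auto
    then show "x \<in> {?y 0}" using \<open>x = q (s + n - 1 - t)\<close> by (simp add: ns)
  qed (use s n in \<open>auto simp: ns\<close>)
  have Cz: "?C \<inter> ?z ` {..<n} = {?z 0}"
  proof (intro equalityI subsetI)
    fix x assume "x \<in> ?C \<inter> ?z ` {..<n}"
    then obtain p t where "p \<in> {s + n - 1..s'}" "t < n" "x = q p" "x = q (s' + t)" by (auto simp: ns)
    then have "p = s' + t" using inj[of p "s' + t"] s n by auto
    then have "t = 0" using \<open>p \<in> {s + n - 1..s'}\<close> by auto
    then show "x \<in> {?z 0}" using \<open>x = q (s' + t)\<close> by (simp add: ns)
  next
    fix x assume "x \<in> {?z 0}"
    then show "x \<in> ?C \<inter> ?z ` {..<n}" using s n by (auto simp: ns intro!: image_eqI[of _ _ 0])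
  qed
  have yz: "?y ` {..<n} \<inter> ?z ` {..<n} = {}"
  proof -
    have "q (s + n - 1 - t) \<noteq> q (s' + t')" if "t < n" "t' < n" for t t'
      using inj[of "s + n - 1 - t" "s' + t'"] that s by auto
    then show ?thesis by (auto simp: ns)
  qed
  obtain R where R: "strands (parcs G) n R (legs a) (\<lambda>t. (Some (a, 0), ?y t)) (\<lambda>t. (Some (a, 0), ?z t))"
    using link[OF a n y(1) z(1) yz C CH Cy Cz] .
  show thesis
    by (rule that[OF strands_cong[OF strands_reverse[OF R]]]) (auto simp: ns)
qed

text \<open>The copies of the centre over a port. All legs are attached to them, so this is where
  strands change from one leg to another.\<close>

definition hubs :: "(nat \<Rightarrow> 'b) \<Rightarrow> nat \<Rightarrow> nat \<Rightarrow> (('i \<times> nat) option \<times> 'b) set" where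
  "hubs q s n = (\<lambda>i. (None, q (s + i))) ` {..<n}"

lemma strands_hubs:
  assumes "path_in H q M" "s + n \<le> M"
  shows "strands (parcs G) n (\<lambda>i. {(None, q (s + i))}) (hubs q s n)
    (\<lambda>i. (None, q (s + i))) (\<lambda>i. (None, q (s + i)))"
  unfolding hubs_def
proof (rule strands_points, rule inj_onI)
  fix i j assume "i \<in> {..<n}" "j \<in> {..<n}" "(None, q (s + i)) = (None, q (s + j))"
  then show "i = j" using assms(2) path_inD(1)[OF assms(1), of "s + i" "s + j"] by simp
qed

lemma legs_hubs_disjoint: "legs a \<inter> hubs q s n = {}"
  by (auto simp: legs_def hubs_def)

lemma legs_disjoint: "a \<noteq> b \<Longrightarrow> legs a \<inter> legs b = {}"
  by (auto simp: legs_def)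

lemma hubs_disjoint:
  assumes "path_in H q M" "s + n \<le> s'" "s' + n \<le> M"
  shows "hubs q s n \<inter> hubs q s' n = {}"
proof -
  have "q (s + i) \<noteq> q (s' + j)" if "i < n" "j < n" for i j
    using path_inD(1)[OF assms(1), of "s + i" "s' + j"] that assms(2,3) by auto
  then show ?thesis by (auto simp: hubs_def)
qed

lemma hubs_disjoint':
  assumes "q ` {..<M} \<inter> q' ` {..<M} = {}" "s + n \<le> M" "s' + n \<le> M"
  shows "hubs q s n \<inter> hubs q' s' n = {}"
proof -
  have "q (s + i) \<noteq> q' (s' + j)" if "i < n" "j < n" for i j
    using assms that by (metis add_less_cancel_left disjoint_iff imageI lessThan_iff order_less_le_trans)
  then show ?thesis by (auto simp: hubs_def)
qed

text \<open>If the direct link does not reverse the positions within the ports, it starts instead from a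
  second port of \<open>q\<close>, to which the strands are first led in reversed order.\<close>

lemma reversing_link:
  assumes ab: "a \<in> I" "b \<in> I" "a \<noteq> b" and n: "0 < n" "n \<le> L"
    and q: "path_in H q M" and q': "path_in H q' M"
    and qq': "q ` {..<M} \<inter> q' ` {..<M} = {}"
    and C: "conn (parcs H) C" "C \<subseteq> pverts H" "C \<inter> q ` {..<M} = {q m}" "C \<inter> q' ` {..<M} = {q' m'}"
    and m: "m < M" "m' < M"
    and s: "s1 + n \<le> s2" "s2 + n \<le> M" "m < s1 \<or> s2 + n \<le> m"
    and s': "s' + n \<le> M" "m' < s' \<or> s' + n \<le> m'"
  obtains R where "strands (parcs G) n R (legs a \<union> legs b \<union> hubs q s1 n \<union> hubs q s2 n \<union> hubs q' s' n)
    (\<lambda>i. (None, q (s1 + i))) (\<lambda>i. (None, q' (s' + (n - 1 - i))))"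
proof -
  have L: "0 < L" using n by simp
  have s1: "s1 + n \<le> M" "m < s1 \<or> s1 + n \<le> m" and s2: "m < s2 \<or> s2 + n \<le> m"
    using s by auto
  have V: "q (s1 + i) \<in> pverts H" "q (s2 + i) \<in> pverts H" "q' (s' + i) \<in> pverts H" if "i < n" for i
    using path_inD(2)[OF q] path_inD(2)[OF q'] s s' that by auto
  note h1 = strands_hubs[OF q s1(1)] and h2 = strands_reverse[OF strands_hubs[OF q s(2)]]
    and h' = strands_reverse[OF strands_hubs[OF q' s'(1)]]
  note dj = legs_hubs_disjoint hubs_disjoint[OF q s(1,2)] hubs_disjoint'[OF qq' s1(1) s'(1)]
    hubs_disjoint'[OF qq' s(2) s'(1)] legs_disjoint[OF ab(3)]
  show thesis
  proof (cases "(m < s1) = (m' < s')")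
    case False
    then obtain R where R: "strands (parcs G) n R (legs a) (\<lambda>i. (Some (a, 0), q (s1 + i)))
      (\<lambda>i. (Some (a, 0), q' (s' + (n - 1 - i))))"
      using port_link[OF ab(1) n q q' qq' C m s1 s'] by auto
    have 1: "strands (parcs G) n (\<lambda>i. {(None, q (s1 + i))} \<union> R i) (hubs q s1 n \<union> legs a)
        (\<lambda>i. (None, q (s1 + i))) (\<lambda>i. (Some (a, 0), q' (s' + (n - 1 - i))))"
    proof (rule strands_concat[OF sym_G h1 R])
      show "hubs q s1 n \<inter> legs a = {}" using dj by blast
      fix i assume "i < n"
      then show "((None, q (s1 + i)), Some (a, 0), q (s1 + i)) \<in> parcs G"
        by (intro hub_arc[OF ab(1) L] V)
    qed
    have "strands (parcs G) n (\<lambda>i. {(None, q (s1 + i))} \<union> R i \<union> {(None, q' (s' + (n - 1 - i)))})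
        (hubs q s1 n \<union> legs a \<union> hubs q' s' n)
        (\<lambda>i. (None, q (s1 + i))) (\<lambda>i. (None, q' (s' + (n - 1 - i))))"
    proof (rule strands_concat[OF sym_G 1 h'])
      show "(hubs q s1 n \<union> legs a) \<inter> hubs q' s' n = {}" using dj by blast
      fix i assume "i < n"
      then have "n - 1 - i < n" by simp
      then show "((Some (a, 0), q' (s' + (n - 1 - i))), None, q' (s' + (n - 1 - i))) \<in> parcs G"
        by (intro hub_arc(2)[OF ab(1) L] V)
    qed
    then show thesis by (rule that[OF strands_mono]) blast
  next
    case True
    \<comment> \<open>The contact \<open>m\<close> lies outside the whole stretch spanned by the two
      ports, hence on the same side of both.\<close>
    then have True': "(m < s2) = (m' < s')" using s by auto
    obtain R where R: "strands (parcs G) n R (legs a) (\<lambda>i. (Some (a, 0), q (s2 + i)))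
      (\<lambda>i. (Some (a, 0), q' (s' + i)))"
      using port_link[OF ab(1) n q q' qq' C m s(2) s2 s'] True' by auto
    obtain W where W: "strands (parcs G) n W (legs b) (\<lambda>i. (Some (b, 0), q (s1 + i)))
      (\<lambda>i. (Some (b, 0), q (s2 + (n - 1 - i))))"
      using twist[OF ab(2) n q s(1,2)] .
    have rev: "n - 1 - i < n" if "i < n" for i using that by simp
    have 1: "strands (parcs G) n (\<lambda>i. {(None, q (s1 + i))} \<union> W i) (hubs q s1 n \<union> legs b)
        (\<lambda>i. (None, q (s1 + i))) (\<lambda>i. (Some (b, 0), q (s2 + (n - 1 - i))))"
    proof (rule strands_concat[OF sym_G h1 W])
      show "hubs q s1 n \<inter> legs b = {}" using dj by blast
      fix i assume "i < n"
      then show "((None, q (s1 + i)), Some (b, 0), q (s1 + i)) \<in> parcs G"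
        by (intro hub_arc[OF ab(2) L] V)
    qed
    have 2: "strands (parcs G) n (\<lambda>i. {(None, q (s1 + i))} \<union> W i \<union> {(None, q (s2 + (n - 1 - i)))})
        (hubs q s1 n \<union> legs b \<union> hubs q s2 n)
        (\<lambda>i. (None, q (s1 + i))) (\<lambda>i. (None, q (s2 + (n - 1 - i))))"
    proof (rule strands_concat[OF sym_G 1 h2])
      show "(hubs q s1 n \<union> legs b) \<inter> hubs q s2 n = {}" using dj by blast
      fix i assume "i < n"
      then show "((Some (b, 0), q (s2 + (n - 1 - i))), None, q (s2 + (n - 1 - i))) \<in> parcs G"
        by (intro hub_arc[OF ab(2) L] V rev)
    qed
    \<comment> \<open>The twist has reversed the order already and the direct link preserves it; its
      strands are therefore taken in reversed numbering.\<close>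
    have 3: "strands (parcs G) n (\<lambda>i. {(None, q (s1 + i))} \<union> W i \<union> {(None, q (s2 + (n - 1 - i)))} \<union> R (n - 1 - i))
        (hubs q s1 n \<union> legs b \<union> hubs q s2 n \<union> legs a)
        (\<lambda>i. (None, q (s1 + i))) (\<lambda>i. (Some (a, 0), q' (s' + (n - 1 - i))))"
    proof (rule strands_concat[OF sym_G 2 strands_reverse[OF R]])
      show "(hubs q s1 n \<union> legs b \<union> hubs q s2 n) \<inter> legs a = {}" using dj by blast
      fix i assume "i < n"
      then show "((None, q (s2 + (n - 1 - i))), Some (a, 0), q (s2 + (n - 1 - i))) \<in> parcs G"
        by (intro hub_arc[OF ab(1) L] V rev)
    qed
    have "strands (parcs G) n (\<lambda>i. {(None, q (s1 + i))} \<union> W i \<union> {(None, q (s2 + (n - 1 - i)))} \<union> R (n - 1 - i)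
          \<union> {(None, q' (s' + (n - 1 - i)))})
        (hubs q s1 n \<union> legs b \<union> hubs q s2 n \<union> legs a \<union> hubs q' s' n)
        (\<lambda>i. (None, q (s1 + i))) (\<lambda>i. (None, q' (s' + (n - 1 - i))))"
    proof (rule strands_concat[OF sym_G 3 h'])
      show "(hubs q s1 n \<union> legs b \<union> hubs q s2 n \<union> legs a) \<inter> hubs q' s' n = {}" using dj by blast
      fix i assume "i < n"
      then show "((Some (a, 0), q' (s' + (n - 1 - i))), None, q' (s' + (n - 1 - i))) \<in> parcs G"
        by (intro hub_arc[OF ab(1) L] V rev)
    qed
    then show thesis by (rule that[OF strands_mono]) blast
  qed
qed

text \<open>An \<open>n \<times> n\<close> grid in a half-plane grid: all its four sides are led to the boundary (level 0), the
  rows bending upwards at both ends, and the columns passing below them to their lower ports.\<close>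

definition cell :: "nat \<Rightarrow> nat \<Rightarrow> nat \<Rightarrow> (nat \<times> nat) set" where
  "cell n i j = {(l, p).
     l = i \<and> p = n + j \<or>
     j = 0 \<and> (l \<le> i \<and> p + i + 1 = n \<or> l = i \<and> n \<le> p + i + 1 \<and> p \<le> n) \<or>
     j + 1 = n \<and> (l = i \<and> 2 * n \<le> p + 1 \<and> p \<le> 2 * n + i \<or> l \<le> i \<and> p = 2 * n + i) \<or>
     i + 1 = n \<and> (n \<le> l + 1 \<and> l + j + 1 \<le> 2 * n \<and> p = n + j \<or>
       l + j + 1 = 2 * n \<and> n + j \<le> p \<and> p + j + 1 \<le> 4 * n \<or>
       l + j + 1 \<le> 2 * n \<and> p + j + 1 = 4 * n)}"

text \<open>The bends of the rows stay at levels below \<open>n\<close> and positions below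
  \<open>3 * n\<close>, whereas the columns run sideways at level \<open>n\<close> or deeper and
  come up at position \<open>3 * n\<close> or beyond; within each bundle the bends are nested. As
  \<open>cell\<close> is written without subtraction, linear arithmetic can check this case by
  case.\<close>

lemma cell_unique:
  assumes "(l, p) \<in> cell n i j" "(l, p) \<in> cell n i' j'" "i < n" "j < n" "i' < n" "j' < n"
  shows "i = i' \<and> j = j'"
  using assms unfolding cell_def mem_Collect_eq prod.case
  by (elim disjE conjE) linarith+

lemma cell_bounds:
  assumes "(l, p) \<in> cell n i j" "i < n" "j < n"
  shows "l < 2 * n \<and> p < 4 * n"
  using assms unfolding cell_def mem_Collect_eq prod.case
  by (elim disjE conjE) linarith+

definition quarter_plane :: "((nat \<times> nat) \<times> nat \<times> nat) set" where
  "quarter_plane = {((l, p), (l', p')).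
     l = l' \<and> (p' = Suc p \<or> p = Suc p') \<or> p = p' \<and> (l' = Suc l \<or> l = Suc l')}"

lemma sym_quarter_plane: "sym quarter_plane"
  by (auto simp: sym_def quarter_plane_def)

lemma conn_box:
  assumes "a \<le> b" "c \<le> d"
  shows "conn quarter_plane ({a..b} \<times> {c..d})"
proof -
  define F where "F = {(l, l' :: nat). l' = Suc l \<or> l = Suc l'}"
  have col: "conn quarter_plane ({l} \<times> {c..d})" for l
  proof -
    have "conn quarter_plane (Pair l ` {c..d})"
      by (rule conn_path[OF sym_quarter_plane assms(2)]) (auto simp: quarter_plane_def)
    moreover have "Pair l ` {c..d} = {l} \<times> {c..d}" by auto
    ultimately show ?thesis by simp
  qed
  have "conn quarter_plane (\<Union>l\<in>id ` {a..b}. {l} \<times> {c..d})"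
  proof (rule conn_UN[where F = F])
    show "conn F (id ` {a..b})"
      by (rule conn_path[OF _ assms(1)]) (auto simp: F_def sym_def)
    fix l l' assume "(l, l') \<in> F"
    then have "((l, c), (l', c)) \<in> quarter_plane" by (auto simp: F_def quarter_plane_def)
    then show "{l} \<times> {c..d} \<inter> {l'} \<times> {c..d} \<noteq> {} \<or>
        (\<exists>x\<in>{l} \<times> {c..d}. \<exists>y\<in>{l'} \<times> {c..d}. (x, y) \<in> quarter_plane)"
      using assms(2) by (intro disjI2 bexI[of _ "(l, c)"] bexI[of _ "(l', c)"]) auto
  qed (rule col)
  moreover have "(\<Union>l\<in>id ` {a..b}. {l} \<times> {c..d}) = {a..b} \<times> {c..d}" by auto
  ultimately show ?thesis by simp
qed

lemma conn_Un_at: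
  assumes "sym E" "conn E S" "conn E T" "x \<in> S" "x \<in> T"
  shows "conn E (S \<union> T)"
  using assms conn_Un[of E S T] by blast

lemma conn_Un_if:
  assumes "sym E" "conn E S" "P \<Longrightarrow> conn E T" "P \<Longrightarrow> x \<in> S \<inter> T"
  shows "conn E (S \<union> (if P then T else {}))"
  using assms conn_Un[of E S T] by (cases P) auto

text \<open>The form from which connectedness is read off: horizontal and vertical segments,
  consecutive ones sharing a corner.\<close>

lemma cell_eq:
  assumes "i < n" "j < n"
  shows "cell n i j = {i..i} \<times> {n + j..n + j} \<union>
    (if j = 0 then {0..i} \<times> {n - 1 - i..n - 1 - i} \<union> {i..i} \<times> {n - 1 - i..n} else {}) \<union>
    (if j + 1 = n then {i..i} \<times> {2 * n - 1..2 * n + i} \<union> {0..i} \<times> {2 * n + i..2 * n + i} else {}) \<union>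
    (if i + 1 = n then {n - 1..2 * n - 1 - j} \<times> {n + j..n + j} \<union>
       {2 * n - 1 - j..2 * n - 1 - j} \<times> {n + j..4 * n - 1 - j} \<union>
       {0..2 * n - 1 - j} \<times> {4 * n - 1 - j..4 * n - 1 - j} else {})"
    (is "_ = ?R")
proof -
  have "(l, p) \<in> cell n i j \<longleftrightarrow> (l, p) \<in> ?R" for l p
  proof -
    have 1: "p + i + 1 = n \<longleftrightarrow> p = n - 1 - i" "n \<le> p + i + 1 \<longleftrightarrow> n - 1 - i \<le> p"
      "2 * n \<le> p + 1 \<longleftrightarrow> 2 * n - 1 \<le> p" "n \<le> l + 1 \<longleftrightarrow> n - 1 \<le> l"
      "l + j + 1 \<le> 2 * n \<longleftrightarrow> l \<le> 2 * n - 1 - j" "l + j + 1 = 2 * n \<longleftrightarrow> l = 2 * n - 1 - j"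
      "p + j + 1 \<le> 4 * n \<longleftrightarrow> p \<le> 4 * n - 1 - j" "p + j + 1 = 4 * n \<longleftrightarrow> p = 4 * n - 1 - j"
      using assms by linarith+
    have mem_if: "x \<in> (if P then S else {}) \<longleftrightarrow> P \<and> x \<in> S" for x :: "nat \<times> nat" and P S by simp
    have between: "a \<le> x \<and> x \<le> a \<longleftrightarrow> x = a" for x a :: nat by auto
    show ?thesis
      unfolding cell_def mem_Collect_eq prod.case 1
      by (simp only: Un_iff mem_Times_iff fst_conv snd_conv atLeastAtMost_iff mem_if between
          le0 simp_thms conj_assoc disj_assoc)
  qed
  then show ?thesis unfolding set_eq_iff split_paired_All by iprover
qed

lemma conn_cell:
  assumes ij: "i < n" "j < n"
  shows "conn quarter_plane (cell n i j)"
proof -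
  note s = sym_quarter_plane
  show ?thesis
    unfolding cell_eq[OF ij]
  proof (intro conn_Un_if[OF s, where x = "(i, n + j)"])
    show "conn quarter_plane ({i..i} \<times> {n + j..n + j})" by (rule conn_box) auto
    show "conn quarter_plane ({0..i} \<times> {n - 1 - i..n - 1 - i} \<union> {i..i} \<times> {n - 1 - i..n})"
      by (rule conn_Un_at[where x = "(i, n - 1 - i)", OF s conn_box conn_box]) (use ij in auto)
    show "conn quarter_plane ({i..i} \<times> {2 * n - 1..2 * n + i} \<union> {0..i} \<times> {2 * n + i..2 * n + i})"
      by (rule conn_Un_at[where x = "(i, 2 * n + i)", OF s conn_box conn_box]) (use ij in auto)
    show "conn quarter_plane ({n - 1..2 * n - 1 - j} \<times> {n + j..n + j} \<union>
       {2 * n - 1 - j..2 * n - 1 - j} \<times> {n + j..4 * n - 1 - j} \<union>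
       {0..2 * n - 1 - j} \<times> {4 * n - 1 - j..4 * n - 1 - j})"
      by (rule conn_Un_at[where x = "(2 * n - 1 - j, 4 * n - 1 - j)", OF s
            conn_Un_at[where x = "(2 * n - 1 - j, n + j)", OF s conn_box conn_box] conn_box]) (use ij in auto)
  qed (use ij in auto)
qed

definition place :: "'i \<Rightarrow> (nat \<Rightarrow> 'b) \<Rightarrow> nat \<times> nat \<Rightarrow> ('i \<times> nat) option \<times> 'b" where
  "place a q = (\<lambda>(l, p). (Some (a, l), q p))"

lemma place_arc:
  assumes "a \<in> I" "path_in H q M" "((l, p), (l', p')) \<in> quarter_plane" "l < L" "l' < L" "p < M" "p' < M"
  shows "(place a q (l, p), place a q (l', p')) \<in> parcs G"
proof -
  consider "l' = l" "p' = Suc p" | "l' = l" "p = Suc p'" | "p' = p" "l' = Suc l" | "p' = p" "l = Suc l'"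
    using assms(3) by (auto simp: quarter_plane_def)
  then show ?thesis
    using level_arc[OF assms(1)] leg_arc[OF assms(1)] path_inD(2,4)[OF assms(2)] assms(4-) symD[OF sym_G]
    by cases (simp_all add: place_def)
qed

lemma nonempty_imagesE:
  assumes "f ` A \<inter> f ` B \<noteq> {}"
  obtains l p l' p' where "(l, p) \<in> A" "(l', p') \<in> B" "f (l, p) = f (l', p')"
  using assms by fastforce

text \<open>The sides reach the boundary in the order left, top, right, bottom. Going round the grid
  lists the left and bottom sides backwards, whence \<open>n - 1 - i\<close> and
  \<open>n - 1 - j\<close>. A link from right to left or from bottom to top thus has to reverse the
  positions.\<close>

lemma grid_block:
  assumes a: "a \<in> I" and q: "path_in H q M" "4 * n \<le> M" and n: "2 * n \<le> L"
  defines "D \<equiv> \<lambda>i j. place a q ` cell n i j"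
  shows "i < n \<Longrightarrow> j < n \<Longrightarrow> conn (parcs G) (D i j) \<and> D i j \<subseteq> legs a"
    "i < n \<Longrightarrow> j < n \<Longrightarrow> i' < n \<Longrightarrow> j' < n \<Longrightarrow> (i, j) \<noteq> (i', j') \<Longrightarrow> D i j \<inter> D i' j' = {}"
    "i < n \<Longrightarrow> Suc j < n \<Longrightarrow> \<exists>x\<in>D i j. \<exists>y\<in>D i (Suc j). (x, y) \<in> parcs G"
    "Suc i < n \<Longrightarrow> j < n \<Longrightarrow> \<exists>x\<in>D i j. \<exists>y\<in>D (Suc i) j. (x, y) \<in> parcs G"
    "i < n \<Longrightarrow> (Some (a, 0), q (n - 1 - i)) \<in> D i 0"
    "i < n \<Longrightarrow> (Some (a, 0), q (2 * n + i)) \<in> D i (n - 1)"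
    "j < n \<Longrightarrow> (Some (a, 0), q (n + j)) \<in> D 0 j"
    "j < n \<Longrightarrow> (Some (a, 0), q (3 * n + (n - 1 - j))) \<in> D (n - 1) j"
proof -
  have bounds: "l < L \<and> p < M" if "(l, p) \<in> cell n i j" "i < n" "j < n" for l p i j
    using cell_bounds[OF that] q(2) n by simp
  show "conn (parcs G) (D i j) \<and> D i j \<subseteq> legs a" if "i < n" "j < n" for i j
  proof
    show "conn (parcs G) (D i j)"
      unfolding D_def
    proof (rule conn_image[OF conn_cell[OF that]])
      fix x y assume xy: "(x, y) \<in> quarter_plane" "x \<in> cell n i j" "y \<in> cell n i j"
      obtain l p l' p' where "x = (l, p)" "y = (l', p')" by (metis surj_pair)
      then show "place a q x = place a q y \<or> (place a q x, place a q y) \<in> parcs G"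
        using place_arc[OF a q(1)] bounds xy that by blast
    qed
    show "D i j \<subseteq> legs a"
      using bounds that path_inD(2)[OF q(1)] by (fastforce simp: D_def place_def legs_def)
  qed
  show "D i j \<inter> D i' j' = {}" if ij: "i < n" "j < n" "i' < n" "j' < n" "(i, j) \<noteq> (i', j')" for i j i' j'
  proof (rule ccontr)
    assume "D i j \<inter> D i' j' \<noteq> {}"
    then obtain l p l' p' where lp: "(l, p) \<in> cell n i j" "(l', p') \<in> cell n i' j'"
      "place a q (l, p) = place a q (l', p')" unfolding D_def by (elim nonempty_imagesE)
    then have "l = l'" "p = p'"
      using path_inD(1)[OF q(1)] bounds ij by (auto simp: place_def)
    then show False using cell_unique[of l p n i j i' j'] lp ij by auto
  qed
  have centre: "(i, n + j) \<in> cell n i j" for i j by (simp add: cell_def)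
  show "\<exists>x\<in>D i j. \<exists>y\<in>D i (Suc j). (x, y) \<in> parcs G" if "i < n" "Suc j < n" for i j
  proof -
    have "(place a q (i, n + j), place a q (i, n + Suc j)) \<in> parcs G"
      by (rule place_arc[OF a q(1)]) (use that q(2) n in \<open>auto simp: quarter_plane_def\<close>)
    then show ?thesis using centre unfolding D_def by blast
  qed
  show "\<exists>x\<in>D i j. \<exists>y\<in>D (Suc i) j. (x, y) \<in> parcs G" if "Suc i < n" "j < n" for i j
  proof -
    have "(place a q (i, n + j), place a q (Suc i, n + j)) \<in> parcs G"
      by (rule place_arc[OF a q(1)]) (use that q(2) n in \<open>auto simp: quarter_plane_def\<close>)
    then show ?thesis using centre unfolding D_def by blast
  qed
  have port: "(Some (a, 0), q p) \<in> D i j" if "(0, p) \<in> cell n i j" for p i j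
    using imageI[OF that, of "place a q"] by (simp add: D_def place_def)
  show "(Some (a, 0), q (n - 1 - i)) \<in> D i 0" if "i < n" for i
    by (rule port) (use that in \<open>auto simp: cell_def\<close>)
  show "(Some (a, 0), q (2 * n + i)) \<in> D i (n - 1)" if "i < n" for i
    by (rule port) (use that in \<open>auto simp: cell_def\<close>)
  show "(Some (a, 0), q (n + j)) \<in> D 0 j" if "j < n" for j
    by (rule port) (use that in \<open>auto simp: cell_def\<close>)
  show "(Some (a, 0), q (3 * n + (n - 1 - j))) \<in> D (n - 1) j" if "j < n" for j
    by (rule port) (use that in \<open>auto simp: cell_def\<close>)
qed

end

subsection \<open>Grids in the product with a spider\<close>

lemma path_product_grid:
  assumes G: "wf_sym G" "wf_sym H" and p: "path_in G p n" and q: "path_in H q n"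
  shows "is_minor (grid n) (cartesian_product G H)"
proof (rule grid_minorI[OF wf_sym_cartesian[OF G], where B = "\<lambda>x y. {(p x, q y)}"])
  fix x y assume "x < n" "y < n"
  then show "{(p x, q y)} \<subseteq> pverts (cartesian_product G H)"
    using path_inD(2)[OF p] path_inD(2)[OF q] by (simp add: cartesian_product_def)
next
  fix x y x' y' assume "x < n" "y < n" "x' < n" "y' < n" "(x, y) \<noteq> (x', y')"
  then show "{(p x, q y)} \<inter> {(p x', q y')} = {}"
    using path_inD(1)[OF p] path_inD(1)[OF q] by auto
next
  fix x y assume "x < n" "Suc y < n"
  then show "\<exists>a\<in>{(p x, q y)}. \<exists>b\<in>{(p x, q (Suc y))}. (a, b) \<in> parcs (cartesian_product G H)"
    using path_inD(2)[OF p] path_inD(2,4)[OF q] by (simp add: cartesian_product_def)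
next
  fix x y assume "Suc x < n" "y < n"
  then show "\<exists>a\<in>{(p x, q y)}. \<exists>b\<in>{(p (Suc x), q y)}. (a, b) \<in> parcs (cartesian_product G H)"
    using path_inD(2,4)[OF p] path_inD(2)[OF q] by (simp add: cartesian_product_def)
qed simp

text \<open>After contracting the copies of \<open>H\<close> at the inner ends of the legs, these form a complete bipartite
  graph with the copies of the centre, in which the edges of the grid can be routed independently.\<close>

lemma star_product_grid:
  assumes H: "wf_sym H" "conn (parcs H) (pverts H)" "finite (pverts H)"
    and L: "0 < L" and k: "2 * k\<^sup>2 \<le> card (pverts H)"
  shows "is_minor (grid k) (cartesian_product (spider ({..<k} \<times> {..<k}) L) H)"
proof -
  define I where "I = {..<k} \<times> {..<k}"
  interpret spider_host I L H by unfold_locales (rule H)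
  \<comment> \<open>Each grid point receives two vertices of \<open>H\<close>: the copy of the
    centre over one of them leads to the right neighbour, that over the other to the lower
    one.\<close>
  have "card (I \<times> (UNIV :: bool set)) \<le> card (pverts H)"
    using k by (simp add: I_def power2_eq_square)
  then obtain g where g: "g ` (I \<times> (UNIV :: bool set)) \<subseteq> pverts H" "inj_on g (I \<times> UNIV)"
    using card_le_inj[of "I \<times> (UNIV :: bool set)" "pverts H"] H(3) by (auto simp: I_def)
  have gH: "g ((x, y), b) \<in> pverts H" if "x < k" "y < k" for x y b
    using g(1) that by (auto simp: I_def)
  define B where "B x y = insert (None, g ((x, y), True)) (insert (None, g ((x, y), False))
      (Pair (Some ((x, y), 0 :: nat)) ` pverts H))" for x y
  have "is_minor (grid k) G"
  proof (rule grid_minorI[OF wf_G, where B = B])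
    fix x y assume xy: "x < k" "y < k"
    then show "B x y \<subseteq> pverts G"
      using gH L by (auto simp: B_def cartesian_product_def spider_def I_def)
    have "conn (parcs G) (Pair (Some ((x, y), 0)) ` pverts H)"
      using xy L H(2) by (intro conn_level) (auto simp: I_def)
    then show "conn (parcs G) (B x y)"
      unfolding B_def
      by (intro conn_insert[OF sym_G conn_insert[OF sym_G], of _ "(Some ((x, y), 0), g ((x, y), False))"
            _ "(Some ((x, y), 0), g ((x, y), True))"] insertI2 imageI hub_arc gH xy L)
        (auto simp: I_def xy)
  next
    fix x y x' y' assume xy: "x < k" "y < k" "x' < k" "y' < k" "(x, y) \<noteq> (x', y')"
    then have "g ((x, y), b) \<noteq> g ((x', y'), b')" "g ((x', y'), b') \<noteq> g ((x, y), b)" for b b'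
      using inj_onD[OF g(2), of "((x, y), b)" "((x', y'), b')"]
        inj_onD[OF g(2), of "((x', y'), b')" "((x, y), b)"] by (auto simp: I_def)
    then show "B x y \<inter> B x' y' = {}" using xy(5) by (auto simp: B_def)
  next
    fix x y assume xy: "x < k" "Suc y < k"
    then have "((None, g ((x, y), True)), (Some ((x, Suc y), 0), g ((x, y), True))) \<in> parcs G"
      using L gH by (intro hub_arc) (auto simp: I_def)
    then show "\<exists>a\<in>B x y. \<exists>b\<in>B x (Suc y). (a, b) \<in> parcs G"
      using gH xy by (intro bexI[of _ "(None, g ((x, y), True))"]
          bexI[of _ "(Some ((x, Suc y), 0), g ((x, y), True))"]) (auto simp: B_def)
  next
    fix x y assume xy: "Suc x < k" "y < k"
    then have "((None, g ((x, y), False)), (Some ((Suc x, y), 0), g ((x, y), False))) \<in> parcs G"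
      using L gH by (intro hub_arc) (auto simp: I_def)
    then show "\<exists>a\<in>B x y. \<exists>b\<in>B (Suc x) y. (a, b) \<in> parcs G"
      using gH xy by (intro bexI[of _ "(None, g ((x, y), False))"]
          bexI[of _ "(Some ((Suc x, y), 0), g ((x, y), False))"]) (auto simp: B_def)
  qed
  then show ?thesis by (simp add: I_def)
qed

text \<open>By the pigeonhole principle, four points leave one of five consecutive windows free.
  Four is the largest number of links that a block has.\<close>

lemma avoid_four:
  fixes a b c d w :: nat
  assumes "0 < w"
  obtains s where "s + w \<le> 5 * w" "\<And>x. x \<in> {a, b, c, d} \<Longrightarrow> x < s \<or> s + w \<le> x"
proof -
  have "card ((\<lambda>x. x div w) ` {a, b, c, d}) \<le> card {a, b, c, d}" by (rule card_image_le) simp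
  also have "\<dots> \<le> 4" by (simp add: card_insert_if)
  finally have "\<not> {..<5} \<subseteq> (\<lambda>x. x div w) ` {a, b, c, d}"
    using card_mono[of "(\<lambda>x. x div w) ` {a, b, c, d}" "{..<5 :: nat}"] by auto
  then obtain t where t: "t < 5" "t \<notin> (\<lambda>x. x div w) ` {a, b, c, d}" by blast
  show thesis
  proof (rule that[of "w * t"])
    have "w * t + w = (t + 1) * w" by simp
    also have "\<dots> \<le> 5 * w" using t(1) by (intro mult_right_mono) auto
    finally show "w * t + w \<le> 5 * w" .
    fix x assume "x \<in> {a, b, c, d}"
    then have "x div w \<noteq> t" using t(2) by blast
    then show "x < w * t \<or> w * t + w \<le> x"
      using assms by (metis add.commute div_nat_eqI mult.commute mult_Suc not_le)
  qed
qed

text \<open>The grid is assembled from \<open>k\<^sup>2\<close> blocks, placed on one leg of the spider times a path of \<open>H\<close>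
  each. Two further legs per side link the blocks to their right and lower neighbours. Of the path
  of a block only a part is used which all the links of the block reach from its ends.\<close>

lemma spider_product_grid:
  fixes H :: "'b pair_pre_digraph" and q :: "nat \<times> nat \<Rightarrow> nat \<Rightarrow> 'b"
  assumes H: "wf_sym H" "conn (parcs H) (pverts H)"
    and n: "0 < n" "2 * n \<le> L"
    and q: "\<And>v. v \<in> {..<k} \<times> {..<k} \<Longrightarrow> path_in H (q v) (30 * n)"
    and disj: "\<And>v w. v \<in> {..<k} \<times> {..<k} \<Longrightarrow> w \<in> {..<k} \<times> {..<k} \<Longrightarrow> v \<noteq> w \<Longrightarrow>
      q v ` {..<30 * n} \<inter> q w ` {..<30 * n} = {}"
  shows "is_minor (grid (k * n)) (cartesian_product (spider (({..<k} \<times> {..<k}) \<times> {..<5 :: nat}) L) H)"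
proof -
  define V where "V = {..<k} \<times> {..<k}"
  define I where "I = V \<times> {..<5 :: nat}"
  let ?M = "30 * n"
  interpret spider_host I L H by unfold_locales (rule H)
  have nL: "n \<le> L" "0 < L" using n by auto
  have I: "(v, c) \<in> I" if "v \<in> V" "c < 5" for v c using that by (simp add: I_def)
  have qV: "path_in H (q v) ?M" if "v \<in> V" for v using q that by (simp add: V_def)
  have dV: "q v ` {..<?M} \<inter> q w ` {..<?M} = {}" if "v \<in> V" "w \<in> V" "v \<noteq> w" for v w
    using disj that by (simp add: V_def)

  \<comment> \<open>The connecting set and its two contact positions form one triple, so that a
    single choice provides all three.\<close>
  define P where "P v w X \<longleftrightarrow> conn (parcs H) (fst X) \<and> fst X \<subseteq> pverts H \<and>
    fst X \<inter> q v ` {..<?M} = {q v (fst (snd X))} \<and> fst X \<inter> q w ` {..<?M} = {q w (snd (snd X))} \<and>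
    fst (snd X) < ?M \<and> snd (snd X) < ?M" for v w X
  have ex: "\<exists>X. P v w X" if vw: "v \<in> V" "w \<in> V" "v \<noteq> w" for v w
  proof -
    obtain C a b where C: "C \<subseteq> pverts H" "conn (parcs H) C" "C \<inter> q v ` {..<?M} = {a}"
      "C \<inter> q w ` {..<?M} = {b}"
      by (rule conn_touching_once[OF sym_H H(2) path_inD(3)[OF qV[OF vw(1)]] _
            path_inD(3)[OF qV[OF vw(2)]] _ dV[OF vw]]) (use n in \<open>auto simp: lessThan_empty_iff\<close>)
    have "a \<in> q v ` {..<?M}" "b \<in> q w ` {..<?M}" using C(3,4) by blast+
    then obtain m m' where "a = q v m" "m < ?M" "b = q w m'" "m' < ?M" by auto
    then have "P v w (C, m, m')" using C by (simp add: P_def)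
    then show ?thesis ..
  qed
  define X where "X v w = (SOME X. P v w X)" for v w
  define C where "C v w = fst (X v w)" for v w
  define m where "m v w = fst (snd (X v w))" for v w
  define m' where "m' v w = snd (snd (X v w))" for v w
  have C: "conn (parcs H) (C v w)" "C v w \<subseteq> pverts H" "C v w \<inter> q v ` {..<?M} = {q v (m v w)}"
    "C v w \<inter> q w ` {..<?M} = {q w (m' v w)}" "m v w < ?M" "m' v w < ?M"
    if "v \<in> V" "w \<in> V" "v \<noteq> w" for v w
  proof -
    have "P v w (X v w)" unfolding X_def by (rule someI_ex[OF ex[OF that]])
    then show "conn (parcs H) (C v w)" "C v w \<subseteq> pverts H" "C v w \<inter> q v ` {..<?M} = {q v (m v w)}"
      "C v w \<inter> q w ` {..<?M} = {q w (m' v w)}" "m v w < ?M" "m' v w < ?M"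
      unfolding P_def C_def m_def m'_def by iprover+
  qed

  define E where "E v = (fst v, Suc (snd v))" for v :: "nat \<times> nat"
  define S where "S v = (Suc (fst v), snd v)" for v :: "nat \<times> nat"
  \<comment> \<open>A block needs six ports of \<open>n\<close> positions: one for each side, and a
    spare one per outgoing link for the twist. Avoiding the contacts of four links with a window of
    width \<open>6 * n\<close> takes a path of \<open>30 * n\<close> vertices. At the rim of the
    array some neighbours are missing and the values of \<open>m\<close> and \<open>m'\<close> are
    arbitrary; avoiding them does no harm.\<close>
  have "\<exists>s. s + 6 * n \<le> ?M \<and> (\<forall>x\<in>{m v (E v), m v (S v), m' (fst v, snd v - 1) v, m' (fst v - 1, snd v) v}.
      x < s \<or> s + 6 * n \<le> x)" for v
    by (rule avoid_four[of "6 * n" "m v (E v)" "m v (S v)" "m' (fst v, snd v - 1) v" "m' (fst v - 1, snd v) v"])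
      (use n in auto)
  then obtain s where s: "\<And>v. s v + 6 * n \<le> ?M"
    "\<And>v x. x \<in> {m v (E v), m v (S v), m' (fst v, snd v - 1) v, m' (fst v - 1, snd v) v} \<Longrightarrow>
      x < s v \<or> s v + 6 * n \<le> x"
    by metis
  have sE: "m v (E v) < s v \<or> s v + 6 * n \<le> m v (E v)" and sE': "m' v (E v) < s (E v) \<or> s (E v) + 6 * n \<le> m' v (E v)"
    and sS: "m v (S v) < s v \<or> s v + 6 * n \<le> m v (S v)" and sS': "m' v (S v) < s (S v) \<or> s (S v) + 6 * n \<le> m' v (S v)"
    for v
    using s(2)[of "m v (E v)" v] s(2)[of "m' v (E v)" "E v"] s(2)[of "m v (S v)" v]
      s(2)[of "m' v (S v)" "S v"] by (auto simp: E_def S_def)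

  \<comment> \<open>Region 0 is the leg of the block itself, 1 and 2 are the legs of its link to the
    right, 3 and 4 those of its link downwards, and 5 to 10 its six ports. Disjointness of strands
    is thus reduced to disjointness of sets of labels.\<close>
  define reg where "reg = (\<lambda>(v, c). if c < 5 then legs (v, c) else hubs (q v) (s v + (c - 5) * n) n)"
  have regs: "reg (v, c) = legs (v, c)" if "c < 5" for v c using that by (simp add: reg_def)
  have regs': "reg (v, 5) = hubs (q v) (s v) n" "reg (v, 6) = hubs (q v) (s v + n) n"
    "reg (v, 7) = hubs (q v) (s v + 2 * n) n" "reg (v, 8) = hubs (q v) (s v + 3 * n) n"
    "reg (v, 9) = hubs (q v) (s v + 4 * n) n" "reg (v, 10) = hubs (q v) (s v + 5 * n) n" for v
    by (simp_all add: reg_def)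
  have bound: "s v + (c - 5) * n + n \<le> ?M" if "c < 11" for v c
  proof -
    have "(c - 5) * n + n = (c - 5 + 1) * n" by simp
    also have "\<dots> \<le> 6 * n" using that by (intro mult_right_mono) auto
    finally show ?thesis using s(1)[of v] by linarith
  qed
  have later: "s v + (c - 5) * n + n \<le> s v + (c' - 5) * n" if "5 \<le> c" "c < c'" for v c c'
  proof -
    have "(c - 5) * n + n = (c - 5 + 1) * n" by simp
    also have "\<dots> \<le> (c' - 5) * n" using that by (intro mult_right_mono) auto
    finally show ?thesis by simp
  qed
  have reg_disjoint: "reg \<tau> \<inter> reg \<tau>' = {}" if t: "\<tau> \<in> V \<times> {..<11}" "\<tau>' \<in> V \<times> {..<11}" "\<tau> \<noteq> \<tau>'" for \<tau> \<tau>'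
  proof -
    obtain v c v' c' where vc: "\<tau> = (v, c)" "\<tau>' = (v', c')" "v \<in> V" "v' \<in> V" "c < 11" "c' < 11"
      using t(1,2) by (elim SigmaE) simp
    consider "c < 5" "c' < 5" | "c < 5" "5 \<le> c'" | "5 \<le> c" "c' < 5"
      | "5 \<le> c" "5 \<le> c'" "v \<noteq> v'" | "5 \<le> c" "v = v'" "c < c'" | "5 \<le> c'" "v = v'" "c' < c"
      using t(3) vc(1,2) by (metis linorder_neqE_nat not_le)
    then show ?thesis
    proof cases
      case 1
      then show ?thesis using legs_disjoint[of "(v, c)" "(v', c')"] t(3) vc by (simp add: reg_def)
    next
      case 2
      then show ?thesis using legs_hubs_disjoint vc by (simp add: reg_def)
    next
      case 3
      then show ?thesis
        using legs_hubs_disjoint[of "(v', c')" "q v" "s v + (c - 5) * n" n] vc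
        by (simp add: reg_def Int_commute)
    next
      case 4
      then show ?thesis
        using hubs_disjoint'[OF dV[OF vc(3,4)] bound bound] vc by (simp add: reg_def)
    next
      case 5
      then show ?thesis
        using hubs_disjoint[OF qV[OF vc(3)] later[of c c' v] bound] vc by (simp add: reg_def)
    next
      case 6
      then show ?thesis
        using hubs_disjoint[OF qV[OF vc(3)] later[of c' c v] bound] vc by (simp add: reg_def Int_commute)
    qed
  qed
  define Reg where "Reg \<T> = (\<Union>\<tau>\<in>\<T>. reg \<tau>)" for \<T>
  have Reg_disjoint: "A \<inter> B = {}"
    if "A \<subseteq> Reg \<T>" "B \<subseteq> Reg \<T>'" "\<T> \<inter> \<T>' = {}" "\<T> \<subseteq> V \<times> {..<11}" "\<T>' \<subseteq> V \<times> {..<11}" for A B \<T> \<T>'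
  proof -
    have "reg \<tau> \<inter> reg \<tau>' = {}" if "\<tau> \<in> \<T>" "\<tau>' \<in> \<T>'" for \<tau> \<tau>'
      using reg_disjoint[of \<tau> \<tau>'] that \<open>\<T> \<inter> \<T>' = {}\<close> \<open>\<T> \<subseteq> V \<times> {..<11}\<close> \<open>\<T>' \<subseteq> V \<times> {..<11}\<close> by blast
    then have "Reg \<T> \<inter> Reg \<T>' = {}" unfolding Reg_def by blast
    then show ?thesis using that(1,2) by blast
  qed

  have Reg_Un: "Reg (\<T> \<union> \<T>') = Reg \<T> \<union> Reg \<T>'" for \<T> \<T>' by (simp add: Reg_def)
  define tD where "tD v = {(v, 0 :: nat)}" for v :: "nat \<times> nat"
  \<comment> \<open>A link owns its two legs, the outgoing and the spare port in \<open>v\<close>,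
    and the port where it arrives in the next block. Since \<open>E\<close> and \<open>S\<close> are
    injective, no label is claimed twice.\<close>
  define tE where "tE v = (if E v \<in> V then {(v, 1 :: nat), (v, 2), (v, 7), (v, 9), (E v, 5)} else {})" for v
  define tS where "tS v = (if S v \<in> V then {(v, 3 :: nat), (v, 4), (v, 8), (v, 10), (S v, 6)} else {})" for v

  have exE: "\<exists>R. strands (parcs G) n R (Reg (tE v)) (\<lambda>i. (None, q v (s v + 2 * n + i)))
      (\<lambda>i. (None, q (E v) (s (E v) + (n - 1 - i))))" if v: "v \<in> V" "E v \<in> V" for v
  proof -
    have ne: "v \<noteq> E v" by (simp add: E_def prod_eq_iff)
    obtain R where "strands (parcs G) n R (legs (v, 1) \<union> legs (v, 2) \<union> hubs (q v) (s v + 2 * n) n \<union>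
        hubs (q v) (s v + 4 * n) n \<union> hubs (q (E v)) (s (E v)) n)
      (\<lambda>i. (None, q v (s v + 2 * n + i))) (\<lambda>i. (None, q (E v) (s (E v) + (n - 1 - i))))"
      by (rule reversing_link[OF I[OF v(1), of 1] I[OF v(1), of 2] _ n(1) nL(1) qV[OF v(1)] qV[OF v(2)]
            dV[OF v ne] C[OF v ne], of "s v + 2 * n" "s v + 4 * n" "s (E v)"])
        (use s(1)[of v] s(1)[of "E v"] sE[of v] sE'[of v] in auto)
    moreover have "Reg (tE v) = legs (v, 1) \<union> legs (v, 2) \<union> hubs (q v) (s v + 2 * n) n \<union>
        hubs (q v) (s v + 4 * n) n \<union> hubs (q (E v)) (s (E v)) n"
      using v(2) by (simp add: Reg_def tE_def regs regs' Un_assoc)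
    ultimately show ?thesis by auto
  qed
  have exS: "\<exists>R. strands (parcs G) n R (Reg (tS v)) (\<lambda>i. (None, q v (s v + 3 * n + i)))
      (\<lambda>i. (None, q (S v) (s (S v) + n + (n - 1 - i))))" if v: "v \<in> V" "S v \<in> V" for v
  proof -
    have ne: "v \<noteq> S v" by (simp add: S_def prod_eq_iff)
    obtain R where "strands (parcs G) n R (legs (v, 3) \<union> legs (v, 4) \<union> hubs (q v) (s v + 3 * n) n \<union>
        hubs (q v) (s v + 5 * n) n \<union> hubs (q (S v)) (s (S v) + n) n)
      (\<lambda>i. (None, q v (s v + 3 * n + i))) (\<lambda>i. (None, q (S v) (s (S v) + n + (n - 1 - i))))"
      by (rule reversing_link[OF I[OF v(1), of 3] I[OF v(1), of 4] _ n(1) nL(1) qV[OF v(1)] qV[OF v(2)]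
            dV[OF v ne] C[OF v ne], of "s v + 3 * n" "s v + 5 * n" "s (S v) + n"])
        (use s(1)[of v] s(1)[of "S v"] sS[of v] sS'[of v] in auto)
    moreover have "Reg (tS v) = legs (v, 3) \<union> legs (v, 4) \<union> hubs (q v) (s v + 3 * n) n \<union>
        hubs (q v) (s v + 5 * n) n \<union> hubs (q (S v)) (s (S v) + n) n"
      using v(2) by (simp add: Reg_def tS_def regs regs' Un_assoc)
    ultimately show ?thesis by auto
  qed
  obtain RE where RE: "\<And>v. v \<in> V \<Longrightarrow> E v \<in> V \<Longrightarrow> strands (parcs G) n (RE v) (Reg (tE v))
      (\<lambda>i. (None, q v (s v + 2 * n + i))) (\<lambda>i. (None, q (E v) (s (E v) + (n - 1 - i))))"
    using exE by metis
  obtain RS where RS: "\<And>v. v \<in> V \<Longrightarrow> S v \<in> V \<Longrightarrow> strands (parcs G) n (RS v) (Reg (tS v))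
      (\<lambda>i. (None, q v (s v + 3 * n + i))) (\<lambda>i. (None, q (S v) (s (S v) + n + (n - 1 - i))))"
    using exS by metis

  define D where "D v i j = place (v, 0) (\<lambda>p. q v (s v + p)) ` cell n i j" for v i j
  have qs: "path_in H (\<lambda>p. q v (s v + p)) (4 * n)" if "v \<in> V" for v
    by (rule path_in_shift[OF qV[OF that]]) (use s(1)[of v] in simp)
  have D: "i < n \<Longrightarrow> j < n \<Longrightarrow> conn (parcs G) (D v i j) \<and> D v i j \<subseteq> legs (v, 0)"
    "i < n \<Longrightarrow> j < n \<Longrightarrow> i' < n \<Longrightarrow> j' < n \<Longrightarrow> (i, j) \<noteq> (i', j') \<Longrightarrow> D v i j \<inter> D v i' j' = {}"
    "i < n \<Longrightarrow> Suc j < n \<Longrightarrow> \<exists>x\<in>D v i j. \<exists>y\<in>D v i (Suc j). (x, y) \<in> parcs G"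
    "Suc i < n \<Longrightarrow> j < n \<Longrightarrow> \<exists>x\<in>D v i j. \<exists>y\<in>D v (Suc i) j. (x, y) \<in> parcs G"
    "i < n \<Longrightarrow> (Some ((v, 0), 0), q v (s v + (n - 1 - i))) \<in> D v i 0"
    "i < n \<Longrightarrow> (Some ((v, 0), 0), q v (s v + (2 * n + i))) \<in> D v i (n - 1)"
    "j < n \<Longrightarrow> (Some ((v, 0), 0), q v (s v + (n + j))) \<in> D v 0 j"
    "j < n \<Longrightarrow> (Some ((v, 0), 0), q v (s v + (3 * n + (n - 1 - j)))) \<in> D v (n - 1) j"
    if "v \<in> V" for v i j i' j'
    unfolding D_def by (fact grid_block[OF I[OF that, of 0, simplified] qs[OF that] order_refl n(2)])+

  \<comment> \<open>Outgoing strands are absorbed by the last column and the last row of their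
    block. They end in a copy of the centre, one edge away from the cell of the next block that
    awaits them.\<close>
  define pE where "pE v i j = (if j + 1 = n \<and> E v \<in> V then RE v i else {})" for v i j
  \<comment> \<open>The lower port lists the columns backwards, so column \<open>j\<close> leaves
    through strand \<open>n - 1 - j\<close>.\<close>
  define pS where "pS v i j = (if i + 1 = n \<and> S v \<in> V then RS v (n - 1 - j) else {})" for v i j
  define B where "B v i j = D v i j \<union> pE v i j \<union> pS v i j" for v i j
  have qH: "q v (s v + p) \<in> pverts H" if "v \<in> V" "p < 6 * n" for v p
    using path_inD(2)[OF qV[OF that(1)]] s(1)[of v] that(2) by simp
  have hub: "((None, q v (s v + p)), (Some ((v, 0), 0), q v (s v + p))) \<in> parcs G"
      "((Some ((v, 0), 0), q v (s v + p)), (None, q v (s v + p))) \<in> parcs G"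
    if "v \<in> V" "p < 6 * n" for v p
    using hub_arc[OF I[OF that(1), of 0] nL(2) qH[OF that]] by auto

  have pieces: "D v i j \<subseteq> Reg (tD v)" "pE v i j \<subseteq> Reg (tE v)" "pS v i j \<subseteq> Reg (tS v)"
    if v: "v \<in> V" "i < n" "j < n" for v i j
  proof -
    have "Reg (tD v) = legs (v, 0)" by (simp add: Reg_def tD_def regs)
    then show "D v i j \<subseteq> Reg (tD v)" using D(1)[OF v] by simp
    show "pE v i j \<subseteq> Reg (tE v)" using RE[OF v(1)] v by (simp add: pE_def strands_def)
    have "n - 1 - j < n" using n by simp
    then show "pS v i j \<subseteq> Reg (tS v)" using RS[OF v(1)] by (simp add: pS_def strands_def)
  qed
  have tags: "tD v \<subseteq> V \<times> {..<11}" "tE v \<subseteq> V \<times> {..<11}" "tS v \<subseteq> V \<times> {..<11}" if "v \<in> V" for v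
    using that by (auto simp: tD_def tE_def tS_def)
  have Reg_sub: "Reg \<T> \<subseteq> pverts G" if "\<T> \<subseteq> V \<times> {..<11}" for \<T>
  proof -
    have "reg (v, c) \<subseteq> pverts G" if vc: "v \<in> V" "c < 11" for v c
    proof (cases "c < 5")
      case True
      then show ?thesis
        using I[OF vc(1)] by (auto simp: regs legs_def cartesian_product_def spider_def)
    next
      case False
      have "q v (s v + (c - 5) * n + i) \<in> pverts H" if "i < n" for i
        using path_inD(2)[OF qV[OF vc(1)]] bound[OF vc(2), of v] that by simp
      then show ?thesis
        using False by (auto simp: reg_def hubs_def cartesian_product_def spider_def)
    qed
    then show ?thesis using that unfolding Reg_def by blast
  qed

  have conn_B: "conn (parcs G) (B v i j)" if v: "v \<in> V" "i < n" "j < n" for v i j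
  proof -
    have "conn (parcs G) (D v i j \<union> pE v i j)"
    proof (cases "j + 1 = n \<and> E v \<in> V")
      case True
      then have j: "j = n - 1" by auto
      have "(None, q v (s v + (2 * n + i))) \<in> RE v i" "conn (parcs G) (RE v i)"
        using RE[OF v(1)] True v(2) by (auto simp: strands_def add.assoc)
      moreover have "(Some ((v, 0), 0), q v (s v + (2 * n + i))) \<in> D v i j"
        using D(6)[OF v(1,2)] j by simp
      moreover have "2 * n + i < 6 * n" using v(2) by simp
      ultimately have "conn (parcs G) (D v i j \<union> RE v i)"
        using D(1)[OF v] hub(2)[OF v(1), of "2 * n + i"] by (intro conn_Un[OF sym_G]) blast+
      then show ?thesis using True by (simp add: pE_def)
    next
      case False
      then have "pE v i j = {}" by (auto simp: pE_def)
      then show ?thesis using D(1)[OF v] by simp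
    qed
    moreover have "conn (parcs G) (X \<union> pS v i j)" if X: "conn (parcs G) X" "D v i j \<subseteq> X" for X
    proof (cases "i + 1 = n \<and> S v \<in> V")
      case True
      then have i: "i = n - 1" by auto
      have "n - 1 - j < n" using v(3) by simp
      then have "(None, q v (s v + (3 * n + (n - 1 - j)))) \<in> RS v (n - 1 - j)"
          "conn (parcs G) (RS v (n - 1 - j))"
        using RS[OF v(1)] True by (auto simp: strands_def add.assoc)
      moreover have "(Some ((v, 0), 0), q v (s v + (3 * n + (n - 1 - j)))) \<in> X"
        using D(8)[OF v(1,3)] i X(2) by auto
      moreover have "3 * n + (n - 1 - j) < 6 * n" using v(3) by simp
      ultimately have "conn (parcs G) (X \<union> RS v (n - 1 - j))"
        using X(1) hub(2)[OF v(1), of "3 * n + (n - 1 - j)"] by (intro conn_Un[OF sym_G]) blast+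
      then show ?thesis using True by (simp add: pS_def)
    next
      case False
      then have "pS v i j = {}" by (auto simp: pS_def)
      then show ?thesis using X(1) by simp
    qed
    ultimately show ?thesis unfolding B_def by blast
  qed

  have disjoint_B: "B v i j \<inter> B v' i' j' = {}"
    if v: "v \<in> V" "i < n" "j < n" and v': "v' \<in> V" "i' < n" "j' < n" and ne: "(v, i, j) \<noteq> (v', i', j')"
    for v i j v' i' j'
  proof (cases "v = v'")
    case False
    have "B v i j \<subseteq> Reg (tD v \<union> tE v \<union> tS v)" "B v' i' j' \<subseteq> Reg (tD v' \<union> tE v' \<union> tS v')"
      using pieces[OF v] pieces[OF v'] unfolding B_def Reg_Un by (simp_all only: Un_mono)
    moreover have "E v \<noteq> E v'" "S v \<noteq> S v'" using False by (auto simp: E_def S_def prod_eq_iff)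
    then have "(tD v \<union> tE v \<union> tS v) \<inter> (tD v' \<union> tE v' \<union> tS v') = {}"
      using False by (auto simp: tD_def tE_def tS_def)
    ultimately show ?thesis
      by (rule Reg_disjoint) (use tags[OF v(1)] tags[OF v'(1)] in auto)
  next
    case True
    have DD: "D v i j \<inter> D v i' j' = {}" using D(2)[OF v v'(2,3)] ne True by auto
    have EE: "pE v i j \<inter> pE v i' j' = {}"
    proof (cases "j + 1 = n \<and> j' + 1 = n \<and> E v \<in> V")
      case c: True
      then have "i \<noteq> i'" using ne True by auto
      then show ?thesis using RE[OF v(1)] c v v' by (auto simp: pE_def strands_def)
    qed (auto simp: pE_def)
    have SS: "pS v i j \<inter> pS v i' j' = {}"
    proof (cases "i + 1 = n \<and> i' + 1 = n \<and> S v \<in> V")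
      case c: True
      then have "n - 1 - j \<noteq> n - 1 - j'" using ne True v v' by auto
      moreover have "n - 1 - j < n" "n - 1 - j' < n" using n by auto
      ultimately show ?thesis using RS[OF v(1)] c v v' by (auto simp: pS_def strands_def)
    qed (auto simp: pS_def)
    have t: "tD v \<inter> tE v = {}" "tD v \<inter> tS v = {}" "tE v \<inter> tS v = {}"
      by (auto simp: tD_def tE_def tS_def)
    note p = pieces[OF v] and p' = pieces[OF v'(1)[folded True] v'(2,3)] and T = tags[OF v(1)]
    show ?thesis
      unfolding B_def True[symmetric] Int_Un_distrib Int_Un_distrib2 Un_empty
      using DD EE SS Reg_disjoint[OF p(1) p'(2) t(1) T(1,2)] Reg_disjoint[OF p(1) p'(3) t(2) T(1,3)]
        Reg_disjoint[OF p(2) p'(3) t(3) T(2,3)] Reg_disjoint[OF p'(1) p(2) t(1) T(1,2)]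
        Reg_disjoint[OF p'(1) p(3) t(2) T(1,3)] Reg_disjoint[OF p'(2) p(3) t(3) T(2,3)] by (simp add: Int_commute)
  qed

  have adjE: "\<exists>a\<in>B v i (n - 1). \<exists>b\<in>B (E v) i 0. (a, b) \<in> parcs G" if v: "v \<in> V" "E v \<in> V" "i < n" for v i
  proof -
    have "(None, q (E v) (s (E v) + (n - 1 - i))) \<in> pE v i (n - 1)"
      using RE[OF v(1,2)] v n by (auto simp: pE_def strands_def)
    moreover have "(Some ((E v, 0), 0), q (E v) (s (E v) + (n - 1 - i))) \<in> D (E v) i 0"
      using D(5)[OF v(2,3)] .
    moreover have "n - 1 - i < 6 * n" using n by simp
    ultimately show ?thesis using hub(1)[OF v(2), of "n - 1 - i"] unfolding B_def by blast
  qed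
  have adjS: "\<exists>a\<in>B v (n - 1) j. \<exists>b\<in>B (S v) 0 j. (a, b) \<in> parcs G" if v: "v \<in> V" "S v \<in> V" "j < n" for v j
  proof -
    \<comment> \<open>The reversal by the lower port and the reversal by the link cancel, so that
      column \<open>j\<close> meets column \<open>j\<close>.\<close>
    have j: "n - 1 - j < n" "n - 1 - (n - 1 - j) = j" using v n by auto
    have "(None, q (S v) (s (S v) + n + (n - 1 - (n - 1 - j)))) \<in> RS v (n - 1 - j)"
      using RS[OF v(1,2)] j(1) unfolding strands_def by blast
    then have "(None, q (S v) (s (S v) + (n + j))) \<in> pS v (n - 1) j"
      unfolding j(2) using v(2) n by (simp add: pS_def add.assoc)
    moreover have "(Some ((S v, 0), 0), q (S v) (s (S v) + (n + j))) \<in> D (S v) 0 j"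
      using D(7)[OF v(2,3)] .
    moreover have "n + j < 6 * n" using v by simp
    ultimately show ?thesis using hub(1)[OF v(2), of "n + j"] unfolding B_def by blast
  qed

  have div: "x div n < k" "x mod n < n" if "x < k * n" for x
    using that n by (auto simp: less_mult_imp_div_less)
  have step: "(x mod n + 1 < n \<and> Suc x div n = x div n \<and> Suc x mod n = Suc (x mod n)) \<or>
      (x mod n = n - 1 \<and> Suc x div n = Suc (x div n) \<and> Suc x mod n = 0)" for x
    using mod_less_divisor[OF n(1), of x] by (auto simp: div_Suc mod_Suc)
  have "is_minor (grid (k * n)) G"
  proof (rule grid_minorI[OF wf_G, where B = "\<lambda>x y. B (x div n, y div n) (x mod n) (y mod n)"])
    fix x y assume xy: "x < k * n" "y < k * n"
    then have v: "(x div n, y div n) \<in> V" "x mod n < n" "y mod n < n" using div by (auto simp: V_def)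
    show "conn (parcs G) (B (x div n, y div n) (x mod n) (y mod n))" by (rule conn_B[OF v])
    show "B (x div n, y div n) (x mod n) (y mod n) \<subseteq> pverts G"
      using pieces[OF v] Reg_sub[OF tags(1)[OF v(1)]] Reg_sub[OF tags(2)[OF v(1)]]
        Reg_sub[OF tags(3)[OF v(1)]] unfolding B_def by blast
    fix x' y' assume xy': "x' < k * n" "y' < k * n" "(x, y) \<noteq> (x', y')"
    then have v': "(x' div n, y' div n) \<in> V" "x' mod n < n" "y' mod n < n" using div by (auto simp: V_def)
    have "((x div n, y div n), x mod n, y mod n) \<noteq> ((x' div n, y' div n), x' mod n, y' mod n)"
      using xy'(3) by (metis Pair_inject div_mult_mod_eq)
    then show "B (x div n, y div n) (x mod n) (y mod n) \<inter> B (x' div n, y' div n) (x' mod n) (y' mod n) = {}"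
      by (rule disjoint_B[OF v v'])
  next
    fix x y assume xy: "x < k * n" "Suc y < k * n"
    let ?v = "(x div n, y div n)"
    have v: "?v \<in> V" "x mod n < n" using div xy by (auto simp: V_def)
    from step[of y] show "\<exists>a\<in>B ?v (x mod n) (y mod n).
        \<exists>b\<in>B (x div n, Suc y div n) (x mod n) (Suc y mod n). (a, b) \<in> parcs G"
    proof
      assume a: "y mod n + 1 < n \<and> Suc y div n = y div n \<and> Suc y mod n = Suc (y mod n)"
      then show ?thesis using D(3)[OF v(1,2), of "y mod n"] unfolding B_def by (simp only:) auto
    next
      assume a: "y mod n = n - 1 \<and> Suc y div n = Suc (y div n) \<and> Suc y mod n = 0"
      moreover have "E ?v \<in> V" using a div[OF xy(1)] div[OF xy(2)] by (simp add: E_def V_def)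
      ultimately show ?thesis using adjE[OF v(1) _ v(2)] by (simp add: E_def)
    qed
  next
    fix x y assume xy: "Suc x < k * n" "y < k * n"
    let ?v = "(x div n, y div n)"
    have v: "?v \<in> V" "y mod n < n" using div xy by (auto simp: V_def)
    from step[of x] show "\<exists>a\<in>B ?v (x mod n) (y mod n).
        \<exists>b\<in>B (Suc x div n, y div n) (Suc x mod n) (y mod n). (a, b) \<in> parcs G"
    proof
      assume a: "x mod n + 1 < n \<and> Suc x div n = x div n \<and> Suc x mod n = Suc (x mod n)"
      then show ?thesis using D(4)[OF v(1) _ v(2), of "x mod n"] unfolding B_def by (simp only:) auto
    next
      assume a: "x mod n = n - 1 \<and> Suc x div n = Suc (x div n) \<and> Suc x mod n = 0"
      moreover have "S ?v \<in> V" using a div[OF xy(1)] div[OF xy(2)] by (simp add: S_def V_def)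
      ultimately show ?thesis using adjS[OF v(1) _ v(2)] by (simp add: S_def)
    qed
  qed
  then show ?thesis by (simp add: I_def V_def)
qed

subsection \<open>Grids in products of trees\<close>

lemma ex_square_bracket:
  fixes m :: nat
  obtains k where "k\<^sup>2 \<le> m" "m < (Suc k)\<^sup>2"
proof -
  have "\<exists>k. k\<^sup>2 \<le> m \<and> m < (Suc k)\<^sup>2"
  proof (induction m)
    case (Suc m)
    then obtain k where k: "k\<^sup>2 \<le> m" "m < (Suc k)\<^sup>2" by blast
    show ?case
    proof (cases "Suc m < (Suc k)\<^sup>2")
      case True
      then show ?thesis using k by (intro exI[of _ k]) simp
    next
      case False
      then have "Suc m = (Suc k)\<^sup>2" using k by simp
      then show ?thesis by (intro exI[of _ "Suc k"]) (simp add: power2_eq_square)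
    qed
  qed (auto intro: exI[of _ 0])
  then show thesis using that by blast
qed

lemma (in rooted_tree) path_in_tree:
  assumes "pverts T = V" "parcs T = E" "x \<in> V" "n \<le> Suc (ht x)"
  shows "path_in T (\<lambda>i. (child ^^ i) x) n"
proof -
  have "i = j" if "i < n" "j < n" "(child ^^ i) x = (child ^^ j) x" for i j
    using child_chains_disjoint(2)[of x x i j] that assms(3,4) by simp
  moreover have "(child ^^ i) x \<in> V" if "i < n" for i
    using funpow_child[of x i] that assms(3,4) by simp
  moreover have "((child ^^ i) x, (child ^^ Suc i) x) \<in> E" if "Suc i < n" for i
    using child_adjacent[of x i] that assms(3,4) by simp
  ultimately show ?thesis
    unfolding path_in_def inj_on_def assms(1,2) by (auto simp del: funpow.simps)
qed

text \<open>Here \<open>L\<close> plays the part of the smaller scale: rich in \<open>T1\<close>,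
  with all lower levels sparse in \<open>T2\<close>. The constant stems from the case in which legs
  are scarce: five legs per block turn the factor 4 of the scale into 20, and rounding
  \<open>L\<close> and \<open>k\<close> costs 60^2 and 2^2.\<close>

lemma gm_cartesian_ge:
  fixes T1 :: "'a pair_pre_digraph" and T2 :: "'b pair_pre_digraph"
  assumes T1: "undirected_tree T1" and T2: "undirected_tree T2"
    and r1: "rooted_tree (pverts T1) (parcs T1) r1 par1 dep1"
    and r2: "rooted_tree (pverts T2) (parcs T2) r2 par2 dep2"
    and L: "0 < L" "card (pverts T1) \<le> 4 * L\<^sup>2 * card (rooted_tree.level (pverts T1) par1 dep1 (L - 1))"
    "\<And>i. i < L - 1 \<Longrightarrow>
      4 * (Suc i)\<^sup>2 * card (rooted_tree.level (pverts T2) par2 dep2 i) < card (pverts T2)"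
  shows "min (card (pverts T1)) (card (pverts T2)) \<le> 288000 * (gm (cartesian_product T1 T2))\<^sup>2"
proof -
  interpret A: rooted_tree "pverts T1" "parcs T1" r1 par1 dep1 by (rule r1)
  interpret B: rooted_tree "pverts T2" "parcs T2" r2 par2 dep2 by (rule r2)
  note T1 = undirected_treeD[OF T1] and T2 = undirected_treeD[OF T2]
  let ?G = "cartesian_product T1 T2"
  define g where "g = gm ?G"
  define p where "p = card (A.level (L - 1))"
  define K where "K = card (B.path_tops L)"
  let ?N1 = "card (pverts T1)" and ?N2 = "card (pverts T2)"
  have wf: "wf_sym ?G" using T1(1) T2(1) by (rule wf_sym_cartesian)
  have fin: "finite (pverts ?G)" using T1(2) T2(2) by (simp add: cartesian_product_def)
  have ne: "pverts ?G \<noteq> {}" using T1(4) T2(4) by (simp add: cartesian_product_def)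
  have ge: "k \<le> g" if "is_minor (grid k) ?G" for k
    using gm_ge[OF wf fin _ that] unfolding g_def by (cases "k = 0") auto
  have g1: "1 \<le> g" unfolding g_def by (rule gm_minor(1)[OF wf fin ne])
  have N1: "?N1 \<le> 4 * L\<^sup>2 * p" using L(2) by (simp add: p_def)
  have N2: "?N2 \<le> 2 * L * K" using B.card_path_tops_ge[OF L(1,3)] by (simp add: K_def)
  have pos: "0 < ?N1" "0 < ?N2" using T1 T2 by (auto simp: card_gt_0_iff)
  have finp: "finite (A.level (L - 1))" using T1(2) by (simp add: A.level_def)
  have finK: "finite (B.path_tops L)" using T2(2) by (simp add: B.path_tops_def)

  have path2: "path_in T2 (\<lambda>i. (B.child ^^ i) x) L" if "x \<in> B.path_tops L" for x
    using that B.path_tops_ht[OF that, of "L - 1"] L(1)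
    by (intro B.path_in_tree) (auto simp: B.path_tops_def)
  \<comment> \<open>A descending path of \<open>T1\<close> times one of \<open>T2\<close> is already
    a grid of order \<open>L\<close>. This pays for the cases with few blocks or none.\<close>
  have Lg: "L \<le> g"
  proof -
    have "0 < p" "0 < K" using N1 N2 pos by (auto intro: gr0I)
    then obtain x y where x: "x \<in> A.level (L - 1)" and y: "y \<in> B.path_tops L"
      by (metis K_def card_gt_0_iff ex_in_conv p_def)
    have "path_in T1 (\<lambda>i. (A.child ^^ i) x) L"
      using x L(1) by (intro A.path_in_tree) (auto simp: A.level_def)
    then have "is_minor (grid L) ?G"
      by (rule path_product_grid[OF T1(1) T2(1) _ path2[OF y]])
    then show ?thesis by (rule ge)
  qed
  have via_spider: "k \<le> g"
    if J: "is_minor (grid k) (cartesian_product (spider J L) T2)" "finite J" "card J \<le> p" "L \<le> A.ht r1"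
    for k and J :: "'j set"
  proof -
    obtain f where "f ` J \<subseteq> A.level (L - 1)" "inj_on f J"
      using card_le_inj[OF J(2) finp] J(3) unfolding p_def by blast
    then have "is_minor (spider J L) (spider (A.level (L - 1)) L)"
      by (intro spider_minor_mono)
    then have "is_minor (spider J L) T1"
      by (rule is_minor_trans[OF _ A.spider_minor[OF T1(1) refl refl L(1) J(4)] wf_sym_spider wf_sym_spider T1(1)])
    then have "is_minor (cartesian_product (spider J L) T2) ?G"
      by (rule cartesian_minor_mono[OF _ wf_sym_spider T1(1) T2(1)])
    then have "is_minor (grid k) ?G"
      by (rule is_minor_trans[OF J(1) _ wf_sym_grid wf_sym_cartesian[OF wf_sym_spider T2(1)] wf])
    then show ?thesis by (rule ge)
  qed

  \<comment> \<open>With \<open>A.ht r1 < L\<close> there is no centre to contract, and with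
    \<open>L < 30\<close> the block size \<open>L div 30\<close> would be 0.\<close>
  consider "A.ht r1 < L" | "L \<le> A.ht r1" "L < 30" | "L \<le> A.ht r1" "30 \<le> L" by linarith
  then have "min ?N1 ?N2 \<le> 288000 * g\<^sup>2"
  proof cases
    case 1
    then have "p \<le> 1" unfolding p_def by (intro A.card_level_root) simp
    then have "?N1 \<le> 4 * L\<^sup>2" using N1 by (metis le_trans mult_le_mono2 mult.right_neutral)
    also have "\<dots> \<le> 4 * g\<^sup>2" using Lg by (simp add: power_mono)
    finally show ?thesis by (simp add: min_le_iff_disj)
  next
    case 2
    obtain k where k: "k\<^sup>2 \<le> min p (?N2 div 2)" "min p (?N2 div 2) < (Suc k)\<^sup>2"
      by (rule ex_square_bracket)
    have "is_minor (grid k) (cartesian_product (spider ({..<k} \<times> {..<k}) L) T2)"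
      by (rule star_product_grid[OF T2(1,3,2) L(1)]) (use k(1) in linarith)
    then have "k \<le> g"
      by (rule via_spider) (use k(1) 2 in \<open>simp_all add: power2_eq_square\<close>)
    then have "Suc k \<le> 2 * g" using g1 by simp
    then have k2: "(Suc k)\<^sup>2 \<le> 4 * g\<^sup>2" using power_mono[of "Suc k" "2 * g" 2] by (simp add: power_mult_distrib)
    have "p < (Suc k)\<^sup>2 \<or> ?N2 div 2 < (Suc k)\<^sup>2" using k(2) by (simp add: min_less_iff_disj)
    then show ?thesis
    proof
      assume "p < (Suc k)\<^sup>2"
      then have "p \<le> 4 * g\<^sup>2" using k2 by simp
      moreover have "L\<^sup>2 \<le> 30\<^sup>2" using 2 by (intro power_mono) auto
      ultimately have "L\<^sup>2 * p \<le> 900 * (4 * g\<^sup>2)" by (intro mult_le_mono) auto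
      then show ?thesis using N1 by linarith
    next
      assume "?N2 div 2 < (Suc k)\<^sup>2"
      then show ?thesis using k2 by linarith
    qed
  next
    case 3
    \<comment> \<open>A path with \<open>L\<close> vertices must offer \<open>30 * n\<close>
      positions to a block; since \<open>30 \<le> L\<close>, rounding down loses less than half of
      them.\<close>
    define n where "n = L div 30"
    have "30 * n + L mod 30 = L" "L mod 30 < 30" "0 < n"
      using 3(2) unfolding n_def by (simp_all add: div_greater_zero_iff)
    then have n: "0 < n" "2 * n \<le> L" "30 * n \<le> L" "L \<le> 60 * n"
      by linarith+
    obtain k where k: "k\<^sup>2 \<le> min (p div 5) K" "min (p div 5) K < (Suc k)\<^sup>2"
      by (rule ex_square_bracket)
    have "card ({..<k} \<times> {..<k}) \<le> card (B.path_tops L)"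
      using k(1) by (simp add: K_def power2_eq_square)
    then obtain f where f: "f ` ({..<k} \<times> {..<k}) \<subseteq> B.path_tops L" "inj_on f ({..<k} \<times> {..<k})"
      using card_le_inj[of "{..<k} \<times> {..<k}" "B.path_tops L"] finK by auto
    define q where "q v i = (B.child ^^ i) (f v)" for v i
    have "is_minor (grid (k * n)) (cartesian_product (spider (({..<k} \<times> {..<k}) \<times> {..<5 :: nat}) L) T2)"
    proof (rule spider_product_grid[OF T2(1,3) n(1,2)])
      fix v assume "v \<in> {..<k} \<times> {..<k}"
      then have "path_in T2 (q v) L" using path2 f(1) unfolding q_def by blast
      then show "path_in T2 (q v) (30 * n)" using path_in_shift[of T2 "q v" L 0 "30 * n"] n(3) by simp
    next
      fix v w assume vw: "v \<in> {..<k} \<times> {..<k}" "w \<in> {..<k} \<times> {..<k}" "v \<noteq> w"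
      have "f v \<in> B.path_tops L" "f w \<in> B.path_tops L" using f(1) vw by blast+
      moreover have "f v \<noteq> f w" using inj_onD[OF f(2) _ vw(1,2)] vw(3) by blast
      ultimately have "q v i \<noteq> q w j" if "i < L" "j < L" for i j
        using B.path_tops_disjoint[of "f v" L "f w" i j] that unfolding q_def by blast
      then show "q v ` {..<30 * n} \<inter> q w ` {..<30 * n} = {}" using n(3) by fastforce
    qed
    moreover have "k * k \<le> p div 5" using k(1) by (simp add: power2_eq_square)
    then have "5 * (k * k) \<le> p" by linarith
    ultimately have "k * n \<le> g"
      by (intro via_spider[of "k * n" "({..<k} \<times> {..<k}) \<times> {..<5 :: nat}"]) (use 3 in \<open>simp_all add: mult.commute\<close>)
    moreover have "n \<le> g" using n(2) Lg by simp
    \<comment> \<open>The step from \<open>k\<close> to \<open>Suc k\<close>, due to rounding down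
      the square root, is paid for by \<open>n \<le> g\<close>, even if \<open>k\<close> is
      0.\<close>
    ultimately have "Suc k * n \<le> 2 * g" by simp
    then have "(Suc k * n)\<^sup>2 \<le> (2 * g)\<^sup>2" by (rule power_mono) simp
    then have kn: "(Suc k)\<^sup>2 * n\<^sup>2 \<le> 4 * g\<^sup>2" by (simp add: power_mult_distrib del: mult_Suc)
    have L2: "L\<^sup>2 \<le> 3600 * n\<^sup>2"
      using power_mono[OF n(4), of 2] by (simp add: power_mult_distrib)
    have main: "L\<^sup>2 * (Suc k)\<^sup>2 \<le> 14400 * g\<^sup>2"
    proof -
      have "L\<^sup>2 * (Suc k)\<^sup>2 \<le> 3600 * n\<^sup>2 * (Suc k)\<^sup>2" using L2 by (rule mult_le_mono1)
      also have "\<dots> = 3600 * ((Suc k)\<^sup>2 * n\<^sup>2)" by (simp only: mult_ac)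
      also have "\<dots> \<le> 3600 * (4 * g\<^sup>2)" using kn by (rule mult_le_mono2)
      finally show ?thesis by simp
    qed
    have "p div 5 < (Suc k)\<^sup>2 \<or> K < (Suc k)\<^sup>2" using k(2) by (simp add: min_less_iff_disj)
    then show ?thesis
    proof
      assume "p div 5 < (Suc k)\<^sup>2"
      then have "p \<le> 5 * (Suc k)\<^sup>2" by linarith
      then have "L\<^sup>2 * p \<le> L\<^sup>2 * (5 * (Suc k)\<^sup>2)" by (rule mult_le_mono2)
      then have "?N1 \<le> 20 * (L\<^sup>2 * (Suc k)\<^sup>2)" using N1 by linarith
      then show ?thesis using main by linarith
    next
      assume "K < (Suc k)\<^sup>2"
      moreover have "L \<le> L\<^sup>2" by (simp add: power2_nat_le_imp_le)
      ultimately have "L * K \<le> L\<^sup>2 * (Suc k)\<^sup>2" by (intro mult_le_mono) auto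
      then show ?thesis using N2 main by linarith
    qed
  qed
  then show ?thesis by (simp add: g_def)
qed

lemma gm_cartesian_swap_le:
  assumes "undirected_tree T1" "undirected_tree T2"
  shows "gm (cartesian_product T2 T1) \<le> gm (cartesian_product T1 T2)"
proof -
  note T1 = undirected_treeD[OF assms(1)] and T2 = undirected_treeD[OF assms(2)]
  show ?thesis
    by (rule gm_mono[OF cartesian_swap_minor])
      (use T1 T2 wf_sym_cartesian in \<open>auto simp: cartesian_product_def\<close>)
qed

text \<open>The tree with the smaller of the two least scales supplies the spider; swapping the
  factors covers both orders.\<close>

lemma gm_cartesian_quadratic:
  assumes T1: "undirected_tree T1" and T2: "undirected_tree T2"
  shows "min (card (pverts T1)) (card (pverts T2)) \<le> 288000 * (gm (cartesian_product T1 T2))\<^sup>2"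
proof -
  obtain r1 par1 dep1 where r1: "rooted_tree (pverts T1) (parcs T1) r1 par1 dep1"
    using undirected_tree_rooted[OF T1] .
  obtain r2 par2 dep2 where r2: "rooted_tree (pverts T2) (parcs T2) r2 par2 dep2"
    using undirected_tree_rooted[OF T2] .
  interpret A: rooted_tree "pverts T1" "parcs T1" r1 par1 dep1 by (rule r1)
  interpret B: rooted_tree "pverts T2" "parcs T2" r2 par2 dep2 by (rule r2)
  obtain L1 where L1: "0 < L1" "card (pverts T1) \<le> 4 * L1\<^sup>2 * card (A.level (L1 - 1))"
    "\<And>i. i < L1 - 1 \<Longrightarrow> 4 * (Suc i)\<^sup>2 * card (A.level i) < card (pverts T1)"
    using A.ex_scale by blast
  obtain L2 where L2: "0 < L2" "card (pverts T2) \<le> 4 * L2\<^sup>2 * card (B.level (L2 - 1))"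
    "\<And>i. i < L2 - 1 \<Longrightarrow> 4 * (Suc i)\<^sup>2 * card (B.level i) < card (pverts T2)"
    using B.ex_scale by blast
  show ?thesis
  proof (cases "L1 \<le> L2")
    case True
    show ?thesis
      by (rule gm_cartesian_ge[OF T1 T2 r1 r2 L1(1,2)]) (use L2(3) True in simp)
  next
    case False
    have "min (card (pverts T2)) (card (pverts T1)) \<le> 288000 * (gm (cartesian_product T2 T1))\<^sup>2"
      by (rule gm_cartesian_ge[OF T2 T1 r2 r1 L2(1,2)]) (use L1(3) False in simp)
    also have "\<dots> \<le> 288000 * (gm (cartesian_product T1 T2))\<^sup>2"
      using gm_cartesian_swap_le[OF T1 T2] by (simp add: power_mono)
    finally show ?thesis by (simp add: min.commute)
  qed
qed

lemma strong_product_arc: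
  assumes T1: "undirected_tree T1" and T2: "undirected_tree T2"
    and "\<not> (card (pverts T1) = 1 \<and> card (pverts T2) = 1)"
  obtains u v where "(u, v) \<in> parcs (strong_product T1 T2)" "u \<noteq> v"
proof -
  have arc: "\<exists>x y. (x, y) \<in> parcs T \<and> x \<noteq> y \<and> x \<in> pverts T \<and> y \<in> pverts T"
    if T: "undirected_tree T" "card (pverts T) \<noteq> 1" for T :: "'c pair_pre_digraph"
  proof -
    note t = undirected_treeD[OF T(1)]
    obtain x where x: "x \<in> pverts T" using t(4) by auto
    have "pverts T \<noteq> {x}" using T(2) by auto
    then obtain z where "z \<in> pverts T" "z \<noteq> x" using x by auto
    then obtain u v where "(u, v) \<in> parcs T" "u \<in> {x}" "v \<notin> {x}" "u \<in> pverts T" "v \<in> pverts T"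
      using conn_crossing_edge[OF t(3) x, of "{x}" z] by blast
    then show ?thesis by blast
  qed
  obtain a b where ab: "a \<in> pverts T1" "b \<in> pverts T2"
    using undirected_treeD(4)[OF T1] undirected_treeD(4)[OF T2] by auto
  show thesis
  proof (cases "card (pverts T1) = 1")
    case False
    then obtain x y where "(x, y) \<in> parcs T1" "x \<noteq> y" "x \<in> pverts T1" "y \<in> pverts T1"
      using arc[OF T1] by blast
    then show thesis using ab by (intro that[of "(x, b)" "(y, b)"]) (auto simp: strong_product_def)
  next
    case True
    then obtain x y where "(x, y) \<in> parcs T2" "x \<noteq> y" "x \<in> pverts T2" "y \<in> pverts T2"
      using arc[OF T2] assms(3) by blast
    then show thesis using ab by (intro that[of "(a, x)" "(a, y)"]) (auto simp: strong_product_def)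
  qed
qed

text \<open>The middle inequality excludes the product with a single vertex, for which
  \<open>gm\<close> is 1 but the treewidth is 0. The constant doubles that of
  \<open>gm_cartesian_quadratic\<close>, because the bags consist of two fibres.\<close>

theorem theorem8:
  shows "\<exists>C::real. C > 0 \<and>
    (\<forall>(T1 :: nat pair_pre_digraph) (T2 :: nat pair_pre_digraph).
       undirected_tree T1 \<and> undirected_tree T2 \<longrightarrow>
         gm (cartesian_product T1 T2) \<le> gm (strong_product T1 T2) \<and>
         (\<not> (card (pverts T1) = 1 \<and> card (pverts T2) = 1) \<longrightarrow>
            gm (strong_product T1 T2) \<le> treewidth (strong_product T1 T2)) \<and>
         real (treewidth (strong_product T1 T2)) \<le> C * (real (gm (cartesian_product T1 T2)))\<^sup>2)"
proof (intro exI[of _ 576000] conjI allI impI)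
  fix T1 T2 :: "nat pair_pre_digraph"
  assume T: "undirected_tree T1 \<and> undirected_tree T2"
  then have T1: "undirected_tree T1" and T2: "undirected_tree T2" by auto
  note t1 = undirected_treeD[OF T1] and t2 = undirected_treeD[OF T2]
  let ?C = "cartesian_product T1 T2" and ?S = "strong_product T1 T2"
  have wf: "wf_sym ?S" "wf_sym ?C" using t1(1) t2(1) by (simp_all add: wf_sym_strong wf_sym_cartesian)
  have fin: "finite (pverts ?S)" "finite (pverts ?C)"
    using t1(2) t2(2) by (simp_all add: strong_product_def cartesian_product_def)
  have "pverts ?C \<noteq> {}" using t1(4) t2(4) by (simp add: cartesian_product_def)
  then show "gm ?C \<le> gm ?S"
    by (rule gm_mono[OF cartesian_minor_strong[OF t1(1) t2(1)] wf fin])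
  obtain bag1 bag2 where
    bag1: "tree_decomposition ?S T1 bag1" "decomposition_width T1 bag1 \<le> 2 * card (pverts T2)" and
    bag2: "tree_decomposition ?S T2 bag2" "decomposition_width T2 bag2 \<le> 2 * card (pverts T1)"
    using strong_product_decompositions[OF T1 T2] .
  show "gm ?S \<le> treewidth ?S" if nontriv: "\<not> (card (pverts T1) = 1 \<and> card (pverts T2) = 1)"
  proof -
    obtain u v where uv: "(u, v) \<in> parcs ?S" "u \<noteq> v"
      using strong_product_arc[OF T1 T2 nontriv] .
    obtain T :: "nat pair_pre_digraph" and bag
      where "tree_decomposition ?S T bag" "decomposition_width T bag = treewidth ?S"
      using treewidth_attained[OF bag1(1)] .
    then show ?thesis using gm_le_width[OF wf(1) fin(1) uv] by metis
  qed
  have "treewidth ?S \<le> 2 * min (card (pverts T1)) (card (pverts T2))"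
    using treewidth_le[OF bag1(1)] treewidth_le[OF bag2(1)] bag1(2) bag2(2) by linarith
  then have "treewidth ?S \<le> 576000 * (gm ?C)\<^sup>2"
    using gm_cartesian_quadratic[OF T1 T2] by linarith
  then have "real (treewidth ?S) \<le> real (576000 * (gm ?C)\<^sup>2)" by (simp only: of_nat_le_iff)
  then show "real (treewidth ?S) \<le> 576000 * (real (gm ?C))\<^sup>2" by simp
qed simp

end
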